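(* Let $\mathcal{A}_{\mathfrak{q}}(Q)$ be the Kronecker quantum cluster algebra with principal coefficients over an indeterminate $\mathfrak{q}$, and let $$\mathcal{B}=\{\text{cluster monomials}\}\sqcup\{F_n \mid n\geq 1\}.$$ Then $\mathcal{B}$ is the bar-invariant atomic $\mathbb{Z}[\mathfrak{q}^{\pm\frac12}][y_1^{\pm},y_2^{\pm}]$-basis of $\mathcal{A}_{\mathfrak{q}}(Q)$; that is, $\mathcal{B}$ is a basis of $\mathcal{A}_{\mathfrak{q}}(Q)$ over $\mathbb{Z}[\mathfrak{q}^{\pm\frac12}][y_1^{\pm},y_2^{\pm}]$, every element of $\mathcal{B}$ is invariant under the bar-involution, and the positive elements of $\mathcal{A}_{\mathfrak{q}}(Q)$ are exactly the $\mathbb{Z}_{\geq 0}[\mathfrak{q}^{\pm\frac12}][y_1^{\pm},y_2^{\pm}]$-combinations of elements of $\mathcal{B}$.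
   Context: Let $\mathfrak{q}$ be an indeterminate. Let $\Lambda$ be the skew-symmetric bilinear form on $\mathbb{Z}^4$ (natural basis $e_1,\dots,e_4$) with $\Lambda(e_1,e_3)=-1$, $\Lambda(e_2,e_4)=-1$, $\Lambda(e_3,e_4)=-2$, $\Lambda(e_1,e_2)=\Lambda(e_1,e_4)=\Lambda(e_2,e_3)=0$. The quantum torus $\mathcal{T}_{\mathfrak q}$ is the $\mathbb{Z}[\mathfrak{q}^{\pm 1/2}]$-algebra with basis $\{X^{e}: e\in\mathbb{Z}^4\}$ and product $X^{e}X^{f}=\mathfrak{q}^{\Lambda(e,f)/2}X^{e+f}$; $\mathcal{F}_{\mathfrak q}$ is its skew-field of fractions. The bar-involution is the $\mathbb{Z}$-linear map with $\overline{\mathfrak{q}^{r/2}X^e}=\mathfrak{q}^{-r/2}X^e$. Let $\widetilde{B}$ be the $4\times2$ matrix with rows $(0,2),(-2,0),(1,0),(0,1)$. The initial quantum seed is $(\Lambda,\widetilde B,X)$ with $X=\{X_1,\dots,X_4\}$, $X_i=X^{e_i}$. For a quantum seed $(\Lambda,\widetilde B=(b_{ij}),X)$, write $X^a=\mathfrak{q}^{-\frac12\sum_{i<j}a_ia_j\Lambda_{ij}}X_1^{a_1}X_2^{a_2}X_3^{a_3}X_4^{a_4}$ for $a\in\mathbb{Z}^4$. For $k\in\{1,2\}$ its mutation in direction $k$ is $(\Lambda',\widetilde B',X')$ with: $\Lambda'=E^{tr}\Lambda E$, where $e_{ij}=\delta_{ij}$ if $j\neq k$, $e_{kk}=-1$,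 $e_{ik}=[-b_{ik}]_+$ for $i\neq k$; $b'_{ij}=-b_{ij}$ if $i=k$ or $j=k$, and $b'_{ij}=b_{ij}+[b_{ik}]_+b_{kj}+b_{ik}[-b_{kj}]_+$ otherwise; $X'_i=X_i$ for $i\neq k$ and $X'_k=X^{\sum_j[b_{jk}]_+e_j-e_k}+X^{\sum_j[-b_{jk}]_+e_j-e_k}$. Here $[a]_+=\max\{0,a\}$. For every seed obtained from the initial one by finitely many mutations, its first two elements $\{X'_1,X'_2\}$ form a cluster, whose elements are cluster variables. Cluster monomials are the elements $X'^{(a_1,a_2,0,0)}$ with $a_1,a_2\in\mathbb{Z}_{\ge0}$, for all such seeds. The coefficients are $y_1=X^{(0,0,1,0)}$, $y_2=X^{(0,0,0,1)}$ (they lie in every seed). $\mathbb{Z}[\mathfrak{q}^{\pm1/2}][y_1^{\pm},y_2^{\pm}]$ denotes the ring of Laurent polynomials in the ($\mathfrak q$-commuting) elements $y_1,y_2$ inside $\mathcal{T}_{\mathfrak q}$, and $\mathbb{Z}_{\ge0}[\mathfrak{q}^{\pm1/2}][y_1^{\pm},y_2^{\pm}]$ the subset of those with coefficients in $\mathbb{Z}_{\geq0}[\mathfrak q^{\pm1/2}]$. $\mathcal{A}_{\mathfrak q}(Q)$ is the $\mathbb{Z}[\mathfrak{q}^{\pm1/2}][y_1^{\pm},y_2^{\pm}]$-subalgebra of $\mathcal{F}_{\mathfrak q}$ generated by all cluster variables; by the quantum Laurent phenomenon each of its elements is, for every cluster, a Laurent polynomial in the elements of that cluster with coefficients in $\mathbb{Z}[\mathfrak{q}^{\pm1/2}][y_1^{\pm},y_2^{\pm}]$.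 An element of $\mathcal{A}_{\mathfrak q}(Q)$ is called positive if for every cluster the coefficients of its Laurent expansion in that cluster belong to $\mathbb{Z}_{\ge0}[\mathfrak{q}^{\pm1/2}][y_1^{\pm},y_2^{\pm}]$. Bases and linear combinations over $\mathbb{Z}[\mathfrak{q}^{\pm1/2}][y_1^{\pm},y_2^{\pm}]$ are understood with coefficients multiplied on the left. Let $X_\delta=X^{(1,-1,1,1)}+X^{(-1,-1,1,0)}+X^{(-1,1,0,0)}$. Define $F_0=1$, $F_1=X_\delta$, $F_2=F_1F_1-2X^{(0,0,1,1)}$, and $F_{n+1}=F_nF_1-X^{(0,0,1,1)}F_{n-1}$ for $n\ge 2$. *)

theory Defs
  imports Complex_Main "HOL-Library.Poly_Mapping" "HOL-Library.Product_Plus"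
begin

section \<open>The quantum torus\<close>

type_synonym int4 = "int \<times> int \<times> int \<times> int"

fun coord :: "int4 \<Rightarrow> nat \<Rightarrow> int" where
  "coord (a, b, c, d) i =
     (if i = 1 then a else if i = 2 then b else if i = 3 then c else if i = 4 then d else 0)"

definition unit4 :: "nat \<Rightarrow> int4" where
  "unit4 i = (of_bool (i = 1), of_bool (i = 2), of_bool (i = 3), of_bool (i = 4))"

text \<open>
  All matrices are functions of 1-based indices. Only the entries with row index in
  \<open>{1..4}\<close> and column index in \<open>{1..4}\<close>, respectively \<open>{1..2}\<close>, carry meaning.
\<close>

definition Lambda0 :: "nat \<Rightarrow> nat \<Rightarrow> int" where
  "Lambda0 i j =
     (if (i, j) = (1, 3) \<or> (i, j) = (2, 4) then - 1
      else if (i, j) = (3, 1) \<or> (i, j) = (4, 2) then 1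
      else if (i, j) = (3, 4) then - 2
      else if (i, j) = (4, 3) then 2
      else 0)"

definition LambdaForm :: "int4 \<Rightarrow> int4 \<Rightarrow> int" where
  "LambdaForm e f = (\<Sum>i = 1..4. \<Sum>j = 1..4. coord e i * Lambda0 i j * coord f j)"

lemma LambdaForm_explicit:
  "LambdaForm (e1, e2, e3, e4) (f1, f2, f3, f4) =
     (e3 * f1 - e1 * f3) + (e4 * f2 - e2 * f4) + 2 * (e4 * f3 - e3 * f4)"
proof -
  have "{1..4::nat} = {1, 2, 3, 4}" by auto
  then show ?thesis
    by (simp add: LambdaForm_def Lambda0_def algebra_simps)
qed

text \<open>
  \<open>QMon r e\<close> stands for \<open>q\<^sup>r\<^sup>/\<^sup>2 X\<^sup>e\<close>. These elements form a (noncommutative) group under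
  multiplication in the quantum torus; it is written additively here, so that the convolution
  product of \<open>HOL-Library.Poly_Mapping\<close> on finitely supported functions \<open>qmon \<Rightarrow>\<^sub>0 int\<close> is the
  product of the quantum torus: as a ring, the quantum torus is the integral group ring of this
  group, with \<open>\<int>\<close>-basis the elements \<open>q\<^sup>r\<^sup>/\<^sup>2 X\<^sup>e\<close>.
\<close>

datatype qmon = QMon (qexp: int) (xexp: int4)

instantiation qmon :: monoid_add
begin

definition zero_qmon :: qmon where
  "zero_qmon = QMon 0 0"

definition plus_qmon :: "qmon \<Rightarrow> qmon \<Rightarrow> qmon" where
  "plus_qmon m n =
     QMon (qexp m + qexp n + LambdaForm (xexp m) (xexp n)) (xexp m + xexp n)"

instance
proof
  fix a b c :: qmon
  obtain a1 a2 a3 a4 where a: "xexp a = (a1, a2, a3, a4)" by (cases "xexp a")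
  obtain b1 b2 b3 b4 where b: "xexp b = (b1, b2, b3, b4)" by (cases "xexp b")
  obtain c1 c2 c3 c4 where c: "xexp c = (c1, c2, c3, c4)" by (cases "xexp c")
  show "a + b + c = a + (b + c)"
    by (simp add: plus_qmon_def a b c plus_prod_def LambdaForm_explicit algebra_simps)
  show "0 + a = a"
    by (cases a) (use a in \<open>simp add: plus_qmon_def zero_qmon_def zero_prod_def plus_prod_def
      LambdaForm_explicit\<close>)
  show "a + 0 = a"
    by (cases a) (use a in \<open>simp add: plus_qmon_def zero_qmon_def zero_prod_def plus_prod_def
      LambdaForm_explicit\<close>)
qed

end

type_synonym qtorus = "qmon \<Rightarrow>\<^sub>0 int"

definition qhalf :: "int \<Rightarrow> qtorus" where  \<comment> \<open>\<open>q\<^sup>r\<^sup>/\<^sup>2\<close>\<close>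
  "qhalf r = Poly_Mapping.single (QMon r 0) 1"

definition X0 :: "int4 \<Rightarrow> qtorus" where  \<comment> \<open>\<open>X\<^sup>e\<close>\<close>
  "X0 e = Poly_Mapping.single (QMon 0 e) 1"

lemma qhalf_mult_X0: "qhalf r * X0 e = Poly_Mapping.single (QMon r e) 1"
  by (cases e) (simp add: qhalf_def X0_def mult_single plus_qmon_def zero_prod_def
    plus_prod_def LambdaForm_explicit)

lemma X0_mult: "X0 e * X0 f = qhalf (LambdaForm e f) * X0 (e + f)"
  by (simp add: qhalf_mult_X0) (simp add: X0_def mult_single plus_qmon_def)

lemma qhalf_add: "qhalf r * qhalf s = qhalf (r + s)"
  by (simp add: qhalf_def mult_single plus_qmon_def zero_prod_def plus_prod_def
    LambdaForm_explicit)

lemma qhalf_central: "qhalf r * t = t * qhalf r"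
  using subset_UNIV
proof (induction t rule: frag_induction)
  case (one m)
  show ?case
    by (cases m, cases "xexp m") (simp add: qhalf_def mult_single plus_qmon_def zero_prod_def
      plus_prod_def LambdaForm_explicit add.commute)
qed (simp_all add: algebra_simps)

text \<open>The constant \<open>frag_extend\<close> is \<open>\<int>\<close>-linear extension from the basis.\<close>

definition bar :: "qtorus \<Rightarrow> qtorus" where
  "bar = frag_extend (\<lambda>m. Poly_Mapping.single (QMon (- qexp m) (xexp m)) 1)"

lemma bar_basis: "bar (qhalf r * X0 e) = qhalf (- r) * X0 e"
  by (simp add: bar_def qhalf_mult_X0)

text \<open>
  The Laurent polynomials in \<open>y\<^sub>1\<close>, \<open>y\<^sub>2\<close>, as the elements of the quantum torus supported on the
  monomials \<open>X\<^sup>(\<^sup>0\<^sup>,\<^sup>0\<^sup>,\<^sup>c\<^sup>,\<^sup>d\<^sup>)\<close>, which equal \<open>y\<^sub>1\<^sup>c y\<^sub>2\<^sup>d\<close> up to a power of \<open>q\<^sup>1\<^sup>/\<^sup>2\<close>.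
\<close>

definition ZP :: "qtorus set" where
  "ZP = {t. \<forall>m \<in> Poly_Mapping.keys t. coord (xexp m) 1 = 0 \<and> coord (xexp m) 2 = 0}"

definition ZP_nonneg :: "qtorus set" where
  "ZP_nonneg = {t \<in> ZP. \<forall>m. 0 \<le> Poly_Mapping.lookup t m}"

definition X_delta :: qtorus where
  "X_delta = X0 (1, - 1, 1, 1) + X0 (- 1, - 1, 1, 0) + X0 (- 1, 1, 0, 0)"

fun F :: "nat \<Rightarrow> qtorus" where
  "F 0 = 1"
| "F (Suc 0) = X_delta"
| "F (Suc (Suc 0)) = X_delta * X_delta - 2 * X0 (0, 0, 1, 1)"
| "F (Suc (Suc (Suc n))) = F (Suc (Suc n)) * X_delta - X0 (0, 0, 1, 1) * F (Suc n)"


section \<open>Skew-field of fractions, seeds and mutations\<close>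

text \<open>
  \<open>\<iota>\<close> exhibits the division ring \<open>'f\<close> as the (Ore) skew-field of fractions of the quantum
  torus. This determines \<open>'f\<close> up to a unique isomorphism compatible with \<open>\<iota>\<close>.
\<close>

definition is_fraction_skew_field :: "(qtorus \<Rightarrow> 'f::division_ring) \<Rightarrow> bool" where
  "is_fraction_skew_field \<iota> \<longleftrightarrow>
     \<iota> 1 = 1 \<and> (\<forall>s t. \<iota> (s + t) = \<iota> s + \<iota> t) \<and> (\<forall>s t. \<iota> (s * t) = \<iota> s * \<iota> t) \<and> inj \<iota> \<and>
     (\<forall>z. \<exists>s t. t \<noteq> 0 \<and> z = \<iota> s * inverse (\<iota> t))"

record 'f qseed =
  Lam :: "nat \<Rightarrow> nat \<Rightarrow> int"
  Bt :: "nat \<Rightarrow> nat \<Rightarrow> int"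
  Xs :: "nat \<Rightarrow> 'f"

definition seed_monomial ::
  "(qtorus \<Rightarrow> 'f::division_ring) \<Rightarrow> 'f qseed \<Rightarrow> (nat \<Rightarrow> int) \<Rightarrow> 'f" where
  "seed_monomial \<iota> S a =
     \<iota> (qhalf (- (\<Sum>j = 1..4. \<Sum>i = 1..<j. a i * a j * Lam S i j))) *
     (Xs S 1 powi a 1 * Xs S 2 powi a 2 * Xs S 3 powi a 3 * Xs S 4 powi a 4)"

definition mutation_E :: "nat \<Rightarrow> (nat \<Rightarrow> nat \<Rightarrow> int) \<Rightarrow> nat \<Rightarrow> nat \<Rightarrow> int" where
  "mutation_E k B i j =
     (if j \<noteq> k then of_bool (i = j) else if i = k then - 1 else max 0 (- B i k))"

definition mutate :: "(qtorus \<Rightarrow> 'f::division_ring) \<Rightarrow> nat \<Rightarrow> 'f qseed \<Rightarrow> 'f qseed" where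
  "mutate \<iota> k S =
     (let B = Bt S; E = mutation_E k B in
      \<lparr> Lam = (\<lambda>i j. \<Sum>p = 1..4. \<Sum>r = 1..4. E p i * Lam S p r * E r j),
        Bt = (\<lambda>i j. if i = k \<or> j = k then - B i j
                     else B i j + max 0 (B i k) * B k j + B i k * max 0 (- B k j)),
        Xs = (Xs S)(k := seed_monomial \<iota> S (\<lambda>j. max 0 (B j k) - of_bool (j = k)) +
                         seed_monomial \<iota> S (\<lambda>j. max 0 (- B j k) - of_bool (j = k))) \<rparr>)"

definition B0 :: "nat \<Rightarrow> nat \<Rightarrow> int" where
  "B0 i j =
     (if (i, j) = (1, 2) then 2
      else if (i, j) = (2, 1) then - 2
      else if (i, j) = (3, 1) \<or> (i, j) = (4, 2) then 1
      else 0)"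

definition initial_seed :: "(qtorus \<Rightarrow> 'f::division_ring) \<Rightarrow> 'f qseed" where
  "initial_seed \<iota> = \<lparr> Lam = Lambda0, Bt = B0, Xs = (\<lambda>i. \<iota> (X0 (unit4 i))) \<rparr>"

inductive_set seeds :: "(qtorus \<Rightarrow> 'f::division_ring) \<Rightarrow> 'f qseed set"
  for \<iota> :: "qtorus \<Rightarrow> 'f::division_ring" where
  initial: "initial_seed \<iota> \<in> seeds \<iota>"
| mutation: "S \<in> seeds \<iota> \<Longrightarrow> k \<in> {1, 2} \<Longrightarrow> mutate \<iota> k S \<in> seeds \<iota>"

definition cluster_variables :: "(qtorus \<Rightarrow> 'f::division_ring) \<Rightarrow> 'f set" where
  "cluster_variables \<iota> = (\<Union>S \<in> seeds \<iota>. {Xs S 1, Xs S 2})"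

definition cluster_exp :: "int \<Rightarrow> int \<Rightarrow> nat \<Rightarrow> int" where  \<comment> \<open>\<open>(a\<^sub>1, a\<^sub>2, 0, 0)\<close>\<close>
  "cluster_exp a1 a2 = coord (a1, a2, 0, 0)"

definition cluster_monomials :: "(qtorus \<Rightarrow> 'f::division_ring) \<Rightarrow> 'f set" where
  "cluster_monomials \<iota> =
     {seed_monomial \<iota> S (cluster_exp a1 a2) | S a1 a2. S \<in> seeds \<iota> \<and> 0 \<le> a1 \<and> 0 \<le> a2}"

inductive_set cluster_algebra :: "(qtorus \<Rightarrow> 'f::division_ring) \<Rightarrow> 'f set"
  for \<iota> :: "qtorus \<Rightarrow> 'f::division_ring" where
  coeff: "c \<in> ZP \<Longrightarrow> \<iota> c \<in> cluster_algebra \<iota>"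
| variable: "x \<in> cluster_variables \<iota> \<Longrightarrow> x \<in> cluster_algebra \<iota>"
| add: "x \<in> cluster_algebra \<iota> \<Longrightarrow> y \<in> cluster_algebra \<iota> \<Longrightarrow> x + y \<in> cluster_algebra \<iota>"
| mult: "x \<in> cluster_algebra \<iota> \<Longrightarrow> y \<in> cluster_algebra \<iota> \<Longrightarrow> x * y \<in> cluster_algebra \<iota>"


section \<open>Left linear combinations, bases and positivity\<close>

definition left_combinations :: "'f::ring_1 set \<Rightarrow> 'f set \<Rightarrow> 'f set" where
  "left_combinations R B =
     {\<Sum>b \<in> B'. c b * b | B' c. finite B' \<and> B' \<subseteq> B \<and> (\<forall>b \<in> B'. c b \<in> R)}"

definition left_independent :: "'f::ring_1 set \<Rightarrow> 'f set \<Rightarrow> bool" where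
  "left_independent R B \<longleftrightarrow>
     (\<forall>B' c. finite B' \<and> B' \<subseteq> B \<and> (\<forall>b \<in> B'. c b \<in> R) \<and> (\<Sum>b \<in> B'. c b * b) = 0
        \<longrightarrow> (\<forall>b \<in> B'. c b = 0))"

definition is_left_basis :: "'f::ring_1 set \<Rightarrow> 'f set \<Rightarrow> 'f set \<Rightarrow> bool" where
  "is_left_basis R B M \<longleftrightarrow> B \<subseteq> M \<and> left_independent R B \<and> left_combinations R B = M"

definition cluster_laurent_monomials ::
  "(qtorus \<Rightarrow> 'f::division_ring) \<Rightarrow> 'f qseed \<Rightarrow> 'f set" where
  "cluster_laurent_monomials \<iota> S = {seed_monomial \<iota> S (cluster_exp a1 a2) | a1 a2. True}"

text \<open>
  The Laurent monomials of a seed are left independent over the image of \<open>ZP\<close>, so the Laurent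
  expansion of an element is unique and it suffices to ask for one with positive coefficients.
  Each of them is \<open>x\<^sub>1\<^sup>a x\<^sub>2\<^sup>b\<close> times a power of \<open>q\<^sup>1\<^sup>/\<^sup>2\<close>, which does not affect positivity.
\<close>

definition positive_elements :: "(qtorus \<Rightarrow> 'f::division_ring) \<Rightarrow> 'f set" where
  "positive_elements \<iota> =
     {z \<in> cluster_algebra \<iota>. \<forall>S \<in> seeds \<iota>.
        z \<in> left_combinations (\<iota> ` ZP_nonneg) (cluster_laurent_monomials \<iota> S)}"

definition bar_invariant :: "(qtorus \<Rightarrow> 'f::division_ring) \<Rightarrow> 'f \<Rightarrow> bool" where
  "bar_invariant \<iota> z \<longleftrightarrow> (\<exists>t. z = \<iota> t \<and> bar t = t)"

definition F_elements :: "(qtorus \<Rightarrow> 'f::division_ring) \<Rightarrow> 'f set" where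
  "F_elements \<iota> = {\<iota> (F n) | n. 1 \<le> n}"

definition atomic_basis_set :: "(qtorus \<Rightarrow> 'f::division_ring) \<Rightarrow> 'f set" where
  "atomic_basis_set \<iota> = cluster_monomials \<iota> \<union> F_elements \<iota>"

end

theory Submission
  imports Defs
begin

text \<open>
  The exchange graph of the Kronecker quiver is a line, and its clusters \<open>{x\<^sub>m, x\<^sub>m\<^sub>+\<^sub>1}\<close> are indexed by
  the integers. All clusters look alike: there is a shift \<open>X\<^sub>1 \<mapsto> X\<^sub>2 \<mapsto> x_next\<close> which, with a suitable
  action on the coefficients, preserves the form \<open>\<Lambda>\<close>, maps exchange relations to exchange relations
  and fixes both \<open>X\<^sub>\<delta>\<close> and the element \<open>Y = X\<^sup>(\<^sup>0\<^sup>,\<^sup>0\<^sup>,\<^sup>1\<^sup>,\<^sup>1\<^sup>)\<close>. It is realised by a chain of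
  injective ring homomorphisms from the quantum torus into the division ring, one for each cluster
  (\<open>torus_embedding_next\<close>, \<open>adjacent_emb\<close>). A statement about all clusters thus reduces to a
  computation in the torus of the initial one. Mutated seeds are identified with the members of this
  chain by \<open>seeds_imp_seed_at\<close> and \<open>ex_seed_at\<close>.

  Everything is governed by the relation \<open>X\<^sub>\<delta> x\<^sub>m = x\<^sub>m\<^sub>+\<^sub>1 + Y x\<^sub>m\<^sub>-\<^sub>1\<close>, valid with variables rescaled by
  coefficients.

  \<^item> Spanning. The relation shows that the span of the basis is closed under left multiplication by
    \<open>X\<^sub>\<delta>\<close> (\<open>delta_span\<close>) and is generated over coefficients and \<open>X\<^sub>\<delta>\<close> by the monomials of any one
    cluster (\<open>span_subset_module\<close>). Since right multiplication by \<open>x\<^sub>m\<close> visibly preserves the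
    monomials of a cluster that contains \<open>x\<^sub>m\<close>, the span is closed under right multiplication by all cluster
    variables, hence is the cluster algebra (\<open>span_eq_cluster_algebra\<close>).

  \<^item> Positivity. In any cluster \<open>X\<^sub>\<delta> = u + w + v\<close> with monomials satisfying \<open>u v = v u = Y\<close>. This factorisation
    of \<open>Y\<close> turns the recursions for \<open>x\<^sub>m\<close> and for the Chebyshev-like \<open>F\<^sub>n\<close> into ones without
    subtraction (\<open>subtraction_free_step\<close>, \<open>nonneg_F\<close>).

  \<^item> Independence and atomicity. In its own cluster a cluster monomial has nonnegative exponents, while
    basis elements that are not monomials of this cluster have a negative exponent in each of their
    terms (\<open>proper_or_same_cluster\<close>, \<open>supp_F\<close>).
    The element \<open>F\<^sub>n\<close> has a term at the exponents \<open>(n, - n)\<close>, which no other \<open>F\<^sub>k\<close> and no cluster monomial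
    sufficiently far to one side has (\<open>isolate_F\<close>). So the coefficient of any basis element in a given
    combination is, up to a monomial factor, a part of the Laurent expansion of this combination in a suitable
    cluster (\<open>coefficient_extraction\<close>): it is zero if the combination is, and positive if the
    combination is positive.
\<close>

section \<open>Monomials, positivity and supports in the quantum torus\<close>

text \<open>
  The element \<open>q\<^sup>r\<^sup>/\<^sup>2 X\<^sup>(\<^sup>a\<^sup>,\<^sup>b\<^sup>,\<^sup>c\<^sup>,\<^sup>d\<^sup>)\<close>. Keeping the five exponents as separate arguments lets
  the simplifier compute products of concrete monomials and compare the results.
\<close>

definition mon :: "int \<Rightarrow> int \<Rightarrow> int \<Rightarrow> int \<Rightarrow> int \<Rightarrow> qtorus" where
  "mon r a b c d = Poly_Mapping.single (QMon r (a, b, c, d)) 1"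

lemma frag_of_eq_mon: "Poly_Mapping.single (QMon r (a, b, c, d)) 1 = mon r a b c d"
  by (simp add: mon_def)

lemma mon_cong:
  "r = r' \<Longrightarrow> a = a' \<Longrightarrow> b = b' \<Longrightarrow> c = c' \<Longrightarrow> d = d' \<Longrightarrow> mon r a b c d = mon r' a' b' c' d'"
  by simp

lemma mon_mult:
  "mon r a b c d * mon r' a' b' c' d' =
     mon (r + r' + (c * a' - a * c') + (d * b' - b * d') + 2 * (d * c' - c * d'))
       (a + a') (b + b') (c + c') (d + d')"
  by (simp add: mon_def mult_single plus_qmon_def plus_prod_def LambdaForm_explicit algebra_simps)

lemma mon_mult_assoc:
  "mon r a b c d * (mon r' a' b' c' d' * t) =
     mon (r + r' + (c * a' - a * c') + (d * b' - b * d') + 2 * (d * c' - c * d'))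
       (a + a') (b + b') (c + c') (d + d') * t"
  by (simp only: mult.assoc[symmetric] mon_mult)

lemma one_eq_mon: "1 = mon 0 0 0 0 0"
  by (simp add: mon_def single_one[symmetric] zero_qmon_def zero_prod_def del: single_one)

lemma X0_eq_mon: "X0 (a, b, c, d) = mon 0 a b c d"
  by (simp add: X0_def mon_def)

lemma qhalf_eq_mon: "qhalf r = mon r 0 0 0 0"
  by (simp add: qhalf_def mon_def zero_prod_def)

lemma mon_central: "mon r 0 0 0 0 * t = t * mon r 0 0 0 0"
  using qhalf_central[of r t] by (simp add: qhalf_eq_mon)

lemma mon_inverse: "mon r a b c d * mon (- r) (- a) (- b) (- c) (- d) = 1"
    "mon (- r) (- a) (- b) (- c) (- d) * mon r a b c d = 1"
  by (simp_all add: mon_mult one_eq_mon)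

lemma mon_power: "mon r a b c d ^ n = mon (int n * r) (int n * a) (int n * b) (int n * c) (int n * d)"
  by (induction n) (simp_all add: one_eq_mon mon_mult algebra_simps)

lemma qmon_cases_mon:
  obtains r a b c d where "m = QMon r (a, b, c, d)"
  by (cases m, cases "xexp m") auto

text \<open>
  Differences instead of sums as the closing step: with them zero and integer multiples come for
  free, so an additive identity only has to be checked on monomials.
\<close>

lemma torus_induct [case_names mon diff]:
  assumes "\<And>r a b c d. P (mon r a b c d)" and "\<And>s t. P s \<Longrightarrow> P t \<Longrightarrow> P (s - t)"
  shows "P t"
  using subset_UNIV
proof (induction t rule: frag_induction)
  case zero
  from assms(2)[OF assms(1) assms(1), of 0 0 0 0 0 0 0 0 0 0] show ?case by simp
next
  case (one m)
  then show ?case by (cases m rule: qmon_cases_mon) (simp add: frag_of_eq_mon assms(1))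
qed (rule assms(2))

lemma ZP_induct [consumes 1, case_names mon diff]:
  assumes "t \<in> ZP" and "\<And>r c d. P (mon r 0 0 c d)" and "\<And>s t. P s \<Longrightarrow> P t \<Longrightarrow> P (s - t)"
  shows "P t"
proof -
  have "Poly_Mapping.keys t \<subseteq> {m. coord (xexp m) 1 = 0 \<and> coord (xexp m) 2 = 0}"
    using assms(1) by (auto simp: ZP_def)
  then show ?thesis
  proof (induction t rule: frag_induction)
    case zero
    from assms(3)[OF assms(2) assms(2), of 0 0 0 0 0 0] show ?case by simp
  next
    case (one m)
    then show ?case by (cases m rule: qmon_cases_mon) (auto simp: frag_of_eq_mon assms(2))
  qed (rule assms(3))
qed

lemma ZP_mon: "mon r 0 0 c d \<in> ZP"
  by (simp add: ZP_def mon_def)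

lemma ZP_zero: "0 \<in> ZP"
  by (simp add: ZP_def)

lemma ZP_one: "1 \<in> ZP"
  by (simp add: one_eq_mon ZP_mon)

lemma ZP_add: "s \<in> ZP \<Longrightarrow> t \<in> ZP \<Longrightarrow> s + t \<in> ZP"
  using keys_add[of s t] by (auto simp: ZP_def)

lemma ZP_diff: "s \<in> ZP \<Longrightarrow> t \<in> ZP \<Longrightarrow> s - t \<in> ZP"
  using keys_diff[of s t] by (auto simp: ZP_def)

lemma ZP_uminus: "t \<in> ZP \<Longrightarrow> - t \<in> ZP"
  using ZP_diff[OF ZP_zero] by fastforce

lemma ZP_mult:
  assumes "s \<in> ZP" and "t \<in> ZP"
  shows "s * t \<in> ZP"
  using assms(1)
proof (induction s rule: ZP_induct)
  case (mon r c d)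
  show ?case using assms(2)
    by (induction t rule: ZP_induct) (simp_all add: mon_mult ZP_mon right_diff_distrib ZP_diff)
qed (simp add: left_diff_distrib ZP_diff)

definition nonneg :: "qtorus \<Rightarrow> bool" where
  "nonneg t \<longleftrightarrow> (\<forall>m. 0 \<le> Poly_Mapping.lookup t m)"

lemma ZP_nonneg_iff: "t \<in> ZP_nonneg \<longleftrightarrow> t \<in> ZP \<and> nonneg t"
  by (simp add: ZP_nonneg_def nonneg_def)

lemma nonneg_zero: "nonneg 0"
  by (simp add: nonneg_def)

lemma nonneg_mon: "nonneg (mon r a b c d)"
  by (simp add: nonneg_def mon_def lookup_single when_def)

lemma nonneg_one: "nonneg 1"
  by (simp add: one_eq_mon nonneg_mon)

lemma nonneg_add: "nonneg s \<Longrightarrow> nonneg t \<Longrightarrow> nonneg (s + t)"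
  by (simp add: nonneg_def lookup_add)

text \<open>
  With only sums allowed, what can be reached from the monomials are exactly the elements with
  nonnegative coefficients. Positivity statements are proved by this rule, which never looks at
  coefficients.
\<close>

lemma nonneg_induct [consumes 1, case_names zero mon add]:
  assumes "nonneg t" and "P 0"
    and mon: "\<And>r a b c d. QMon r (a, b, c, d) \<in> Poly_Mapping.keys t \<Longrightarrow> P (mon r a b c d)"
    and add: "\<And>u v. P u \<Longrightarrow> P v \<Longrightarrow> P (u + v)"
  shows "P t"
proof -
  have single: "P (Poly_Mapping.single m (int n))" if "m \<in> Poly_Mapping.keys t" for m n
  proof (induction n)
    case (Suc n)
    have "P (Poly_Mapping.single m 1)"
      using mon that by (cases m rule: qmon_cases_mon) (auto simp: mon_def)
    from add[OF this Suc] show ?case by (simp add: single_add)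
  qed (simp add: assms(2))
  have "P (\<Sum>m\<in>M. Poly_Mapping.single m (Poly_Mapping.lookup t m))"
    if "finite M" "M \<subseteq> Poly_Mapping.keys t" for M
    using that
  proof (induction M rule: finite_induct)
    case (insert m M)
    have "Poly_Mapping.lookup t m = int (nat (Poly_Mapping.lookup t m))"
      using assms(1) by (simp add: nonneg_def)
    with single[of m "nat (Poly_Mapping.lookup t m)"] insert show ?case by (simp add: add)
  qed (simp add: assms(2))
  from this[of "Poly_Mapping.keys t"] have
    "P (\<Sum>m\<in>Poly_Mapping.keys t. Poly_Mapping.single m (Poly_Mapping.lookup t m))"
    by simp
  moreover have "(\<Sum>m\<in>Poly_Mapping.keys t. Poly_Mapping.single m (Poly_Mapping.lookup t m)) = t"
    by (rule poly_mapping_eqI) (simp add: lookup_sum lookup_single when_def in_keys_iff)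
  ultimately show ?thesis by simp
qed

lemma nonneg_mult: "nonneg s \<Longrightarrow> nonneg t \<Longrightarrow> nonneg (s * t)"
proof (induction s rule: nonneg_induct)
  case (mon r a b c d)
  from \<open>nonneg t\<close> show ?case
    by (induction t rule: nonneg_induct)
      (simp_all add: mon_mult nonneg_mon distrib_left nonneg_add nonneg_zero)
qed (simp_all add: distrib_right nonneg_add nonneg_zero)

lemma ZP_nonneg_induct [consumes 1, case_names zero mon add]:
  assumes "t \<in> ZP_nonneg" and "P 0" and "\<And>r c d. P (mon r 0 0 c d)"
    and "\<And>u v. P u \<Longrightarrow> P v \<Longrightarrow> P (u + v)"
  shows "P t"
proof -
  from assms(1) have "nonneg t" "t \<in> ZP" by (simp_all add: ZP_nonneg_iff)
  from this(1) show ?thesis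
  proof (induction t rule: nonneg_induct)
    case (mon r a b c d)
    with \<open>t \<in> ZP\<close> have "a = 0" "b = 0" by (auto simp: ZP_def)
    then show ?case using assms(3) by simp
  qed (use assms in auto)
qed

lemma ZP_nonneg_zero: "0 \<in> ZP_nonneg"
  by (simp add: ZP_nonneg_iff ZP_zero nonneg_zero)

lemma ZP_nonneg_mon: "mon r 0 0 c d \<in> ZP_nonneg"
  by (simp add: ZP_nonneg_iff ZP_mon nonneg_mon)

lemma ZP_nonneg_add: "s \<in> ZP_nonneg \<Longrightarrow> t \<in> ZP_nonneg \<Longrightarrow> s + t \<in> ZP_nonneg"
  by (simp add: ZP_nonneg_iff ZP_add nonneg_add)

text \<open>
  This selection of terms by their exponents of \<open>X\<^sub>1\<close>, \<open>X\<^sub>2\<close> is left linear over the coefficient ring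
  \<open>ZP\<close>. It serves both as a coefficient extractor for Laurent expansions and as the homogeneous
  component of a grading.
\<close>

definition part :: "(int \<Rightarrow> int \<Rightarrow> bool) \<Rightarrow> qtorus \<Rightarrow> qtorus" where
  "part P = frag_extend (\<lambda>m. if P (coord (xexp m) 1) (coord (xexp m) 2)
     then Poly_Mapping.single m 1 else 0)"

lemma part_mon: "part P (mon r a b c d) = (if P a b then mon r a b c d else 0)"
  by (simp add: part_def mon_def)

lemma part_0: "part P 0 = 0"
  by (simp add: part_def)

lemma part_add: "part P (s + t) = part P s + part P t"
  by (simp add: part_def frag_extend_add)

lemma part_diff: "part P (s - t) = part P s - part P t"
  by (simp add: part_def frag_extend_diff)

lemma part_sum: "finite I \<Longrightarrow> part P (\<Sum>i\<in>I. g i) = (\<Sum>i\<in>I. part P (g i))"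
  by (simp add: part_def frag_extend_sum)

lemma part_ZP_mult:
  assumes "s \<in> ZP"
  shows "part P (s * t) = s * part P t"
  using assms
proof (induction s rule: ZP_induct)
  case (mon r c d)
  show ?case
    by (induction t rule: torus_induct)
      (simp_all add: mon_mult part_mon right_diff_distrib part_diff)
qed (simp add: left_diff_distrib part_diff)

lemma nonneg_part: "nonneg t \<Longrightarrow> nonneg (part P t)"
  by (induction t rule: nonneg_induct) (simp_all add: part_0 nonneg_zero part_mon nonneg_mon part_add nonneg_add)

text \<open>
  The Newton support in the two cluster directions only: it does not change under multiplication by
  monomials in the coefficients.
\<close>

definition supp :: "qtorus \<Rightarrow> (int \<times> int) set" where
  "supp t = (\<lambda>m. (coord (xexp m) 1, coord (xexp m) 2)) ` Poly_Mapping.keys t"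

lemma supp_mon: "supp (mon r a b c d) = {(a, b)}"
  by (simp add: supp_def mon_def)

lemma supp_one: "supp 1 = {(0, 0)}"
  by (simp add: one_eq_mon supp_mon)

lemma supp_zero: "supp 0 = {}"
  by (simp add: supp_def)

lemma supp_add: "supp (s + t) \<subseteq> supp s \<union> supp t"
  using keys_add[of s t] by (auto simp: supp_def)

lemma supp_diff: "supp (s - t) \<subseteq> supp s \<union> supp t"
  using keys_diff[of s t] by (auto simp: supp_def)

lemma supp_mult: "supp (s * t) \<subseteq> {(a + a', b + b') | a b a' b'. (a, b) \<in> supp s \<and> (a', b') \<in> supp t}"
proof
  fix p assume "p \<in> supp (s * t)"
  then obtain m where m: "m \<in> Poly_Mapping.keys (s * t)"
    and p: "p = (coord (xexp m) 1, coord (xexp m) 2)"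
    by (auto simp: supp_def)
  from m keys_mult[of s t] obtain k l
    where kl: "m = k + l" "k \<in> Poly_Mapping.keys s" "l \<in> Poly_Mapping.keys t"
    by blast
  then have "(coord (xexp k) 1, coord (xexp k) 2) \<in> supp s"
    "(coord (xexp l) 1, coord (xexp l) 2) \<in> supp t"
    by (auto simp: supp_def)
  moreover have "p = (coord (xexp k) 1 + coord (xexp l) 1, coord (xexp k) 2 + coord (xexp l) 2)"
    by (cases k rule: qmon_cases_mon, cases l rule: qmon_cases_mon)
      (simp add: p kl plus_qmon_def plus_prod_def)
  ultimately show "p \<in> {(a + a', b + b') | a b a' b'. (a, b) \<in> supp s \<and> (a', b') \<in> supp t}"
    by blast
qed

lemma part_eq_0: "(\<And>a b. (a, b) \<in> supp t \<Longrightarrow> \<not> P a b) \<Longrightarrow> part P t = 0"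
  unfolding part_def by (rule frag_extend_eq_0) (auto simp: supp_def)

lemma lookup_part: "Poly_Mapping.lookup (part P t) m =
    (if P (coord (xexp m) 1) (coord (xexp m) 2) then Poly_Mapping.lookup t m else 0)"
proof (induction t rule: torus_induct)
  case (mon r a b c d)
  show ?case
    by (cases m rule: qmon_cases_mon)
      (simp add: part_mon, auto simp: mon_def lookup_single when_def)
qed (simp add: part_diff lookup_minus)

lemma part_eq_self: "(\<And>a b. (a, b) \<in> supp t \<Longrightarrow> P a b) \<Longrightarrow> part P t = t"
proof (rule poly_mapping_eqI)
  fix m
  assume "\<And>a b. (a, b) \<in> supp t \<Longrightarrow> P a b"
  then have "m \<in> Poly_Mapping.keys t \<Longrightarrow> P (coord (xexp m) 1) (coord (xexp m) 2)"
    unfolding supp_def by blast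
  then show "Poly_Mapping.lookup (part P t) m = Poly_Mapping.lookup t m"
    by (auto simp: lookup_part in_keys_iff simp del: One_nat_def)
qed

section \<open>Reflection and bar-involution\<close>

text \<open>
  The symmetry of the Kronecker quiver that reverses the chain of clusters: it exchanges the two
  cluster variables of the initial seed. On exponents it changes the sign of the form
  \<open>\<Lambda>\<close>, so \<open>q\<close> has to be inverted for it to be multiplicative.
\<close>

fun refl_mon :: "qmon \<Rightarrow> qmon" where
  "refl_mon (QMon r (a, b, c, d)) = QMon (- r) (b, a, - d, - c)"

definition reflect :: "qtorus \<Rightarrow> qtorus" where
  "reflect = frag_extend (\<lambda>m. Poly_Mapping.single (refl_mon m) 1)"

lemma reflect_mon: "reflect (mon r a b c d) = mon (- r) b a (- d) (- c)"
  by (simp add: reflect_def mon_def)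

lemma reflect_0: "reflect 0 = 0"
  by (simp add: reflect_def)

lemma reflect_add: "reflect (s + t) = reflect s + reflect t"
  by (simp add: reflect_def frag_extend_add)

lemma reflect_diff: "reflect (s - t) = reflect s - reflect t"
  by (simp add: reflect_def frag_extend_diff)

lemma reflect_one: "reflect 1 = 1"
  by (simp add: one_eq_mon reflect_mon)

lemma reflect_mult: "reflect (s * t) = reflect s * reflect t"
proof (induction s rule: torus_induct)
  case (mon r a b c d)
  show ?case
    by (induction t rule: torus_induct)
      (simp_all add: mon_mult reflect_mon right_diff_distrib reflect_diff algebra_simps)
qed (simp add: left_diff_distrib reflect_diff)

lemma reflect_power: "reflect (s ^ n) = reflect s ^ n"
  by (induction n) (simp_all add: reflect_one reflect_mult)

lemma reflect_reflect: "reflect (reflect t) = t"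
  by (induction t rule: torus_induct) (simp_all add: reflect_mon reflect_diff)

lemma nonneg_reflect: "nonneg t \<Longrightarrow> nonneg (reflect t)"
  by (induction t rule: nonneg_induct) (simp_all add: reflect_0 nonneg_zero reflect_mon nonneg_mon reflect_add nonneg_add)

lemma supp_reflect: "supp (reflect t) \<subseteq> prod.swap ` supp t"
proof
  fix p assume "p \<in> supp (reflect t)"
  then obtain m where m: "m \<in> Poly_Mapping.keys (reflect t)" 
    and p: "p = (coord (xexp m) 1, coord (xexp m) 2)"
    by (auto simp: supp_def)
  from m obtain k where "k \<in> Poly_Mapping.keys t" "m = refl_mon k"
    using keys_frag_extend[of "\<lambda>m. Poly_Mapping.single (refl_mon m) 1" t]
    by (auto simp: reflect_def)
  then show "p \<in> prod.swap ` supp t"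
    by (cases k rule: qmon_cases_mon) (auto simp: p supp_def image_iff intro!: bexI[of _ k])
qed

lemma bar_mon: "bar (mon r a b c d) = mon (- r) a b c d"
  by (simp add: bar_def mon_def)

lemma bar_diff: "bar (s - t) = bar s - bar t"
  by (simp add: bar_def frag_extend_diff)

lemma bar_add: "bar (s + t) = bar s + bar t"
  by (simp add: bar_def frag_extend_add)

lemma bar_one: "bar 1 = 1"
  by (simp add: one_eq_mon bar_mon)

text \<open>
  The bar-involution reverses products because \<open>\<Lambda>\<close> is skew-symmetric.
\<close>

lemma bar_mult: "bar (s * t) = bar t * bar s"
proof (induction s rule: torus_induct)
  case (mon r a b c d)
  show ?case
    by (induction t rule: torus_induct)
      (simp_all add: mon_mult bar_mon left_diff_distrib right_diff_distrib bar_diff algebra_simps)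
qed (simp add: left_diff_distrib right_diff_distrib bar_diff)

lemma bar_power: "bar (s ^ n) = bar s ^ n"
  by (induction n) (simp_all add: bar_one bar_mult power_commutes)

lemma bar_reflect: "bar (reflect t) = reflect (bar t)"
  by (induction t rule: torus_induct) (simp_all add: reflect_mon bar_mon reflect_diff bar_diff)

section \<open>Exchange relations at the initial cluster\<close>

text \<open>
  The neighbours of the cluster \<open>{X\<^sub>1, X\<^sub>2}\<close> in both directions. The actual cluster variable obtained
  by mutating \<open>X\<^sub>2\<close> is a coefficient times \<open>x_prev\<close>; the factor is dropped so that one and the same
  recursion holds along the whole chain of clusters.
\<close>

definition x_prev :: qtorus where
  "x_prev = mon 0 2 (- 1) 0 0 + mon 0 0 (- 1) 0 (- 1)"

definition x_next :: qtorus where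
  "x_next = mon 0 (- 1) 0 1 0 + mon 0 (- 1) 2 0 0"

abbreviation Y :: qtorus where "Y \<equiv> mon 0 0 0 1 1"
abbreviation X1 :: qtorus where "X1 \<equiv> mon 0 1 0 0 0"
abbreviation X2 :: qtorus where "X2 \<equiv> mon 0 0 1 0 0"

lemma X_delta_eq: "X_delta = mon 0 1 (- 1) 1 1 + mon 0 (- 1) (- 1) 1 0 + mon 0 (- 1) 1 0 0"
  by (simp add: X_delta_def X0_eq_mon)

lemma reflect_x_next: "reflect x_next = x_prev"
  by (simp add: x_next_def x_prev_def reflect_add reflect_mon add.commute)

lemma reflect_X_delta: "Y * reflect X_delta = X_delta"
  by (simp add: X_delta_eq reflect_add reflect_mon distrib_left mon_mult)

text \<open>
  Multiplication by \<open>X\<^sub>\<delta>\<close> moves along the chain of clusters: \<open>X\<^sub>\<delta> x\<^sub>m = x\<^sub>m\<^sub>+\<^sub>1 + Y x\<^sub>m\<^sub>-\<^sub>1\<close> with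
  \<open>Y = X\<^sup>(\<^sup>0\<^sup>,\<^sup>0\<^sup>,\<^sup>1\<^sup>,\<^sup>1\<^sup>)\<close>. These are the instances at the initial cluster; embeddings of the torus
  transport them to all others.
\<close>

lemma delta_X2: "X_delta * X2 = x_next + Y * X1"
  by (simp add: X_delta_eq x_next_def distrib_right mon_mult)

lemma X2_delta: "X2 * X_delta = x_next + X1 * Y"
  by (simp add: X_delta_eq x_next_def distrib_left mon_mult)

lemma delta_X1: "X_delta * X1 = X2 + Y * x_prev"
  by (simp add: X_delta_eq x_prev_def distrib_left distrib_right mon_mult)

lemma exchange_next: "x_next * X1 = X2 * X2 + mon 1 0 0 1 0"
   "X1 * x_next = X2 * X2 + mon (- 1) 0 0 1 0"
  by (simp_all add: x_next_def distrib_left distrib_right mon_mult)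

lemma exchange_prev: "x_prev * X2 = X1 * X1 + mon (- 1) 0 0 0 (- 1)"
    "X2 * x_prev = X1 * X1 + mon 1 0 0 0 (- 1)"
  by (simp_all add: x_prev_def distrib_left distrib_right mon_mult)

lemma X1_X2_commute: "X1 * X2 = X2 * X1"
  by (simp add: mon_mult)

lemma delta_Y: "X_delta * Y = Y * X_delta"
  by (simp add: X_delta_eq distrib_left distrib_right mon_mult)

text \<open>
  All three monomials of \<open>X\<^sub>\<delta>\<close> \<open>q\<close>-commute with \<open>y\<^sub>1\<close> and \<open>y\<^sub>2\<close> in the same way.
\<close>

lemma delta_ZP:
  assumes "s \<in> ZP"
  shows "\<exists>s'\<in>ZP. X_delta * s = s' * X_delta"
  using assms
proof (induction s rule: ZP_induct)
  case (mon r c d)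
  have "X_delta * mon r 0 0 c d = mon (r + 2 * (c - d)) 0 0 c d * X_delta"
    by (simp add: X_delta_eq distrib_left distrib_right mon_mult algebra_simps)
  then show ?case using ZP_mon by blast
next
  case (diff s t)
  then obtain s' t' where "s' \<in> ZP" "t' \<in> ZP" "X_delta * s = s' * X_delta" "X_delta * t = t' * X_delta"
    by blast
  then show ?case
    by (intro bexI[of _ "s' - t'"]) (simp_all add: right_diff_distrib left_diff_distrib ZP_diff)
qed

lemma mon_ZP:
  assumes "s \<in> ZP"
  shows "\<exists>s'\<in>ZP. mon r a b c d * s = s' * mon r a b c d"
  using assms
proof (induction s rule: ZP_induct)
  case (mon r' c' d')
  have "mon r a b c d * mon r' 0 0 c' d' =
     mon (r' - 2 * a * c' - 2 * b * d' + 4 * (d * c' - c * d')) 0 0 c' d' * mon r a b c d"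
    by (simp add: mon_mult algebra_simps)
  then show ?case using ZP_mon by blast
next
  case (diff s t)
  then obtain s' t' where "s' \<in> ZP" "t' \<in> ZP" "mon r a b c d * s = s' * mon r a b c d" "mon r a b c d * t = t' * mon r a b c d"
    by blast
  then show ?case
    by (intro bexI[of _ "s' - t'"]) (simp_all add: right_diff_distrib left_diff_distrib ZP_diff)
qed

text \<open>
  The product of the two neighbours of the initial cluster consists of the three terms of
  \<open>X\<^sub>\<delta>\<close> and one term proportional to \<open>X\<^sub>1 X\<^sub>2\<close>, up to a coefficient; hence \<open>X\<^sub>\<delta>\<close> lies in the
  cluster algebra.
\<close>

lemma delta_from_variables:
  "X_delta = mon 1 0 0 0 1 * (x_prev * x_next) - mon 1 0 0 0 1 * (X1 * X2)"
  by (simp add: X_delta_eq x_prev_def x_next_def distrib_left distrib_right mon_mult)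

section \<open>Neighbouring clusters as embeddings of the quantum torus\<close>

definition lift :: "(qmon \<Rightarrow> 'f::ring_1) \<Rightarrow> qtorus \<Rightarrow> 'f" where
  "lift \<mu> t = (\<Sum>m\<in>Poly_Mapping.keys t. of_int (Poly_Mapping.lookup t m) * \<mu> m)"

lemma lift_mon: "lift \<mu> (mon r a b c d) = \<mu> (QMon r (a, b, c, d))"
  by (simp add: lift_def mon_def)

lemma lift_add: "lift \<mu> (s + t) = lift \<mu> s + lift \<mu> t"
  unfolding lift_def by (rule setsum_keys_plus_distrib) (simp_all add: distrib_right)

lemma lift_diff: "lift \<mu> (s - t) = lift \<mu> s - lift \<mu> t"
  using lift_add[of \<mu> "s - t" t] by simp

lemma lift_mult:
  assumes "\<And>m n. \<mu> (m + n) = \<mu> m * \<mu> n"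
  shows "lift \<mu> (s * t) = lift \<mu> s * lift \<mu> t"
proof (induction s rule: torus_induct)
  case (mon r a b c d)
  show ?case
  proof (induction t rule: torus_induct)
    case (mon r' a' b' c' d')
    show ?case
      using assms[of "QMon r (a, b, c, d)" "QMon r' (a', b', c', d')"]
      by (simp add: mon_mult lift_mon plus_qmon_def plus_prod_def LambdaForm_explicit algebra_simps)
  qed (simp add: right_diff_distrib lift_diff)
qed (simp add: left_diff_distrib lift_diff)

text \<open>
  A cluster with its Laurent expansions: the images of \<open>X\<^sub>1\<close>, \<open>X\<^sub>2\<close> are the cluster variables, those of
  \<open>y\<^sub>1\<close>, \<open>y\<^sub>2\<close> generate the coefficients, and injectivity says that Laurent expansions are unique.
\<close>

locale torus_embedding =
  fixes \<kappa> :: "qtorus \<Rightarrow> 'f::division_ring"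
  assumes one: "\<kappa> 1 = 1"
    and add: "\<kappa> (s + t) = \<kappa> s + \<kappa> t"
    and mult: "\<kappa> (s * t) = \<kappa> s * \<kappa> t"
    and eqD: "\<kappa> s = \<kappa> t \<Longrightarrow> s = t"
begin

lemma eq_iff: "\<kappa> s = \<kappa> t \<longleftrightarrow> s = t"
  using eqD by blast

lemma zero: "\<kappa> 0 = 0"
  using add[of 0 0] by simp

lemma diff: "\<kappa> (s - t) = \<kappa> s - \<kappa> t"
  using add[of "s - t" t] by simp

lemma uminus: "\<kappa> (- t) = - \<kappa> t"
  using diff[of 0 t] by (simp add: zero)

lemma power: "\<kappa> (s ^ n) = \<kappa> s ^ n"
  by (induction n) (simp_all add: one mult)

lemma sum: "\<kappa> (\<Sum>i\<in>I. g i) = (\<Sum>i\<in>I. \<kappa> (g i))"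
  by (induction I rule: infinite_finite_induct) (simp_all add: zero add)

lemma eq_0_iff: "\<kappa> t = 0 \<longleftrightarrow> t = 0"
  using eq_iff[of t 0] by (simp add: zero)

lemma mon_nonzero: "\<kappa> (mon r a b c d) \<noteq> 0"
  by (simp add: eq_0_iff) (simp add: mon_def)

lemma inverse_mon: "inverse (\<kappa> (mon r a b c d)) = \<kappa> (mon (- r) (- a) (- b) (- c) (- d))"
  by (rule inverse_unique) (simp add: mult[symmetric] mon_inverse one)

lemma power_cancel:
  fixes s p :: qtorus
  assumes "s * p ^ n = 0" and "p \<noteq> 0"
  shows "s = 0"
proof -
  have "\<kappa> s * \<kappa> p ^ n = 0"
    using assms(1) by (simp add: mult[symmetric] power[symmetric] zero)
  with assms(2) show ?thesis by (simp add: eq_0_iff)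
qed

lemma mon_power_int:
  "\<kappa> (mon r a b c d) powi n = \<kappa> (mon (n * r) (n * a) (n * b) (n * c) (n * d))"
proof (cases "n \<ge> 0")
  case True
  then show ?thesis by (simp add: power_int_def power[symmetric] mon_power)
next
  case False
  have "\<kappa> (mon r a b c d) powi n = inverse (\<kappa> (mon r a b c d)) ^ nat (- n)"
    using False by (simp add: power_int_def)
  also have "\<dots> = \<kappa> (mon (n * r) (n * a) (n * b) (n * c) (n * d))"
    using False by (simp add: inverse_mon power[symmetric] mon_power)
  finally show ?thesis .
qed

text \<open>
  For negative \<open>n\<close> the relation is conjugated by the inverse of a power of \<open>p\<close>, which need not
  exist in the torus but does in the division ring.
\<close>

lemma q_commute_power_int:
  assumes "s * p = mon k 0 0 0 0 * p * s"
  shows "\<kappa> s * \<kappa> p powi n = \<kappa> (mon (k * n) 0 0 0 0) * (\<kappa> p powi n * \<kappa> s)"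
proof -
  have pow: "s * p ^ j = mon (k * int j) 0 0 0 0 * (p ^ j * s)" for j
  proof (induction j)
    case 0
    show ?case by (simp add: one_eq_mon[symmetric])
  next
    case (Suc j)
    have "s * p ^ Suc j = mon k 0 0 0 0 * p * (s * p ^ j)"
      using assms by (simp add: mult.assoc[symmetric])
    also have "\<dots> = mon k 0 0 0 0 * (p * mon (k * int j) 0 0 0 0) * (p ^ j * s)"
      by (simp add: Suc mult.assoc)
    also have "\<dots> = (mon k 0 0 0 0 * mon (k * int j) 0 0 0 0) * (p ^ Suc j * s)"
      by (simp add: mon_central[of _ p, symmetric] mult.assoc)
    also have "mon k 0 0 0 0 * mon (k * int j) 0 0 0 0 = mon (k * int (Suc j)) 0 0 0 0"
      by (simp add: mon_mult algebra_simps)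
    finally show ?case .
  qed
  show ?thesis
  proof (cases "n \<ge> 0")
    case True
    then show ?thesis
      using pow[of "nat n"] by (simp add: power_int_def power[symmetric] mult[symmetric])
  next
    case False
    show ?thesis
    proof (cases "p = 0")
      case True
      with False show ?thesis by (simp add: zero)
    next
      case p: False
      define y where "y = \<kappa> (p ^ nat (- n))"
      have y: "y \<noteq> 0" using p by (simp add: y_def power eq_0_iff)
      define q where "q = \<kappa> (mon (- (k * n)) 0 0 0 0)"
      have qi: "inverse q = \<kappa> (mon (k * n) 0 0 0 0)"
        by (simp add: q_def inverse_mon)
      have q0: "q \<noteq> 0" by (simp add: q_def mon_nonzero)
      have "\<kappa> s * y = q * (y * \<kappa> s)"
        using pow[of "nat (- n)"] False by (simp add: y_def q_def mult[symmetric])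
      then have "inverse q * (\<kappa> s * y) * inverse y = y * \<kappa> s * inverse y"
        by (simp add: mult.assoc[symmetric] q0)
      then have "inverse q * \<kappa> s = y * \<kappa> s * inverse y"
        using y by (simp add: mult.assoc)
      then have "inverse y * (inverse q * \<kappa> s) = \<kappa> s * inverse y"
        using y by (simp add: mult.assoc[symmetric])
      moreover have "inverse y * inverse q = inverse q * inverse y"
      proof -
        have "q * y = y * q"
          by (simp add: q_def y_def mult[symmetric] mon_central)
        then show ?thesis by (metis q0 y nonzero_inverse_mult_distrib)
      qed
      ultimately have "\<kappa> s * inverse y = inverse q * (inverse y * \<kappa> s)"
        by (simp add: mult.assoc[symmetric])
      moreover have "\<kappa> p powi n = inverse y"
        using False by (simp add: power_int_def y_def power power_inverse)
      ultimately show ?thesis by (simp add: qi)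
    qed
  qed
qed

end

lemma torus_embedding_reflect: "torus_embedding \<kappa> \<Longrightarrow> torus_embedding (\<kappa> \<circ> reflect)"
proof -
  assume "torus_embedding \<kappa>"
  then interpret torus_embedding \<kappa> .
  show ?thesis
  proof
    fix s t assume "(\<kappa> \<circ> reflect) s = (\<kappa> \<circ> reflect) t"
    then have "reflect (reflect s) = reflect (reflect t)" by (simp add: eq_iff)
    then show "s = t" by (simp add: reflect_reflect)
  qed (simp_all add: reflect_one reflect_add reflect_mult one add mult)
qed

text \<open>
  The next cluster sends \<open>X\<^sub>1\<close> to \<open>X\<^sub>2\<close> and \<open>X\<^sub>2\<close> to \<open>x_next\<close>, and \<open>y\<^sub>1\<close>, \<open>y\<^sub>2\<close> to \<open>X\<^sup>(\<^sup>0\<^sup>,\<^sup>0\<^sup>,\<^sup>2\<^sup>,\<^sup>1\<^sup>)\<close> and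
  \<open>X\<^sup>(\<^sup>0\<^sup>,\<^sup>0\<^sup>,\<^sup>-\<^sup>1\<^sup>,\<^sup>0\<^sup>)\<close>. This choice on the coefficients preserves \<open>\<Lambda>\<close>, carries exchange
  relations to exchange relations, and fixes both \<open>Y\<close> and \<open>X\<^sub>\<delta>\<close>. The summand \<open>- b * d\<close>
  normalises the product of \<open>X\<^sup>(\<^sup>a\<^sup>,\<^sup>0\<^sup>,\<^sup>c\<^sup>,\<^sup>d\<^sup>)\<close> and \<open>X\<^sub>2\<^sup>b\<close>.
\<close>

fun next_mon :: "(qtorus \<Rightarrow> 'f::division_ring) \<Rightarrow> qmon \<Rightarrow> 'f" where
  "next_mon \<kappa> (QMon r (a, b, c, d)) = \<kappa> (mon (r - b * d) 0 a (2 * c - d) c) * \<kappa> x_next powi b"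

definition next_embedding :: "(qtorus \<Rightarrow> 'f::division_ring) \<Rightarrow> qtorus \<Rightarrow> 'f" where
  "next_embedding \<kappa> = lift (next_mon \<kappa>)"

lemma x_next_q_commute:
  "mon r 0 a (2 * c - d) c * x_next = mon (2 * d) 0 0 0 0 * x_next * mon r 0 a (2 * c - d) c"
  by (simp add: x_next_def distrib_left distrib_right mon_mult algebra_simps)

lemma x_next_nonzero: "x_next \<noteq> 0"
proof -
  have "Poly_Mapping.lookup x_next (QMon 0 (- 1, 0, 1, 0)) = 1"
    by (simp add: x_next_def mon_def lookup_add lookup_single when_def)
  then show ?thesis by auto
qed

text \<open>
  Every term of \<open>x_next\<close> has degree \<open>- 1\<close> in \<open>X\<^sub>1\<close>; this grading separates the powers of \<open>x_next\<close>
  in the proof of injectivity below.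
\<close>

lemma supp_x_next_power: "(a, b) \<in> supp (x_next ^ n) \<Longrightarrow> a = - int n"
proof (induction n arbitrary: a b)
  case (Suc n)
  have "supp x_next \<subseteq> {(- 1, 0), (- 1, 2)}"
    using supp_add[of "mon 0 (- 1) 0 1 0" "mon 0 (- 1) 2 0 0"] by (auto simp: x_next_def supp_mon)
  moreover from Suc.prems obtain a1 b1 a2 b2 where "(a1, b1) \<in> supp x_next" "(a2, b2) \<in> supp (x_next ^ n)"
      "a = a1 + a2" using supp_mult[of x_next "x_next ^ n"] by auto
  ultimately show ?case using Suc.IH[of a2 b2] by auto
qed (simp add: supp_one)

context torus_embedding
begin

lemma next_mon_add: "next_mon \<kappa> (m + n) = next_mon \<kappa> m * next_mon \<kappa> n"
proof -
  obtain r a b c d where m: "m = QMon r (a, b, c, d)" by (rule qmon_cases_mon)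
  obtain r' a' b' c' d' where n: "n = QMon r' (a', b', c', d')" by (rule qmon_cases_mon)
  define x where "x = \<kappa> x_next"
  have x: "x \<noteq> 0" by (simp add: x_def eq_0_iff x_next_nonzero)
  define k where "k = mon (r - b * d) 0 a (2 * c - d) c"
  define l where "l = mon (r' - b' * d') 0 a' (2 * c' - d') c'"
  have "next_mon \<kappa> m * next_mon \<kappa> n = \<kappa> k * (x powi b * \<kappa> l) * x powi b'"
    by (simp add: m n k_def l_def x_def mult.assoc)
  also have "\<kappa> l * x powi b = \<kappa> (mon (2 * d' * b) 0 0 0 0) * (x powi b * \<kappa> l)"
    unfolding x_def l_def by (rule q_commute_power_int) (rule x_next_q_commute)
  then have "x powi b * \<kappa> l = \<kappa> (mon (- (2 * d' * b)) 0 0 0 0) * (\<kappa> l * x powi b)"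
    by (simp add: mult.assoc[symmetric] mult[symmetric] mon_mult one_eq_mon[symmetric] one)
  also have "\<kappa> k * (\<kappa> (mon (- (2 * d' * b)) 0 0 0 0) * (\<kappa> l * x powi b)) * x powi b' =
      \<kappa> (k * mon (- (2 * d' * b)) 0 0 0 0 * l) * (x powi b * x powi b')"
    by (simp add: mult mult.assoc)
  also have "k * mon (- (2 * d' * b)) 0 0 0 0 * l =
      mon (r + r' + (c * a' - a * c') + (d * b' - b * d') + 2 * (d * c' - c * d') - (b + b') * (d + d'))
        0 (a + a') (2 * (c + c') - (d + d')) (c + c')"
    by (simp add: k_def l_def mon_mult algebra_simps)
  also have "x powi b * x powi b' = x powi (b + b')"
    using x by (simp add: power_int_add)
  finally show ?thesis
    by (simp add: m n plus_qmon_def plus_prod_def LambdaForm_explicit x_def add.assoc)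
qed

lemma next_embedding_mon:
  "next_embedding \<kappa> (mon r a b c d) = \<kappa> (mon (r - b * d) 0 a (2 * c - d) c) * \<kappa> x_next powi b"
  by (simp add: next_embedding_def lift_mon)

text \<open>
  Multiplying by a power of \<open>X\<^sub>2\<close> makes all exponents of \<open>X\<^sub>2\<close> nonnegative, so that the image already
  lies in the image of the torus. There, what comes from exponent \<open>k\<close> of \<open>X\<^sub>2\<close> has degree \<open>- k\<close> in \<open>X\<^sub>1\<close>, so
  the different \<open>k\<close> cannot cancel each other; and for one \<open>k\<close> the map is an injective relabelling of
  monomials followed by multiplication with \<open>x_next ^ k\<close>.
\<close>

lemma next_embedding_eq_0D:
  assumes "next_embedding \<kappa> t = 0"
  shows "t = 0"
proof -
  \<comment> \<open>\<open>- N\<close> is a lower bound for the exponents of \<open>X\<^sub>2\<close>.\<close>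
  define N where "N = Max (insert 0 ((\<lambda>m. - coord (xexp m) 2) ` Poly_Mapping.keys t))"
  have N: "- coord (xexp m) 2 \<le> N" if "m \<in> Poly_Mapping.keys t" for m
    unfolding N_def using that by (intro Max_ge) auto
  define t' where "t' = t * mon 0 0 N 0 0"
  have "next_embedding \<kappa> t' = 0"
    using assms lift_mult[OF next_mon_add] by (simp add: t'_def next_embedding_def)
  have keys: "Poly_Mapping.keys t' \<subseteq> {m. 0 \<le> coord (xexp m) 2}"
  proof
    fix m assume "m \<in> Poly_Mapping.keys t'"
    with keys_mult[of t "mon 0 0 N 0 0"] obtain k where
      "k \<in> Poly_Mapping.keys t" "m = k + QMon 0 (0, N, 0, 0)"
      by (auto simp: t'_def mon_def)
    with N show "m \<in> {m. 0 \<le> coord (xexp m) 2}"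
      by (cases k rule: qmon_cases_mon) (force simp: plus_qmon_def plus_prod_def)
  qed
  \<comment> \<open>The effect on a monomial apart from the power of \<open>x_next\<close>, which \<open>\<nu>\<close> restores.\<close>
  define sh where "sh = (\<lambda>m. case m of QMon r (a, b, c, d) \<Rightarrow> mon (r - b * d) 0 a (2 * c - d) c)"
  define \<nu> where "\<nu> = (\<lambda>m. sh m * x_next ^ nat (coord (xexp m) 2))"
  from keys have "next_embedding \<kappa> t' = \<kappa> (frag_extend \<nu> t')"
  proof (induction t' rule: frag_induction)
    case (one m)
    then show ?case
      by (cases m rule: qmon_cases_mon)
        (simp add: frag_of_eq_mon next_embedding_mon \<nu>_def sh_def mult power power_int_def,
         simp add: mon_def mult power sh_def)
  qed (simp_all add: next_embedding_def zero lift_diff frag_extend_diff diff, simp add: lift_def)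
  with \<open>next_embedding \<kappa> t' = 0\<close> have zero': "frag_extend \<nu> t' = 0"
    by (simp add: eq_0_iff)
  have "part (\<lambda>a b. b = k) t' = 0" for k
  proof (cases "k \<ge> 0")
    case False
    then show ?thesis
      using keys by (intro part_eq_0) (auto simp: supp_def)
  next
    case True
    have hom: "part (\<lambda>a b. a = - k) (sh m * x_next ^ n) = (if int n = k then sh m * x_next ^ n else 0)" for m n
    proof -
      have deg: "a = - int n" if "(a, b) \<in> supp (sh m * x_next ^ n)" for a b
      proof -
        have "supp (sh m) \<subseteq> {0} \<times> UNIV"
          by (cases m rule: qmon_cases_mon) (simp add: sh_def supp_mon)
        with that supp_x_next_power supp_mult[of "sh m" "x_next ^ n"] show ?thesis by fastforce
      qed
      show ?thesis
      proof (cases "int n = k")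
        case True
        then show ?thesis by (auto dest: deg intro!: part_eq_self)
      next
        case False
        then show ?thesis by (auto dest: deg intro!: part_eq_0)
      qed
    qed
    from keys have "part (\<lambda>a b. a = - k) (frag_extend \<nu> t') =
        frag_extend sh (part (\<lambda>a b. b = k) t') * x_next ^ nat k"
    proof (induction t' rule: frag_induction)
      case (one m)
      have "part (\<lambda>a b. b = k) (Poly_Mapping.single m 1) =
          (if coord (xexp m) 2 = k then Poly_Mapping.single m 1 else 0)"
        by (simp add: part_def)
      with one show ?case
        by (simp add: \<nu>_def hom)
    qed (simp_all add: part_0 frag_extend_diff part_diff left_diff_distrib)
    with zero' have "frag_extend sh (part (\<lambda>a b. b = k) t') * x_next ^ nat k = 0"
      by (simp add: part_0)
    then have "frag_extend sh (part (\<lambda>a b. b = k) t') = 0"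
      by (rule power_cancel) (rule x_next_nonzero)
    \<comment> \<open>A left inverse of \<open>sh\<close> on the monomials with exponent \<open>k\<close> of \<open>X\<^sub>2\<close>.\<close>
    define bk where "bk = (\<lambda>m. case m of QMon r (a, b, c, d) \<Rightarrow>
        mon (r + k * (2 * d - c)) b k d (2 * d - c))"
    have inv: "frag_extend bk (frag_extend sh w) = w"
      if "Poly_Mapping.keys w \<subseteq> {m. coord (xexp m) 2 = k}" for w
      using that
    proof (induction w rule: frag_induction)
      case (one m)
      then show ?case
        by (cases m rule: qmon_cases_mon) (simp add: bk_def sh_def, simp add: mon_def)
    qed (simp_all add: frag_extend_diff)
    have "Poly_Mapping.keys (part (\<lambda>a b. b = k) t') \<subseteq> {m. coord (xexp m) 2 = k}"
      by (auto simp: in_keys_iff lookup_part split: if_splits)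
    from inv[OF this]
    show ?thesis
      using \<open>frag_extend sh (part (\<lambda>a b. b = k) t') = 0\<close> by simp
  qed
  then have "Poly_Mapping.lookup t' m = 0" for m
    using lookup_part[of "\<lambda>a b. b = coord (xexp m) 2" t' m] by simp
  then have "t' = 0" by (intro poly_mapping_eqI) simp
  moreover have "t = t' * mon 0 0 (- N) 0 0"
    by (simp add: t'_def mult.assoc mon_mult one_eq_mon[symmetric])
  ultimately show ?thesis by simp
qed

lemma torus_embedding_next: "torus_embedding (next_embedding \<kappa>)"
proof
  show "next_embedding \<kappa> 1 = 1"
    by (simp add: one_eq_mon next_embedding_mon) (simp add: one_eq_mon[symmetric] one)
  show "next_embedding \<kappa> (s * t) = next_embedding \<kappa> s * next_embedding \<kappa> t" for s t
    unfolding next_embedding_def by (rule lift_mult) (rule next_mon_add)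
  show "next_embedding \<kappa> (s + t) = next_embedding \<kappa> s + next_embedding \<kappa> t" for s t
    by (simp add: next_embedding_def lift_add)
  fix s t assume "next_embedding \<kappa> s = next_embedding \<kappa> t"
  then have "next_embedding \<kappa> (s - t) = 0" by (simp add: next_embedding_def lift_diff)
  then show "s = t" using next_embedding_eq_0D by fastforce
qed

end

text \<open>
  The reflection turns the step forward into the step backward.
\<close>

definition prev_embedding :: "(qtorus \<Rightarrow> 'f::division_ring) \<Rightarrow> qtorus \<Rightarrow> 'f" where
  "prev_embedding \<kappa> = next_embedding (\<kappa> \<circ> reflect) \<circ> reflect"

text \<open>
  Symmetric bookkeeping for both directions: everything about neighbouring clusters is derived from
  these two equations, whichever of the two embeddings was constructed from the other.
\<close>

locale adjacent =
  \<kappa>: torus_embedding \<kappa> + \<kappa>': torus_embedding \<kappa>' for \<kappa> \<kappa>' :: "qtorus \<Rightarrow> 'f::division_ring" +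
  assumes next_mon: "\<kappa>' (mon r a 0 c d) = \<kappa> (mon r 0 a (2 * c - d) c)"
    and next_X2: "\<kappa>' X2 = \<kappa> x_next"

lemma torus_embedding_prev:
  assumes "torus_embedding \<kappa>"
  shows "torus_embedding (prev_embedding \<kappa>)"
  unfolding prev_embedding_def
  by (intro torus_embedding_reflect torus_embedding.torus_embedding_next assms)

lemma adjacent_next:
  assumes "torus_embedding \<kappa>"
  shows "adjacent \<kappa> (next_embedding \<kappa>)"
proof -
  interpret torus_embedding \<kappa> by fact
  interpret n: torus_embedding "next_embedding \<kappa>" by (rule torus_embedding_next)
  show ?thesis
    by unfold_locales (simp_all add: next_embedding_mon, simp add: one_eq_mon[symmetric] one)
qed

lemma adjacent_prev:
  assumes "torus_embedding \<kappa>"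
  shows "adjacent (prev_embedding \<kappa>) \<kappa>"
proof -
  interpret torus_embedding \<kappa> by fact
  interpret r: torus_embedding "\<kappa> \<circ> reflect" by (rule torus_embedding_reflect) fact
  interpret p: torus_embedding "prev_embedding \<kappa>" by (rule torus_embedding_prev) fact
  have mon: "prev_embedding \<kappa> (mon r a b c d) =
      \<kappa> (mon (r - a * c) b 0 d (2 * d - c)) * \<kappa> x_prev powi a" for r a b c d
    using r.next_embedding_mon[of "- r" b a "- d" "- c"]
    by (simp add: prev_embedding_def reflect_mon reflect_x_next[symmetric] reflect_reflect algebra_simps)
  show ?thesis
  proof
    show "\<kappa> (mon r a 0 c d) = prev_embedding \<kappa> (mon r 0 a (2 * c - d) c)" for r a c d
      by (simp add: mon)
    have "x_prev \<noteq> 0"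
      using x_next_nonzero reflect_reflect[of x_next] by (auto simp: reflect_x_next reflect_0)
    then have x: "\<kappa> x_prev \<noteq> 0" by (simp add: eq_0_iff)
    have "prev_embedding \<kappa> x_next = \<kappa> (X2 * x_prev) * inverse (\<kappa> x_prev)"
      by (simp add: x_next_def p.add mon power_int_minus exchange_prev mon_mult add distrib_right)
    also have "\<dots> = \<kappa> X2" using x by (simp add: mult mult.assoc)
    finally show "\<kappa> X2 = prev_embedding \<kappa> x_next" ..
  qed
qed

context adjacent
begin

lemma next_X1: "\<kappa>' X1 = \<kappa> X2"
  by (simp add: next_mon)


lemma next_coeff: "\<kappa>' (mon r 0 0 c d) = \<kappa> (mon r 0 0 (2 * c - d) c)"
  by (simp add: next_mon)

lemma prev_coeff: "\<kappa> (mon r 0 0 c d) = \<kappa>' (mon r 0 0 d (2 * d - c))"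
  by (simp add: next_mon)

lemma next_Y: "\<kappa>' Y = \<kappa> Y"
  by (simp add: next_mon)

text \<open>
  Both sides agree after multiplication by \<open>x_next\<close>, by the two exchange relations.
\<close>

lemma prev_X1: "\<kappa>' x_prev = \<kappa> X1"
proof -
  have "\<kappa>' x_prev * \<kappa> x_next = \<kappa>' (x_prev * X2)"
    by (simp add: \<kappa>'.mult next_X2)
  also have "\<dots> = \<kappa> (X1 * x_next)"
    by (simp add: exchange_prev exchange_next \<kappa>.add \<kappa>'.add mon_mult next_mon)
  finally show ?thesis
    using x_next_nonzero by (simp add: \<kappa>.mult \<kappa>.eq_0_iff)
qed

text \<open>
  The element \<open>X\<^sub>\<delta>\<close> has the same three-term expansion in all clusters: after multiplication by
  the common variable of two neighbouring clusters, both expansions give the sum of the outer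
  variables, one of them weighted by \<open>Y\<close>.
\<close>

lemma next_delta: "\<kappa>' X_delta = \<kappa> X_delta"
proof -
  have "\<kappa>' X_delta * \<kappa> X2 = \<kappa>' (X_delta * X1)"
    by (simp add: \<kappa>'.mult next_X1)
  also have "\<dots> = \<kappa> (X_delta * X2)"
    by (simp add: delta_X1 delta_X2 \<kappa>.add \<kappa>'.add \<kappa>.mult \<kappa>'.mult next_Y next_X2 prev_X1)
  finally show ?thesis
    using \<kappa>.mon_nonzero by (simp add: \<kappa>.mult)
qed

lemma image_ZP: "\<kappa>' ` ZP = \<kappa> ` ZP"
proof (intro equalityI image_subsetI)
  fix s assume "s \<in> ZP"
  then show "\<kappa>' s \<in> \<kappa> ` ZP"
  proof (induction s rule: ZP_induct)
    case (diff s t)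
    then show ?case by (auto simp: \<kappa>'.diff \<kappa>.diff[symmetric] ZP_diff)
  qed (simp add: next_coeff ZP_mon)
next
  fix s assume "s \<in> ZP"
  then show "\<kappa> s \<in> \<kappa>' ` ZP"
  proof (induction s rule: ZP_induct)
    case (diff s t)
    then show ?case by (auto simp: \<kappa>.diff \<kappa>'.diff[symmetric] ZP_diff)
  qed (simp add: prev_coeff ZP_mon)
qed

lemma image_ZP_nonneg: "\<kappa>' ` ZP_nonneg = \<kappa> ` ZP_nonneg"
proof (intro equalityI image_subsetI)
  fix s assume "s \<in> ZP_nonneg"
  then show "\<kappa>' s \<in> \<kappa> ` ZP_nonneg"
  proof (induction s rule: ZP_nonneg_induct)
    case zero
    show ?case using ZP_nonneg_zero by (force simp: \<kappa>'.zero \<kappa>.zero image_iff)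
  next
    case (add s t)
    then show ?case by (auto simp: \<kappa>'.add \<kappa>.add[symmetric] ZP_nonneg_add)
  qed (simp add: next_coeff ZP_nonneg_mon)
next
  fix s assume "s \<in> ZP_nonneg"
  then show "\<kappa> s \<in> \<kappa>' ` ZP_nonneg"
  proof (induction s rule: ZP_nonneg_induct)
    case zero
    show ?case using ZP_nonneg_zero by (force simp: \<kappa>'.zero \<kappa>.zero image_iff)
  next
    case (add s t)
    then show ?case by (auto simp: \<kappa>.add \<kappa>'.add[symmetric] ZP_nonneg_add)
  qed (simp add: prev_coeff ZP_nonneg_mon)
qed

end

section \<open>The chain of clusters\<close>

definition emb :: "(qtorus \<Rightarrow> 'f::division_ring) \<Rightarrow> int \<Rightarrow> qtorus \<Rightarrow> 'f" where
  "emb \<iota> m = (if m \<ge> 0 then (next_embedding ^^ nat m) \<iota> else (prev_embedding ^^ nat (- m)) \<iota>)"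

locale cluster_chain = torus_embedding \<iota> for \<iota> :: "qtorus \<Rightarrow> 'f::division_ring"
begin

lemma torus_embedding_emb: "torus_embedding (emb \<iota> m)"
proof -
  have "torus_embedding ((next_embedding ^^ n) \<iota>)" for n
    by (induction n) (simp_all add: torus_embedding.torus_embedding_next torus_embedding_axioms)
  moreover have "torus_embedding ((prev_embedding ^^ n) \<iota>)" for n
    by (induction n) (simp_all add: torus_embedding_prev torus_embedding_axioms)
  ultimately show ?thesis by (simp add: emb_def)
qed

lemma adjacent_emb: "adjacent (emb \<iota> m) (emb \<iota> (m + 1))"
proof (cases "m \<ge> 0")
  case True
  then have "emb \<iota> (m + 1) = next_embedding (emb \<iota> m)"
    by (simp add: emb_def nat_add_distrib)
  then show ?thesis using adjacent_next[OF torus_embedding_emb] by simp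
next
  case False
  then have suc: "nat (- m) = Suc (nat (- (m + 1)))" by simp
  have "emb \<iota> m = prev_embedding ((prev_embedding ^^ nat (- (m + 1))) \<iota>)"
    using False by (simp add: emb_def suc)
  also have "(prev_embedding ^^ nat (- (m + 1))) \<iota> = emb \<iota> (m + 1)"
    using False by (cases "m = - 1") (simp_all add: emb_def)
  finally have "emb \<iota> m = prev_embedding (emb \<iota> (m + 1))" .
  then show ?thesis using adjacent_prev[OF torus_embedding_emb] by simp
qed

sublocale emb: adjacent "emb \<iota> m" "emb \<iota> (m + 1)" for m
  by (rule adjacent_emb)

lemma emb_0: "emb \<iota> 0 = \<iota>"
  by (simp add: emb_def)

end

section \<open>Positivity and Newton supports of cluster variables\<close>

text \<open>
  The three terms of \<open>X\<^sub>\<delta>\<close>. The outer two commute and have product \<open>Y\<close>.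
\<close>

abbreviation u_mon :: qtorus where "u_mon \<equiv> mon 0 1 (- 1) 1 1"
abbreviation v_mon :: qtorus where "v_mon \<equiv> mon 0 (- 1) 1 0 0"
abbreviation w_mon :: qtorus where "w_mon \<equiv> mon 0 (- 1) (- 1) 1 0"

text \<open>
  The cluster variables to the right of the initial cluster, expanded in it; those to the left are
  their reflections.
\<close>

fun fwd_var :: "nat \<Rightarrow> qtorus" where
  "fwd_var 0 = X1"
| "fwd_var (Suc 0) = X2"
| "fwd_var (Suc (Suc n)) = X_delta * fwd_var (Suc n) - Y * fwd_var n"

text \<open>
  Since \<open>Y = u_mon * v_mon\<close>, the recursion \<open>t'' = X\<^sub>\<delta> t' - Y t\<close> splits into two first-order
  recursions without subtraction, one for \<open>t\<close> and one for \<open>t' - v_mon * t\<close>. Positivity and the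
  shape of the Newton supports follow by induction along these recursions.
\<close>

lemma subtraction_free_step:
  assumes "t'' = X_delta * t' - Y * t"
  shows "t'' - v_mon * t' = w_mon * t' + u_mon * (t' - v_mon * t)"
    and "t'' - u_mon * t' = w_mon * t' + v_mon * (t' - u_mon * t)"
  by (simp_all add: assms X_delta_eq distrib_right right_diff_distrib mon_mult_assoc)

lemma nonneg_by_diff: "nonneg (s - t) \<Longrightarrow> nonneg t \<Longrightarrow> nonneg s"
  using nonneg_add[of "s - t" t] by simp

lemma fwd_var_nonneg_aux: "nonneg (fwd_var n) \<and> nonneg (fwd_var (Suc n) - v_mon * fwd_var n)"
proof (induction n)
  case 0
  show ?case by (simp add: nonneg_mon mon_mult nonneg_zero)
next
  case (Suc n)
  then have "nonneg (v_mon * fwd_var n)" by (simp add: nonneg_mult nonneg_mon)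
  with Suc have n: "nonneg (fwd_var (Suc n))" by (blast intro: nonneg_by_diff)
  moreover have "nonneg (fwd_var (Suc (Suc n)) - v_mon * fwd_var (Suc n))"
    unfolding subtraction_free_step(1)[OF fwd_var.simps(3)]
    using Suc n by (intro nonneg_add nonneg_mult nonneg_mon) auto
  ultimately show ?case by blast
qed

lemma nonneg_fwd_var: "nonneg (fwd_var n)"
  using fwd_var_nonneg_aux by blast

lemma supp_multI:
  assumes "supp s \<subseteq> A" "supp t \<subseteq> B" "\<And>a b a' b'. (a, b) \<in> A \<Longrightarrow> (a', b') \<in> B \<Longrightarrow> (a + a', b + b') \<in> C"
  shows "supp (s * t) \<subseteq> C"
  using supp_mult[of s t] assms by blast

lemma supp_addI: "supp s \<subseteq> C \<Longrightarrow> supp t \<subseteq> C \<Longrightarrow> supp (s + t) \<subseteq> C"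
  using supp_add[of s t] by blast

lemma supp_diffI: "supp s \<subseteq> C \<Longrightarrow> supp t \<subseteq> C \<Longrightarrow> supp (s - t) \<subseteq> C"
  using supp_diff[of s t] by blast

text \<open>
  Contains the support of the \<open>k\<close>-th variable apart from its corner \<open>(1 - k, k)\<close>.
\<close>

definition lower_triangle :: "nat \<Rightarrow> (int \<times> int) set" where
  "lower_triangle k = {(a, b). 1 - int k \<le> a \<and> 2 - int k \<le> b \<and> a + b \<le> - 1}"

lemma supp_fwd_var_aux:
  "supp (fwd_var (Suc k)) \<subseteq> insert (- int k, int k + 1) (lower_triangle (Suc k)) \<and>
   supp (fwd_var (Suc k) - v_mon * fwd_var k) \<subseteq> lower_triangle (Suc k)"
proof (induction k)
  case 0
  show ?case by (simp add: mon_mult supp_mon supp_zero)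
next
  case (Suc k)
  have D: "supp (fwd_var (Suc (Suc k)) - v_mon * fwd_var (Suc k)) \<subseteq> lower_triangle (Suc (Suc k))"
    unfolding subtraction_free_step(1)[OF fwd_var.simps(3)]
  proof (rule supp_addI)
    show "supp (w_mon * fwd_var (Suc k)) \<subseteq> lower_triangle (Suc (Suc k))"
      by (rule supp_multI[OF _ conjunct1[OF Suc], of _ "{(- 1, - 1)}"]) (auto simp: supp_mon lower_triangle_def)
    show "supp (u_mon * (fwd_var (Suc k) - v_mon * fwd_var k)) \<subseteq> lower_triangle (Suc (Suc k))"
      by (rule supp_multI[OF _ conjunct2[OF Suc], of _ "{(1, - 1)}"]) (auto simp: supp_mon lower_triangle_def)
  qed
  have "supp (v_mon * fwd_var (Suc k)) \<subseteq> insert (- int (Suc k), int (Suc k) + 1) (lower_triangle (Suc (Suc k)))"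
    by (rule supp_multI[OF _ conjunct1[OF Suc], of _ "{(- 1, 1)}"]) (auto simp: supp_mon lower_triangle_def)
  with D have "supp ((fwd_var (Suc (Suc k)) - v_mon * fwd_var (Suc k)) + v_mon * fwd_var (Suc k)) \<subseteq>
      insert (- int (Suc k), int (Suc k) + 1) (lower_triangle (Suc (Suc k)))"
    by (intro supp_addI) auto
  with D show ?case by (simp del: fwd_var.simps)
qed

lemma supp_fwd_var:
  assumes "(a, b) \<in> supp (fwd_var (Suc k))"
  shows "(a, b) = (- int k, int k + 1) \<or> - int k \<le> a \<and> 1 - int k \<le> b \<and> a + b \<le> - 1"
  using supp_fwd_var_aux[of k] assms by (auto simp: lower_triangle_def)

text \<open>
  The linear form with coefficients \<open>k + 1\<close>, \<open>k\<close> is at most zero on the supports of this variable and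
  its successor, with equality only at one corner of the former, but at least zero on the positive quadrant and
  positive at \<open>(1, - 1)\<close>. It is additive, so these bounds pass to products.
\<close>

lemma weight_fwd_var:
  assumes "(a, b) \<in> supp (fwd_var (Suc k))"
  shows "int (Suc k) * a + int k * b \<le> 0"
    and "int (Suc k) * a + int k * b = 0 \<Longrightarrow> (a, b) = (- int k, int k + 1)"
proof -
  have *: "int (Suc k) * a + int k * b = int k * (a + b) + a" by (simp add: algebra_simps)
  consider "(a, b) = (- int k, int k + 1)" | "1 - int k \<le> b" "a + b \<le> - 1"
    using supp_fwd_var[OF assms] by blast
  then have "int (Suc k) * a + int k * b \<le> 0 \<and>
     (int (Suc k) * a + int k * b = 0 \<longrightarrow> (a, b) = (- int k, int k + 1))"
  proof cases
    case 2
    then have "int k * (a + b) \<le> int k * (- 1)" by (intro mult_left_mono) auto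
    with 2 show ?thesis unfolding * by linarith
  qed (simp add: algebra_simps)
  then show "int (Suc k) * a + int k * b \<le> 0"
    and "int (Suc k) * a + int k * b = 0 \<Longrightarrow> (a, b) = (- int k, int k + 1)"
    by blast+
qed

lemma weight_fwd_var_Suc:
  assumes "(a, b) \<in> supp (fwd_var (Suc (Suc k)))"
  shows "int (Suc k) * a + int k * b \<le> - 1"
proof -
  have *: "int (Suc k) * a + int k * b = int k * (a + b) + a" by (simp add: algebra_simps)
  consider "a = - int k - 1" "b = int k + 2" | "- int k \<le> b" "a + b \<le> - 1"
    using supp_fwd_var[OF assms] by auto
  then show ?thesis
  proof cases
    case 1
    then show ?thesis by (simp only:) (simp add: algebra_simps)
  next
    case 2
    then have "int k * (a + b) \<le> int k * (- 1)" by (intro mult_left_mono) auto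
    with 2 show ?thesis unfolding * by linarith
  qed
qed

lemma weight_fwd_var_power:
  assumes "(a, b) \<in> supp (fwd_var (Suc k) ^ n)"
  shows "int (Suc k) * a + int k * b \<le> 0 \<and>
    (int (Suc k) * a + int k * b = 0 \<longrightarrow> (a, b) = (- (int n * int k), int n * (int k + 1)))"
  using assms
proof (induction n arbitrary: a b)
  case (Suc n)
  from Suc.prems obtain a1 b1 a2 b2 where ab: "a = a1 + a2" "b = b1 + b2"
    and 1: "(a1, b1) \<in> supp (fwd_var (Suc k))" and 2: "(a2, b2) \<in> supp (fwd_var (Suc k) ^ n)"
    using supp_mult[of "fwd_var (Suc k)" "fwd_var (Suc k) ^ n"] by auto
  have "int (Suc k) * a + int k * b =
      (int (Suc k) * a1 + int k * b1) + (int (Suc k) * a2 + int k * b2)"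
    by (simp add: ab algebra_simps)
  then show ?case
    using weight_fwd_var[OF 1] Suc.IH[OF 2] by (auto simp: ab algebra_simps)
qed (simp add: supp_one)

lemma weight_fwd_var_Suc_power:
  assumes "(a, b) \<in> supp (fwd_var (Suc (Suc k)) ^ n)"
  shows "int (Suc k) * a + int k * b \<le> - int n"
  using assms
proof (induction n arbitrary: a b)
  case (Suc n)
  from Suc.prems obtain a1 b1 a2 b2 where ab: "a = a1 + a2" "b = b1 + b2"
    and 1: "(a1, b1) \<in> supp (fwd_var (Suc (Suc k)))" and 2: "(a2, b2) \<in> supp (fwd_var (Suc (Suc k)) ^ n)"
    using supp_mult[of "fwd_var (Suc (Suc k))" "fwd_var (Suc (Suc k)) ^ n"] by (auto simp del: fwd_var.simps)
  have "int (Suc k) * a + int k * b =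
      (int (Suc k) * a1 + int k * b1) + (int (Suc k) * a2 + int k * b2)"
    by (simp add: ab algebra_simps)
  then show ?case
    using weight_fwd_var_Suc[OF 1] Suc.IH[OF 2] by linarith
qed (simp add: supp_one)

lemma weight_cluster_monomial:
  assumes "(a, b) \<in> supp (fwd_var (Suc k) ^ i * fwd_var (Suc (Suc k)) ^ j)"
  shows "int (Suc k) * a + int k * b \<le> 0"
    and "int (Suc k) * a + int k * b = 0 \<Longrightarrow> j = 0 \<and> (a, b) = (- (int i * int k), int i * (int k + 1))"
proof -
  from assms obtain a1 b1 a2 b2 where ab: "a = a1 + a2" "b = b1 + b2"
    and 1: "(a1, b1) \<in> supp (fwd_var (Suc k) ^ i)" and 2: "(a2, b2) \<in> supp (fwd_var (Suc (Suc k)) ^ j)"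
    using supp_mult[of "fwd_var (Suc k) ^ i" "fwd_var (Suc (Suc k)) ^ j"] by (auto simp del: fwd_var.simps)
  have eq: "int (Suc k) * a + int k * b =
      (int (Suc k) * a1 + int k * b1) + (int (Suc k) * a2 + int k * b2)"
    by (simp add: ab algebra_simps)
  with weight_fwd_var_power[OF 1] weight_fwd_var_Suc_power[OF 2]
  show "int (Suc k) * a + int k * b \<le> 0" by linarith
  assume "int (Suc k) * a + int k * b = 0"
  with eq weight_fwd_var_power[OF 1] weight_fwd_var_Suc_power[OF 2]
  have j: "j = 0" and "(a1, b1) = (- (int i * int k), int i * (int k + 1))" by linarith+
  moreover from j 2 have "(a2, b2) = (0, 0)" by (simp add: supp_one)
  ultimately show "j = 0 \<and> (a, b) = (- (int i * int k), int i * (int k + 1))"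
    by (simp add: ab)
qed

text \<open>
  Expanded in the initial cluster, a cluster monomial that is not also one of the initial cluster has
  a negative exponent in each of its terms.
\<close>

lemma proper_cluster_monomial:
  assumes "(a, b) \<in> supp (fwd_var (Suc k) ^ i * fwd_var (Suc (Suc k)) ^ j)" and "0 \<le> a" and "0 \<le> b"
  shows "j = 0 \<and> (i = 0 \<or> k = 0)"
proof -
  have "int (Suc k) * a + int k * b = 0"
    using weight_cluster_monomial(1)[OF assms(1)] assms(2,3)
    by (intro antisym) (simp_all add: add_nonneg_nonneg)
  from weight_cluster_monomial(2)[OF assms(1) this] have "j = 0" and a: "a = - (int i * int k)"
    by simp_all
  moreover from a assms(2) have "int i * int k \<le> 0" by linarith
  then have "i = 0 \<or> k = 0" by (auto simp: mult_le_0_iff)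
  ultimately show ?thesis by blast
qed

lemma antidiagonal_cluster_monomial:
  assumes "p > 0"
  shows "(p, - p) \<notin> supp (fwd_var (Suc k) ^ i * fwd_var (Suc (Suc k)) ^ j)"
  using weight_cluster_monomial(1)[of p "- p" k i j] assms by (auto simp: algebra_simps)

section \<open>Positivity and leading terms of the elements F\<close>

lemma F_2: "F 2 = X_delta * X_delta - (Y + Y)"
  by (simp add: numeral_2_eq_2 X0_eq_mon mult_2)

lemma F_step: "F (n + 3) = F (n + 2) * X_delta - Y * F (n + 1)"
  by (simp add: numeral_3_eq_3 numeral_2_eq_2 X0_eq_mon)

lemma F_induct [case_names 0 1 2 step]:
  fixes n :: nat
  assumes "P 0" "P 1" "P 2" "\<And>n. P (n + 1) \<Longrightarrow> P (n + 2) \<Longrightarrow> P (n + 3)"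
  shows "P n"
  using assms by (induction n rule: F.induct) (simp_all add: numeral_3_eq_3 numeral_2_eq_2)

text \<open>
  The elements \<open>F n\<close> are polynomials in \<open>X\<^sub>\<delta>\<close> and \<open>Y\<close>, which commute.
\<close>

lemma F_commute: "F n * X_delta = X_delta * F n \<and> F n * Y = Y * F n"
proof (induction n rule: F_induct)
  case 2
  have "X_delta * X_delta * Y = Y * (X_delta * X_delta)"
    by (metis delta_Y mult.assoc)
  then show ?case
    by (simp add: F_2 left_diff_distrib right_diff_distrib distrib_left distrib_right mult.assoc delta_Y)
next
  case (step n)
  have 1: "F (n + 2) * X_delta * X_delta = X_delta * (F (n + 2) * X_delta)"
    "F (n + 2) * X_delta * Y = Y * (F (n + 2) * X_delta)"
    "Y * F (n + 1) * X_delta = X_delta * (Y * F (n + 1))"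
    "Y * F (n + 1) * Y = Y * (Y * F (n + 1))"
    by (metis step delta_Y mult.assoc)+
  show ?case by (simp only: F_step left_diff_distrib right_diff_distrib 1)
qed (simp_all add: delta_Y)

lemma bar_F: "bar (F n) = F n"
proof (induction n rule: F_induct)
  case 0
  show ?case by (simp add: bar_one)
next
  case 1
  show ?case by (simp add: X_delta_eq bar_add bar_mon)
next
  case 2
  show ?case by (simp add: F_2 X_delta_eq bar_diff bar_mult bar_add bar_mon)
next
  case (step n)
  have "bar X_delta = X_delta" by (simp add: X_delta_eq bar_add bar_mon)
  with step show ?case
    by (simp add: F_step bar_diff bar_mult bar_mon F_commute)
qed

text \<open>
  Chebyshev polynomials of the second kind in \<open>X\<^sub>\<delta>\<close>; the \<open>F n\<close> are those of the first kind.
\<close>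

fun chebyshev :: "nat \<Rightarrow> qtorus" where
  "chebyshev 0 = 1"
| "chebyshev (Suc 0) = X_delta"
| "chebyshev (Suc (Suc n)) = X_delta * chebyshev (Suc n) - Y * chebyshev n"

lemma chebyshev_nonneg:
  "nonneg (chebyshev n) \<and> nonneg (chebyshev (Suc n) - v_mon * chebyshev n) \<and>
   nonneg (chebyshev (Suc n) - u_mon * chebyshev n)"
proof (induction n)
  case 0
  show ?case by (simp add: X_delta_eq nonneg_one nonneg_add nonneg_mon)
next
  case (Suc n)
  then have "nonneg (v_mon * chebyshev n)" by (simp add: nonneg_mult nonneg_mon)
  with Suc have n: "nonneg (chebyshev (Suc n))" by (blast intro: nonneg_by_diff)
  moreover have "nonneg (chebyshev (Suc (Suc n)) - v_mon * chebyshev (Suc n))"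
    "nonneg (chebyshev (Suc (Suc n)) - u_mon * chebyshev (Suc n))"
    unfolding subtraction_free_step[OF chebyshev.simps(3)]
    using Suc n by (auto intro!: nonneg_add nonneg_mult nonneg_mon)
  ultimately show ?case by blast
qed

lemma chebyshev_commute: "chebyshev n * X_delta = X_delta * chebyshev n"
proof (induction n rule: chebyshev.induct)
  case (3 n)
  have 1: "X_delta * chebyshev (Suc n) * X_delta = X_delta * (X_delta * chebyshev (Suc n))"
    "Y * chebyshev n * X_delta = X_delta * (Y * chebyshev n)"
    by (metis 3 delta_Y mult.assoc)+
  show ?case by (simp only: chebyshev.simps left_diff_distrib right_diff_distrib 1)
qed simp_all

lemma F_chebyshev: "F (n + 2) = chebyshev (n + 2) - Y * chebyshev n"
proof (induction n rule: less_induct)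
  case (less n)
  consider "n = 0" | "n = 1" | m where "n = m + 2"
    by (metis One_nat_def add_2_eq_Suc' not0_implies_Suc)
  then show ?case
  proof cases
    case 1
    then show ?thesis using F_2 by (simp add: numeral_2_eq_2 diff_diff_eq)
  next
    case 2
    have "F (1 + 2) = F (0 + 3)"
      by (rule arg_cong[of _ _ F]) simp
    also have "\<dots> = F 2 * X_delta - Y * X_delta"
      by (simp only: F_step) (simp only: add_0 F.simps One_nat_def)
    also have "\<dots> = (X_delta * X_delta - (Y + Y)) * X_delta - Y * X_delta"
      by (simp only: F_2)
    also have "\<dots> = X_delta * (X_delta * X_delta - Y) - Y * X_delta - Y * X_delta"
      by (simp only: left_diff_distrib right_diff_distrib distrib_right mult.assoc delta_Y) simp
    also have "\<dots> = chebyshev (1 + 2) - Y * chebyshev 1"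
      by (simp add: numeral_2_eq_2)
    finally show ?thesis using 2 by simp
  next
    case (3 m)
    have "F (n + 2) = F (m + 1 + 2) * X_delta - Y * F (m + 2)"
      using F_step[of "m + 1"] 3 by (simp add: add.commute numeral_3_eq_3 numeral_2_eq_2)
    also have "F (m + 1 + 2) = chebyshev (m + 1 + 2) - Y * chebyshev (m + 1)"
      by (rule less.IH) (simp add: 3)
    also have "F (m + 2) = chebyshev (m + 2) - Y * chebyshev m"
      by (rule less.IH) (simp add: 3)
    also have "(chebyshev (m + 1 + 2) - Y * chebyshev (m + 1)) * X_delta - Y * (chebyshev (m + 2) - Y * chebyshev m)
      = (X_delta * chebyshev (m + 1 + 2) - Y * chebyshev (m + 2)) -
        Y * (X_delta * chebyshev (m + 1) - Y * chebyshev m)"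
      by (simp only: left_diff_distrib right_diff_distrib mult.assoc chebyshev_commute) simp
    finally show ?thesis by (simp add: 3 numeral_2_eq_2)
  qed
qed

text \<open>
  \<open>S\<^sub>n - Y S\<^sub>n\<^sub>-\<^sub>2 = (S\<^sub>n - v S\<^sub>n\<^sub>-\<^sub>1) + v (S\<^sub>n\<^sub>-\<^sub>1 - u S\<^sub>n\<^sub>-\<^sub>2)\<close> because \<open>v u = Y\<close>, and both summands are free of
  subtractions.
\<close>

lemma nonneg_F: "nonneg (F n)"
proof -
  consider "n = 0" | "n = 1" | m where "n = m + 2"
    by (metis One_nat_def add_2_eq_Suc' not0_implies_Suc)
  then show ?thesis
  proof cases
    case (3 m)
    have "F n = (chebyshev (Suc (Suc m)) - v_mon * chebyshev (Suc m)) +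
        v_mon * (chebyshev (Suc m) - u_mon * chebyshev m)"
      using F_chebyshev[of m] by (simp add: 3 right_diff_distrib mon_mult_assoc)
    also have "nonneg \<dots>"
      using chebyshev_nonneg[of "Suc m"] chebyshev_nonneg[of m]
      by (intro nonneg_add nonneg_mult nonneg_mon) auto
    finally show ?thesis .
  qed (simp_all add: nonneg_one X_delta_eq nonneg_add nonneg_mon)
qed

text \<open>
  In top degree \<open>w_mon\<close> does not contribute, and what remains is the identity
  \<open>F\<^sub>n(u + v) = u\<^sup>n + v\<^sup>n\<close> for \<open>u v = Y\<close>. In particular the antidiagonal carries only two terms of
  \<open>F n\<close>, which distinguishes the \<open>F n\<close> from each other.
\<close>

lemma F_leading:
  "n \<ge> 1 \<Longrightarrow> \<exists>t. F n = u_mon ^ n + v_mon ^ n + t \<and> supp t \<subseteq> {(a, b). a + b < 0}"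
proof (induction n rule: F_induct)
  case 1
  show ?case by (intro exI[of _ w_mon]) (simp add: X_delta_eq supp_mon)
next
  case 2
  have "F 2 = u_mon ^ 2 + v_mon ^ 2 +
      ((u_mon + v_mon) * w_mon + w_mon * (u_mon + v_mon) + w_mon * w_mon)"
    by (simp add: F_2 X_delta_eq power2_eq_square distrib_left distrib_right mon_mult)
  moreover have "supp ((u_mon + v_mon) * w_mon + w_mon * (u_mon + v_mon) + w_mon * w_mon) \<subseteq>
       {(a, b). a + b < 0}"
    by (simp add: distrib_left distrib_right mon_mult) (intro supp_addI; simp add: supp_mon)
  ultimately show ?case by blast
next
  case (step n)
  then obtain s t where s: "F (n + 1) = u_mon ^ (n + 1) + v_mon ^ (n + 1) + s" "supp s \<subseteq> {(a, b). a + b < 0}"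
    and t: "F (n + 2) = u_mon ^ (n + 2) + v_mon ^ (n + 2) + t" "supp t \<subseteq> {(a, b). a + b < 0}"
    by fastforce
  have pow: "u_mon ^ (n + 2) * v_mon = Y * u_mon ^ (n + 1)" "v_mon ^ (n + 2) * u_mon = Y * v_mon ^ (n + 1)"
    "u_mon ^ (n + 2) * u_mon = u_mon ^ (n + 3)" "v_mon ^ (n + 2) * v_mon = v_mon ^ (n + 3)"
    by (simp_all only: mon_power mon_mult) (rule mon_cong; simp)+
  have "F (n + 3) = u_mon ^ (n + 3) + v_mon ^ (n + 3) +
      ((u_mon ^ (n + 2) + v_mon ^ (n + 2)) * w_mon + t * X_delta - Y * s)"
    by (simp only: F_step s t X_delta_eq distrib_left distrib_right pow) simp
  moreover have "supp ((u_mon ^ (n + 2) + v_mon ^ (n + 2)) * w_mon + t * X_delta - Y * s) \<subseteq>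
       {(a, b). a + b < 0}"
  proof (intro supp_diffI supp_addI)
    show "supp ((u_mon ^ (n + 2) + v_mon ^ (n + 2)) * w_mon) \<subseteq> {(a, b). a + b < 0}"
      unfolding mon_power mon_mult distrib_right by (intro supp_addI) (simp_all add: supp_mon)
    have "supp X_delta \<subseteq> {(a, b). a + b \<le> 0}"
      unfolding X_delta_eq by (intro supp_addI) (simp_all add: supp_mon)
    with t(2) show "supp (t * X_delta) \<subseteq> {(a, b). a + b < 0}"
      by (rule supp_multI) auto
    show "supp (Y * s) \<subseteq> {(a, b). a + b < 0}"
      by (rule supp_multI[OF _ s(2), of _ "{(0, 0)}"]) (auto simp: supp_mon)
  qed
  ultimately show ?case by blast
qed simp

lemma supp_F:
  assumes "n \<ge> 1" and "(a, b) \<in> supp (F n)"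
  shows "a + b < 0 \<or> (a, b) = (int n, - int n) \<or> (a, b) = (- int n, int n)"
proof -
  from F_leading[OF assms(1)] obtain t
    where t: "F n = u_mon ^ n + v_mon ^ n + t" "supp t \<subseteq> {(a, b). a + b < 0}" by blast
  have "supp (F n) \<subseteq> {(a, b). a + b < 0 \<or> (a, b) = (int n, - int n) \<or> (a, b) = (- int n, int n)}"
    unfolding t(1) using t(2) by (intro supp_addI) (auto simp: mon_power supp_mon)
  with assms(2) show ?thesis by auto
qed

lemma part_F:
  assumes "n \<ge> 1"
  shows "part (\<lambda>a b. a = int n \<and> b = - int n) (F n) = mon 0 (int n) (- int n) (int n) (int n)"
proof -
  from F_leading[OF assms(1)] obtain t
    where t: "F n = u_mon ^ n + v_mon ^ n + t" "supp t \<subseteq> {(a, b). a + b < 0}" by blast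
  from t(2) have "part (\<lambda>a b. a = int n \<and> b = - int n) t = 0" by (intro part_eq_0) auto
  with assms show ?thesis by (simp add: t(1) part_add mon_power part_mon)
qed

section \<open>Relations between cluster variables\<close>

context cluster_chain
begin

text \<open>
  The cluster variables, up to a coefficient for negative \<open>m\<close>. The initial cluster is
  \<open>var 0\<close>, \<open>var 1\<close>, and the \<open>m\<close>-th one \<open>var m\<close>, \<open>var (m + 1)\<close>.
\<close>

definition var :: "int \<Rightarrow> 'f" where
  "var m = emb \<iota> m X1"

abbreviation \<delta> :: 'f where "\<delta> \<equiv> \<iota> X_delta"

lemma emb_constant:
  assumes "\<And>m. f (m + 1 :: int) = f m"
  shows "f m = f 0"
proof (induction m rule: int_induct[of _ 0])
  case (step2 i)
  then show ?case using assms[of "i - 1"] by simp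
qed (simp_all add: assms)

lemma emb_X2: "emb \<iota> m X2 = var (m + 1)"
  by (simp add: var_def emb.next_X1)

lemma emb_x_next: "emb \<iota> m x_next = var (m + 2)"
  using emb.next_X2[of m] emb_X2[of "m + 1"] by (simp add: add.assoc)

lemma emb_delta: "emb \<iota> m X_delta = \<delta>"
  using emb_constant[of "\<lambda>m. emb \<iota> m X_delta"] emb.next_delta by (simp add: emb_0)

lemma emb_Y: "emb \<iota> m Y = \<iota> Y"
  using emb_constant[of "\<lambda>m. emb \<iota> m Y"] emb.next_Y by (simp add: emb_0)

lemma emb_qhalf: "emb \<iota> m (mon r 0 0 0 0) = \<iota> (mon r 0 0 0 0)"
  using emb_constant[of "\<lambda>m. emb \<iota> m (mon r 0 0 0 0)"] emb.next_coeff by (simp add: emb_0)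

lemma emb_ZP: "emb \<iota> m ` ZP = \<iota> ` ZP"
  using emb_constant[of "\<lambda>m. emb \<iota> m ` ZP"] emb.image_ZP by (simp add: emb_0)

lemma emb_ZP_nonneg: "emb \<iota> m ` ZP_nonneg = \<iota> ` ZP_nonneg"
  using emb_constant[of "\<lambda>m. emb \<iota> m ` ZP_nonneg"] emb.image_ZP_nonneg by (simp add: emb_0)

lemma delta_var: "\<delta> * var (m + 1) = var (m + 2) + \<iota> Y * var m"
proof -
  have "emb \<iota> m (X_delta * X2) = emb \<iota> m (x_next + Y * X1)" by (simp only: delta_X2)
  then show ?thesis
    by (simp add: emb.\<kappa>.mult emb.\<kappa>.add emb_delta emb_X2 emb_x_next emb_Y var_def[symmetric])
qed

lemma var_delta: "var (m + 1) * \<delta> = var (m + 2) + var m * \<iota> Y"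
proof -
  have "emb \<iota> m (X2 * X_delta) = emb \<iota> m (x_next + X1 * Y)" by (simp only: X2_delta)
  then show ?thesis
    by (simp add: emb.\<kappa>.mult emb.\<kappa>.add emb_delta emb_X2 emb_x_next emb_Y var_def[symmetric])
qed

lemma var_commute: "var m * var (m + 1) = var (m + 1) * var m"
proof -
  have "emb \<iota> m (X1 * X2) = emb \<iota> m (X2 * X1)" by (simp only: X1_X2_commute)
  then show ?thesis by (simp only: emb.\<kappa>.mult emb_X2 var_def[symmetric])
qed

lemma var_exchange: "\<exists>c \<in> \<iota> ` ZP. var (m + 2) * var m = var (m + 1) * var (m + 1) + c"
proof -
  have "emb \<iota> m (x_next * X1) = emb \<iota> m (X2 * X2 + mon 1 0 0 1 0)" by (simp only: exchange_next)
  then have "var (m + 2) * var m = var (m + 1) * var (m + 1) + emb \<iota> m (mon 1 0 0 1 0)"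
    by (simp only: emb.\<kappa>.mult emb.\<kappa>.add emb_X2 emb_x_next var_def[symmetric])
  moreover have "emb \<iota> m (mon 1 0 0 1 0) \<in> \<iota> ` ZP" using emb_ZP ZP_mon by blast
  ultimately show ?thesis by blast
qed

lemma emb_fwd_var: "emb \<iota> m (fwd_var n) = var (m + int n)"
proof (induction n rule: fwd_var.induct)
  case (3 n)
  then show ?case
    using delta_var[of "m + int n"]
    by (simp add: emb.\<kappa>.diff emb.\<kappa>.mult emb_delta emb_Y add_ac)
qed (simp_all add: var_def emb.next_X1)

lemma Y_inverse: "\<iota> (mon 0 0 0 (- 1) (- 1)) * (\<iota> Y * z) = z"
  by (simp add: mult.assoc[symmetric] mult[symmetric] mon_mult one_eq_mon[symmetric] one)

lemma reflect_delta: "reflect X_delta = mon 0 0 0 (- 1) (- 1) * X_delta"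
  by (subst (2) reflect_X_delta[symmetric]) (simp add: mon_mult_assoc one_eq_mon[symmetric])

lemma emb_reflect_fwd_var: "emb \<iota> m (reflect (fwd_var n)) = var (m + 1 - int n)"
proof (induction n rule: fwd_var.induct)
  case 1
  show ?case by (simp add: reflect_mon emb_X2)
next
  case 2
  show ?case by (simp add: reflect_mon var_def)
next
  case (3 n)
  have Yi: "emb \<iota> m (mon 0 0 0 (- 1) (- 1)) = \<iota> (mon 0 0 0 (- 1) (- 1))"
    using emb.\<kappa>.inverse_mon[of m 0 0 0 1 1] inverse_mon[of 0 0 0 1 1] by (simp add: emb_Y)
  have "var (m - int n - 1) = \<iota> (mon 0 0 0 (- 1) (- 1)) * (\<delta> * var (m - int n) - var (m - int n + 1))"
    using delta_var[of "m - int n - 1"] by (simp add: Y_inverse add.commute)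
  with 3 show ?case
    by (simp add: reflect_diff reflect_mult reflect_mon reflect_delta emb.\<kappa>.diff emb.\<kappa>.mult
        emb_delta Yi mult.assoc right_diff_distrib algebra_simps)
qed

lemma emb_mon_nat: "emb \<iota> m (mon 0 (int i) (int j) 0 0) = var m ^ i * var (m + 1) ^ j"
proof -
  have "mon 0 (int i) (int j) 0 0 = X1 ^ i * X2 ^ j" by (simp add: mon_power mon_mult)
  then show ?thesis by (simp only: emb.\<kappa>.mult emb.\<kappa>.power emb_X2 var_def[symmetric])
qed

text \<open>
  Bar reverses products, so it turns the recursion with \<open>X\<^sub>\<delta>\<close> and \<open>Y\<close> on the left into the one
  with these on the right, which the variables satisfy as well.
\<close>

lemma bar_fwd_var: "bar (fwd_var n) = fwd_var n"
proof (induction n rule: fwd_var.induct)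
  case (3 n)
  have "bar X_delta = X_delta" by (simp add: X_delta_eq bar_add bar_mon)
  with 3 have "bar (fwd_var (Suc (Suc n))) = fwd_var (Suc n) * X_delta - fwd_var n * Y"
    by (simp add: bar_diff bar_mult bar_mon)
  also have "\<dots> = fwd_var (Suc (Suc n))"
  proof (rule eqD)
    have "\<iota> (fwd_var n) = var (int n)" for n using emb_fwd_var[of 0 n] by (simp add: emb_0)
    then show "\<iota> (fwd_var (Suc n) * X_delta - fwd_var n * Y) = \<iota> (fwd_var (Suc (Suc n)))"
      using var_delta[of "int n"] by (simp add: diff mult add_ac del: fwd_var.simps)
  qed
  finally show ?case .
qed (simp_all add: bar_mon)

end

section \<open>Seeds and mutations\<close>

definition lattice_comb :: "(nat \<Rightarrow> int) \<Rightarrow> (nat \<Rightarrow> int4) \<Rightarrow> int4" where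
  "lattice_comb a g = (let h = (\<lambda>l. a 1 * coord (g 1) l + a 2 * coord (g 2) l + a 3 * coord (g 3) l + a 4 * coord (g 4) l)
     in (h 1, h 2, h 3, h 4))"

lemma sum_1_4: "(\<Sum>i = 1..4::nat. f i) = f 1 + f 2 + f 3 + (f 4 :: int)"
proof -
  have "{1..4::nat} = {1, 2, 3, 4}" by auto
  then show ?thesis by (simp add: add.assoc)
qed

fun scale4 :: "int \<Rightarrow> int4 \<Rightarrow> int4" where
  "scale4 n (a, b, c, d) = (n * a, n * b, n * c, n * d)"

lemma LambdaForm_add_left: "LambdaForm (e + f) g = LambdaForm e g + LambdaForm f g"
  by (cases e, cases f, cases g) (simp add: LambdaForm_explicit plus_prod_def algebra_simps)

lemma LambdaForm_scale4: "LambdaForm (scale4 m e) (scale4 n f) = m * n * LambdaForm e f"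
  by (cases e, cases f) (simp add: LambdaForm_explicit algebra_simps)

lemma lattice_comb_eq_sum:
  "lattice_comb a g = scale4 (a 1) (g 1) + scale4 (a 2) (g 2) + scale4 (a 3) (g 3) + scale4 (a 4) (g 4)"
  unfolding lattice_comb_def
  by (cases "g 1", cases "g 2", cases "g 3", cases "g 4") (simp add: plus_prod_def del: One_nat_def)

lemma LambdaForm_scale4_left: "LambdaForm (scale4 m e) f = m * LambdaForm e f"
  by (cases e, cases f) (simp add: LambdaForm_explicit algebra_simps)

lemma LambdaForm_lattice_comb_left: "LambdaForm (lattice_comb a g) f = (\<Sum>p = 1..4. a p * LambdaForm (g p) f)"
  by (simp only: lattice_comb_eq_sum sum_1_4 LambdaForm_add_left LambdaForm_scale4_left)

lemma LambdaForm_skew: "LambdaForm e f = - LambdaForm f e"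
  by (cases e, cases f) (simp add: LambdaForm_explicit algebra_simps)

lemma LambdaForm_lattice_comb_right: "LambdaForm f (lattice_comb a g) = (\<Sum>p = 1..4. LambdaForm f (g p) * a p)"
  unfolding LambdaForm_skew[of f] LambdaForm_lattice_comb_left by (simp add: sum_negf[symmetric] mult.commute)

lemma LambdaForm_lattice_comb:
  "(\<Sum>p = 1..4. \<Sum>r = 1..4. a p * LambdaForm (g p) (g r) * b r) = LambdaForm (lattice_comb a g) (lattice_comb b g)"
proof -
  have "LambdaForm (lattice_comb a g) (lattice_comb b g) = (\<Sum>p = 1..4. a p * (\<Sum>r = 1..4. LambdaForm (g p) (g r) * b r))"
    by (subst LambdaForm_lattice_comb_left) (simp only: LambdaForm_lattice_comb_right)
  then show ?thesis by (simp only: sum_distrib_left mult.assoc)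
qed

text \<open>
  The normalising power of \<open>q\<close> in a seed monomial is made for this: if the seed elements are
  themselves monomials in some cluster, with matching \<open>\<Lambda>\<close>, then seed monomials are monomials.
\<close>

lemma (in torus_embedding) seed_monomial_eq:
  assumes X: "\<And>i. i \<in> {1..4} \<Longrightarrow> Xs S i = \<kappa> (X0 (g i))"
    and L: "\<And>i j. i \<in> {1..4} \<Longrightarrow> j \<in> {1..4} \<Longrightarrow> Lam S i j = LambdaForm (g i) (g j)"
    and q: "\<And>r. \<iota> (qhalf r) = \<kappa> (qhalf r)"
  shows "seed_monomial \<iota> S a = \<kappa> (X0 (lattice_comb a g))"
proof -
  have int: "{1..<1::nat} = {}" "{1..<2::nat} = {1}" "{1..<3::nat} = {1, 2}" "{1..<4::nat} = {1, 2, 3}"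
    by auto
  define \<Lambda> where "\<Lambda> = (\<lambda>i j. a i * a j * LambdaForm (g i) (g j))"
  have sum: "(\<Sum>j = 1..4. \<Sum>i = 1..<j. a i * a j * Lam S i j) =
     \<Lambda> 1 2 + (\<Lambda> 1 3 + \<Lambda> 2 3) + (\<Lambda> 1 4 + \<Lambda> 2 4 + \<Lambda> 3 4)"
    unfolding sum_1_4 int by (simp add: L \<Lambda>_def del: One_nat_def)
  have pow: "Xs S i powi a i = \<kappa> (X0 (scale4 (a i) (g i)))" if "i \<in> {1..4}" for i
    using that by (cases "g i") (simp add: X X0_eq_mon mon_power_int)
  have pow1: "Xs S 1 powi a 1 = \<kappa> (X0 (scale4 (a 1) (g 1)))" "Xs S 2 powi a 2 = \<kappa> (X0 (scale4 (a 2) (g 2)))"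
     "Xs S 3 powi a 3 = \<kappa> (X0 (scale4 (a 3) (g 3)))" "Xs S 4 powi a 4 = \<kappa> (X0 (scale4 (a 4) (g 4)))"
    by (rule pow; simp)+
  have X0_mult3: "X0 e * (X0 f * t) = qhalf (LambdaForm e f) * (X0 (e + f) * t)" for e f t
    by (simp only: mult.assoc[symmetric] X0_mult)
  have "X0 (scale4 (a 1) (g 1)) * X0 (scale4 (a 2) (g 2)) * X0 (scale4 (a 3) (g 3)) * X0 (scale4 (a 4) (g 4)) =
      qhalf (\<Lambda> 1 2) * (qhalf (\<Lambda> 1 3 + \<Lambda> 2 3) * (qhalf (\<Lambda> 1 4 + \<Lambda> 2 4 + \<Lambda> 3 4) * X0 (lattice_comb a g)))"
    by (simp only: mult.assoc X0_mult X0_mult3 LambdaForm_add_left LambdaForm_scale4 \<Lambda>_def lattice_comb_eq_sum)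
  also have "\<dots> = qhalf (\<Lambda> 1 2 + (\<Lambda> 1 3 + \<Lambda> 2 3) + (\<Lambda> 1 4 + \<Lambda> 2 4 + \<Lambda> 3 4)) * X0 (lattice_comb a g)"
    by (simp only: mult.assoc[symmetric] qhalf_add add.assoc)
  finally have prod: "X0 (scale4 (a 1) (g 1)) * X0 (scale4 (a 2) (g 2)) * X0 (scale4 (a 3) (g 3)) *
      X0 (scale4 (a 4) (g 4)) = \<dots>" .
  have inv: "qhalf (- r) * (qhalf r * t) = t" for r t
  proof -
    have "qhalf (- r) * qhalf r = 1" by (simp add: qhalf_eq_mon mon_mult one_eq_mon)
    then show ?thesis by (simp add: mult.assoc[symmetric])
  qed
  show ?thesis
    unfolding seed_monomial_def q sum pow1 by (simp only: mult[symmetric] prod inv)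
qed

text \<open>
  The seed at position \<open>m\<close> of the chain, in the exponents of the embedding \<open>emb \<iota> m\<close>. Seeds are
  labelled, and moving along the chain exchanges the roles of the indices \<open>1\<close> and \<open>2\<close>; \<open>p\<close> is
  the index of the element belonging to \<open>X\<^sub>1\<close>. The cases \<open>m < 0\<close> record the coefficients by
  which cluster variables differ from \<open>var\<close>; the indices \<open>3\<close> and \<open>4\<close> hold \<open>y\<^sub>1\<close>, \<open>y\<^sub>2\<close>
  rewritten in the coordinates of this cluster.
\<close>

definition gvec :: "int \<Rightarrow> nat \<Rightarrow> nat \<Rightarrow> int4" where
  "gvec m p i =
     (if i = p then (if m \<ge> 0 then (1, 0, 0, 0) else (1, 0, - 1, 0))
      else if i = 3 - p then (if m \<ge> - 1 then (0, 1, 0, 0) else (0, 1, - 2, - 1))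
      else if i = 3 then (0, 0, 1 - m, - m)
      else (0, 0, m, m + 1))"

text \<open>
  With \<open>g i = gvec m p i\<close>, the column of index \<open>p\<close> is determined by the condition that the sum of the
  \<open>bmat m p i p\<close>-fold \<open>g i\<close> is \<open>(0, - 2, 1, 0)\<close>, and the other column by the analogous sum being
  \<open>(2, 0, 0, 1)\<close>: these are the columns of the initial exchange matrix, and the shift along the
  chain preserves them. The case distinctions mirror those in \<open>gvec\<close>.
\<close>

definition bmat :: "int \<Rightarrow> nat \<Rightarrow> nat \<Rightarrow> nat \<Rightarrow> int" where
  "bmat m p i j =
     (if j = p then
        (if i = p then 0 else if i = 3 - p then - 2
         else if i = 3 then (if m \<ge> - 1 then m + 1 else - m - 3)
         else (if m \<ge> - 1 then m else - m - 2))
      else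
        (if i = p then 2 else if i = 3 - p then 0
         else if i = 3 then (if m \<ge> 0 then - m else m + 2)
         else (if m \<ge> 0 then 1 - m else m + 1)))"

context cluster_chain
begin

definition seed_at :: "int \<Rightarrow> nat \<Rightarrow> 'f qseed \<Rightarrow> bool" where
  "seed_at m p S \<longleftrightarrow> p \<in> {1, 2} \<and>
     (\<forall>i \<in> {1..4}. Xs S i = emb \<iota> m (X0 (gvec m p i))) \<and>
     (\<forall>i \<in> {1..4}. \<forall>j \<in> {1..4}. Lam S i j = LambdaForm (gvec m p i) (gvec m p j)) \<and>
     (\<forall>i \<in> {1..4}. \<forall>j \<in> {1, 2}. Bt S i j = bmat m p i j)"

lemma ball_1_4: "(\<forall>i \<in> {1..4::nat}. P i) \<longleftrightarrow> P 1 \<and> P 2 \<and> P 3 \<and> P 4"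
proof -
  have "{1..4::nat} = {1, 2, 3, 4}" by auto
  then show ?thesis by simp
qed

lemma seed_at_initial: "seed_at 0 1 (initial_seed \<iota>)"
proof -
  have "\<forall>i \<in> {1..4}. Xs (initial_seed \<iota>) i = emb \<iota> 0 (X0 (gvec 0 1 i))"
    unfolding ball_1_4 by (simp add: initial_seed_def emb_0 gvec_def unit4_def)
  moreover have "\<forall>i \<in> {1..4}. \<forall>j \<in> {1..4}. Lam (initial_seed \<iota>) i j = LambdaForm (gvec 0 1 i) (gvec 0 1 j)"
    unfolding ball_1_4 by (simp add: initial_seed_def gvec_def Lambda0_def LambdaForm_explicit)
  moreover have "\<forall>i \<in> {1..4}. \<forall>j \<in> {1, 2}. Bt (initial_seed \<iota>) i j = bmat 0 1 i j"
    unfolding ball_1_4 by (simp add: initial_seed_def bmat_def B0_def)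
  ultimately show ?thesis by (simp add: seed_at_def)
qed

lemma seed_monomial_seed_at:
  assumes "seed_at m p S"
  shows "seed_monomial \<iota> S a = emb \<iota> m (X0 (lattice_comb a (gvec m p)))"
  using assms by (intro emb.\<kappa>.seed_monomial_eq) (auto simp: seed_at_def qhalf_eq_mon emb_qhalf)

lemma mutate_Lam:
  assumes "seed_at m p S" and "i \<in> {1..4}" and "j \<in> {1..4}"
  shows "Lam (mutate \<iota> k S) i j =
    LambdaForm (lattice_comb (\<lambda>l. mutation_E k (Bt S) l i) (gvec m p)) (lattice_comb (\<lambda>l. mutation_E k (Bt S) l j) (gvec m p))"
proof -
  have "Lam (mutate \<iota> k S) i j =
     (\<Sum>p = 1..4. \<Sum>r = 1..4. mutation_E k (Bt S) p i * Lam S p r * mutation_E k (Bt S) r j)"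
    by (simp add: mutate_def Let_def)
  also have "\<dots> = (\<Sum>q = 1..4. \<Sum>r = 1..4. mutation_E k (Bt S) q i * LambdaForm (gvec m p q) (gvec m p r) * mutation_E k (Bt S) r j)"
    using assms(1) by (intro sum.cong refl) (simp add: seed_at_def)
  finally show ?thesis by (simp only: LambdaForm_lattice_comb)
qed

lemma emb_up_1: "emb \<iota> m (mon r 0 1 c d) = emb \<iota> (m + 1) (mon r 1 0 d (2 * d - c))"
  by (simp add: emb.next_mon)

lemma emb_up_0: "emb \<iota> m (mon r 0 0 c d) = emb \<iota> (m + 1) (mon r 0 0 d (2 * d - c))"
  by (simp add: emb.next_mon)

text \<open>
  The two exchange monomials of a mutation forward add up to a single monomial of the next cluster.
\<close>

lemma emb_up_2:
  "emb \<iota> m (mon r (- 1) 2 (2 * c - d) c) + emb \<iota> m (mon r (- 1) 0 (2 * c - d + 1) c) =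
   emb \<iota> (m + 1) (mon r 0 1 c d)"
proof -
  have "emb \<iota> (m + 1) (mon r 0 1 c d) = emb \<iota> (m + 1) (mon (r - d) 0 0 c d * X2)"
    by (simp add: mon_mult)
  also have "\<dots> = emb \<iota> m (mon (r - d) 0 0 (2 * c - d) c * x_next)"
    by (simp only: emb.\<kappa>.mult emb.next_coeff emb.next_X2)
  finally show ?thesis
    by (simp add: x_next_def distrib_left mon_mult emb.\<kappa>.add add.commute)
qed

lemma emb_down:
  "emb \<iota> (m + 1) (mon r 2 (- 1) d (2 * d - c)) + emb \<iota> (m + 1) (mon r 0 (- 1) d (2 * d - c - 1)) =
   emb \<iota> m (mon r 1 0 c d)"
proof -
  have "mon r 1 0 c d = mon (r - c) 0 0 c d * X1"
    by (simp add: mon_mult)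
  then have "emb \<iota> m (mon r 1 0 c d) = emb \<iota> (m + 1) (mon (r - c) 0 0 d (2 * d - c) * x_prev)"
    by (simp only: emb.\<kappa>.mult emb.prev_coeff[of m] emb.prev_X1)
  also have "mon (r - c) 0 0 d (2 * d - c) * x_prev = mon r 2 (- 1) d (2 * d - c) + mon r 0 (- 1) d (2 * d - c - 1)"
    by (simp add: x_prev_def distrib_left mon_mult)
  finally show ?thesis by (simp only: emb.\<kappa>.add)
qed

lemma mutate_Xs_other: "i \<noteq> k \<Longrightarrow> Xs (mutate \<iota> k S) i = Xs S i"
  by (simp add: mutate_def Let_def)

lemma mutate_Xs_same:
  assumes "seed_at m p S"
  shows "Xs (mutate \<iota> k S) k =
     emb \<iota> m (X0 (lattice_comb (\<lambda>j. max 0 (Bt S j k) - of_bool (j = k)) (gvec m p))) +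
     emb \<iota> m (X0 (lattice_comb (\<lambda>j. max 0 (- Bt S j k) - of_bool (j = k)) (gvec m p)))"
  by (simp add: mutate_def Let_def seed_monomial_seed_at[OF assms])

lemma mutate_Bt: "Bt (mutate \<iota> k S) i j = (if i = k \<or> j = k then - Bt S i j
    else Bt S i j + max 0 (Bt S i k) * Bt S k j + Bt S i k * max 0 (- Bt S k j))"
  by (simp add: mutate_def Let_def)

lemma seed_at_Bt:
  assumes "seed_at m p S" "i \<in> {1..4}" "j \<in> {1, 2}"
  shows "Bt S i j = bmat m p i j"
  using assms unfolding seed_at_def by blast

lemma gvec_up:
  assumes "p \<in> {1, 2}" "i \<in> {1..4}" "i \<noteq> p"
  shows "emb \<iota> m (X0 (gvec m p i)) = emb \<iota> (m + 1) (X0 (gvec (m + 1) (3 - p) i))"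
proof -
  consider "i = 3 - p" "m \<ge> - 1" | "i = 3 - p" "m < - 1" | "i = 3" | "i = 4"
    using assms by force
  then show ?thesis
  proof cases
    case 1
    then show ?thesis
      using assms emb_up_1[of m 0 0 0] by (auto simp: gvec_def X0_eq_mon)
  next
    case 2
    then show ?thesis
      using assms emb_up_1[of m 0 "- 2" "- 1"] by (auto simp: gvec_def X0_eq_mon)
  next
    case 3
    then show ?thesis
      using assms emb_up_0[of m 0 "1 - m" "- m"] by (auto simp: gvec_def X0_eq_mon)
  next
    case 4
    then show ?thesis
      using assms emb_up_0[of m 0 m "m + 1"] by (auto simp: gvec_def X0_eq_mon add.commute)
  qed
qed

text \<open>
  Mutation at the index of \<open>X\<^sub>1\<close> moves one step to the right. The four cases for \<open>m\<close> are those with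
  constant signs in the column of the exchange matrix at this index; in each of them the claim is a
  computation with exponent vectors.
\<close>

lemma seed_at_mutate_up:
  assumes "seed_at m p S"
  shows "seed_at (m + 1) (3 - p) (mutate \<iota> p S)"
proof -
  have p: "p \<in> {1, 2}" using assms by (simp add: seed_at_def)
  then have p12: "p = 1 \<or> p = 2" by simp
  have X: "Xs S i = emb \<iota> m (X0 (gvec m p i))" if "i \<in> {1..4}" for i
    using assms that by (simp add: seed_at_def)
  consider "m \<ge> 0" | "m = - 1" | "m = - 2" | "m \<le> - 3" by linarith
  note m = this
  note B = seed_at_Bt[OF assms]
  have "\<forall>i \<in> {1..4}. \<forall>j \<in> {1, 2}. Bt (mutate \<iota> p S) i j = bmat (m + 1) (3 - p) i j"
    unfolding ball_1_4 using p12
    by (elim disjE; cases rule: m; simp add: mutate_Bt B bmat_def max_absorb1 max_absorb2 del: One_nat_def)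
  moreover have "\<forall>i \<in> {1..4}. Xs (mutate \<iota> p S) i = emb \<iota> (m + 1) (X0 (gvec (m + 1) (3 - p) i))"
  proof
    fix i :: nat assume i: "i \<in> {1..4}"
    show "Xs (mutate \<iota> p S) i = emb \<iota> (m + 1) (X0 (gvec (m + 1) (3 - p) i))"
    proof (cases "i = p")
      case False
      then show ?thesis using X[OF i] gvec_up[OF p i] by (simp add: mutate_Xs_other)
    next
      case True
      have "lattice_comb (\<lambda>j. max 0 (Bt S j p) - of_bool (j = p)) (gvec m p) =
          (if m \<ge> - 2 then (- 1, 0, 1, 0) else (- 1, 0, - 2, - 2))"
        using p12 by (elim disjE; cases rule: m; simp add: lattice_comb_def B bmat_def gvec_def max_absorb1 max_absorb2
            del: One_nat_def; simp add: algebra_simps)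
      moreover have "lattice_comb (\<lambda>j. max 0 (- Bt S j p) - of_bool (j = p)) (gvec m p) =
          (if m \<ge> - 2 then (- 1, 2, 0, 0) else (- 1, 2, - 3, - 2))"
        using p12 by (elim disjE; cases rule: m; simp add: lattice_comb_def B bmat_def gvec_def max_absorb1 max_absorb2
            del: One_nat_def; simp add: algebra_simps)
      moreover have "gvec (m + 1) (3 - p) p = (if m \<ge> - 2 then (0, 1, 0, 0) else (0, 1, - 2, - 1))"
        using p12 by (auto simp: gvec_def)
      ultimately show ?thesis
        using emb_up_2[of m 0 0 0] emb_up_2[of m 0 "- 2" "- 1"]
        by (simp add: True mutate_Xs_same[OF assms] X0_eq_mon add.commute)
    qed
  qed
  moreover have "\<forall>i \<in> {1..4}. \<forall>j \<in> {1..4}. Lam (mutate \<iota> p S) i j =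
      LambdaForm (gvec (m + 1) (3 - p) i) (gvec (m + 1) (3 - p) j)"
    unfolding ball_1_4 using p12
    by (elim disjE; cases rule: m; simp add: mutate_Lam[OF assms] mutation_E_def lattice_comb_def B
        bmat_def gvec_def LambdaForm_explicit max_absorb1 max_absorb2 del: One_nat_def;
        simp add: algebra_simps)
  ultimately show ?thesis using p12 unfolding seed_at_def by auto
qed

lemma gvec_down:
  assumes "p \<in> {1, 2}" "i \<in> {1..4}" "i \<noteq> 3 - p"
  shows "emb \<iota> m (X0 (gvec m p i)) = emb \<iota> (m - 1) (X0 (gvec (m - 1) (3 - p) i))"
proof -
  have "3 - p \<in> {1, 2}" "3 - (3 - p) = p" using assms(1) by auto
  with gvec_up[of "3 - p" i "m - 1"] assms show ?thesis by simp
qed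

lemma seed_at_mutate_down:
  assumes "seed_at m p S"
  shows "seed_at (m - 1) (3 - p) (mutate \<iota> (3 - p) S)"
proof -
  have p: "p \<in> {1, 2}" using assms by (simp add: seed_at_def)
  then have p12: "p = 1 \<or> p = 2" by simp
  have X: "Xs S i = emb \<iota> m (X0 (gvec m p i))" if "i \<in> {1..4}" for i
    using assms that by (simp add: seed_at_def)
  consider "m \<ge> 1" | "m = 0" | "m = - 1" | "m \<le> - 2" by linarith
  note m = this
  note B = seed_at_Bt[OF assms]
  have "\<forall>i \<in> {1..4}. \<forall>j \<in> {1, 2}. Bt (mutate \<iota> (3 - p) S) i j = bmat (m - 1) (3 - p) i j"
    unfolding ball_1_4 using p12
    by (elim disjE; cases rule: m; simp add: mutate_Bt B bmat_def max_absorb1 max_absorb2 del: One_nat_def)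
  moreover have "\<forall>i \<in> {1..4}. Xs (mutate \<iota> (3 - p) S) i = emb \<iota> (m - 1) (X0 (gvec (m - 1) (3 - p) i))"
  proof
    fix i :: nat assume i: "i \<in> {1..4}"
    show "Xs (mutate \<iota> (3 - p) S) i = emb \<iota> (m - 1) (X0 (gvec (m - 1) (3 - p) i))"
    proof (cases "i = 3 - p")
      case False
      then show ?thesis using X[OF i] gvec_down[OF p i] by (simp add: mutate_Xs_other)
    next
      case True
      have "lattice_comb (\<lambda>j. max 0 (Bt S j (3 - p)) - of_bool (j = 3 - p)) (gvec m p) =
          (if m \<ge> 1 then (2, - 1, 0, 0) else (2, - 1, 0, 1))"
        using p12 by (elim disjE; cases rule: m; simp add: lattice_comb_def B bmat_def gvec_def max_absorb1 max_absorb2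
            del: One_nat_def; simp add: algebra_simps)
      moreover have "lattice_comb (\<lambda>j. max 0 (- Bt S j (3 - p)) - of_bool (j = 3 - p)) (gvec m p) =
          (if m \<ge> 1 then (0, - 1, 0, - 1) else (0, - 1, 0, 0))"
        using p12 by (elim disjE; cases rule: m; simp add: lattice_comb_def B bmat_def gvec_def max_absorb1 max_absorb2
            del: One_nat_def; simp add: algebra_simps)
      moreover have "gvec (m - 1) (3 - p) (3 - p) = (if m \<ge> 1 then (1, 0, 0, 0) else (1, 0, - 1, 0))"
        by (auto simp: gvec_def)
      ultimately show ?thesis
        using emb_down[of "m - 1" 0 0 0] emb_down[of "m - 1" 0 0 "- 1"]
        by (simp add: True mutate_Xs_same[OF assms] X0_eq_mon)
    qed
  qed
  moreover have "\<forall>i \<in> {1..4}. \<forall>j \<in> {1..4}. Lam (mutate \<iota> (3 - p) S) i j =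
      LambdaForm (gvec (m - 1) (3 - p) i) (gvec (m - 1) (3 - p) j)"
    unfolding ball_1_4 using p12
    by (elim disjE; cases rule: m; simp add: mutate_Lam[OF assms] mutation_E_def lattice_comb_def B
        bmat_def gvec_def LambdaForm_explicit max_absorb1 max_absorb2 del: One_nat_def;
        simp add: algebra_simps)
  ultimately show ?thesis using p12 unfolding seed_at_def by auto
qed

text \<open>
  The exchange graph is a line: the two possible mutations of a seed are the steps to its two
  neighbours.
\<close>

lemma seeds_imp_seed_at:
  assumes "S \<in> seeds \<iota>"
  shows "\<exists>m p. seed_at m p S"
  using assms
proof (induction S rule: seeds.induct)
  case initial
  show ?case using seed_at_initial by blast
next
  case (mutation S k)
  then obtain m p where S: "seed_at m p S" by blast
  then have "k = p \<or> k = 3 - p" using mutation.hyps by (auto simp: seed_at_def)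
  then show ?case using seed_at_mutate_up[OF S] seed_at_mutate_down[OF S] by blast
qed

lemma ex_seed_at: "\<exists>S \<in> seeds \<iota>. \<exists>p. seed_at m p S"
proof (induction m rule: int_induct[of _ 0])
  case base
  show ?case using seeds.initial seed_at_initial by blast
next
  case (step1 m)
  then obtain S p where S: "S \<in> seeds \<iota>" "seed_at m p S" by blast
  then have "mutate \<iota> p S \<in> seeds \<iota>" by (intro seeds.mutation) (auto simp: seed_at_def)
  with seed_at_mutate_up[OF S(2)] show ?case by blast
next
  case (step2 m)
  then obtain S p where S: "S \<in> seeds \<iota>" "seed_at m p S" by blast
  then have "mutate \<iota> (3 - p) S \<in> seeds \<iota>" by (intro seeds.mutation) (auto simp: seed_at_def)
  with seed_at_mutate_down[OF S(2)] show ?case by blast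
qed

text \<open>
  The Laurent monomials of the \<open>m\<close>-th seed, with the coefficients that distinguish its cluster
  variables from \<open>var\<close>.
\<close>

definition seed_mon :: "int \<Rightarrow> int \<Rightarrow> int \<Rightarrow> 'f" where
  "seed_mon m a b =
     emb \<iota> m (mon 0 a b (- (of_bool (m < 0) * a) - 2 * (of_bool (m < - 1) * b)) (- (of_bool (m < - 1) * b)))"

lemma seed_monomial_cluster_exp:
  assumes "seed_at m p S"
  shows "seed_monomial \<iota> S (cluster_exp a1 a2) = (if p = 1 then seed_mon m a1 a2 else seed_mon m a2 a1)"
proof -
  have "p = 1 \<or> p = 2" using assms by (simp add: seed_at_def)
  then show ?thesis
    by (auto simp: seed_monomial_seed_at[OF assms] lattice_comb_def cluster_exp_def gvec_def seed_mon_def X0_eq_mon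
      algebra_simps)
qed

lemma cluster_monomials_eq: "cluster_monomials \<iota> = {seed_mon m (int i) (int j) | m i j. True}"
proof (intro equalityI subsetI)
  fix z assume "z \<in> cluster_monomials \<iota>"
  then obtain S a1 a2 where S: "S \<in> seeds \<iota>" and z: "z = seed_monomial \<iota> S (cluster_exp a1 a2)"
    and a: "0 \<le> a1" "0 \<le> a2"
    by (auto simp: cluster_monomials_def)
  from seeds_imp_seed_at[OF S] obtain m p where mp: "seed_at m p S" by blast
  have "z = seed_mon m (int (nat a1)) (int (nat a2)) \<or> z = seed_mon m (int (nat a2)) (int (nat a1))"
    using seed_monomial_cluster_exp[OF mp] a by (simp add: z)
  then show "z \<in> {seed_mon m (int i) (int j) | m i j. True}" by blast
next
  fix z assume "z \<in> {seed_mon m (int i) (int j) | m i j. True}"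
  then obtain m i j where z: "z = seed_mon m (int i) (int j)" by blast
  from ex_seed_at obtain S p where S: "S \<in> seeds \<iota>" "seed_at m p S" by blast
  have "z = seed_monomial \<iota> S (cluster_exp (int (if p = 1 then i else j)) (int (if p = 1 then j else i)))"
    by (simp add: seed_monomial_cluster_exp[OF S(2)] z)
  with S(1) show "z \<in> cluster_monomials \<iota>"
    unfolding cluster_monomials_def mem_Collect_eq using of_nat_0_le_iff by blast
qed

lemma cluster_laurent_monomials_eq:
  assumes "seed_at m p S"
  shows "cluster_laurent_monomials \<iota> S = {seed_mon m a b | a b. True}"
  unfolding cluster_laurent_monomials_def seed_monomial_cluster_exp[OF assms] by auto

lemma seed_mon_next: "seed_mon (m + 1) a 0 = seed_mon m 0 a"
  by (simp add: seed_mon_def emb.next_mon)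

lemma Xs_seed_at:
  assumes "seed_at m p S"
  shows "{Xs S 1, Xs S 2} = {seed_mon m 1 0, seed_mon m 0 1}"
proof -
  have "p = 1 \<or> p = 2" using assms by (simp add: seed_at_def)
  moreover have "Xs S 1 = emb \<iota> m (X0 (gvec m p 1))" "Xs S 2 = emb \<iota> m (X0 (gvec m p 2))"
    using assms unfolding seed_at_def by simp_all
  ultimately show ?thesis
    by (auto simp: gvec_def seed_mon_def X0_eq_mon)
qed

abbreviation cmon :: "int \<Rightarrow> nat \<Rightarrow> nat \<Rightarrow> 'f" where
  "cmon m i j \<equiv> var m ^ i * var (m + 1) ^ j"

lemma seed_mon_emb_coeff:
  obtains s c d where "s = - (c * int i + d * int j)"
    "seed_mon k (int i) (int j) = emb \<iota> k (mon s 0 0 c d) * cmon k i j"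
proof -
  define c where "c = - (of_bool (k < 0) * int i) - 2 * (of_bool (k < - 1) * int j)"
  define d where "d = - (of_bool (k < - 1) * int j)"
  have "mon 0 (int i) (int j) c d = mon (- (c * int i + d * int j)) 0 0 c d * mon 0 (int i) (int j) 0 0"
    by (simp add: mon_mult)
  then have "seed_mon k (int i) (int j) =
      emb \<iota> k (mon (- (c * int i + d * int j)) 0 0 c d) * cmon k i j"
    by (simp only: seed_mon_def c_def[symmetric] d_def[symmetric] emb.\<kappa>.mult emb_mon_nat)
  then show ?thesis using that by blast
qed

lemma cluster_variables_eq: "cluster_variables \<iota> = {seed_mon m 1 0 | m. True}"
proof -
  have "cluster_variables \<iota> = (\<Union>m. {seed_mon m 1 0, seed_mon m 0 1})"
  proof (intro equalityI subsetI)
    fix z assume "z \<in> cluster_variables \<iota>"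
    then obtain S where S: "S \<in> seeds \<iota>" "z \<in> {Xs S 1, Xs S 2}" by (auto simp: cluster_variables_def)
    from seeds_imp_seed_at[OF S(1)] obtain m p where "seed_at m p S" by blast
    with S(2) Xs_seed_at show "z \<in> (\<Union>m. {seed_mon m 1 0, seed_mon m 0 1})" by blast
  next
    fix z assume "z \<in> (\<Union>m. {seed_mon m 1 0, seed_mon m 0 1})"
    then obtain m where m: "z \<in> {seed_mon m 1 0, seed_mon m 0 1}" by blast
    from ex_seed_at obtain S p where "S \<in> seeds \<iota>" "seed_at m p S" by blast
    with m Xs_seed_at show "z \<in> cluster_variables \<iota>" unfolding cluster_variables_def by blast
  qed
  also have "\<dots> = (\<Union>m. {seed_mon m 1 0, seed_mon (m + 1) 1 0})" by (simp add: seed_mon_next)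
  also have "\<dots> = {seed_mon m 1 0 | m. True}" by blast
  finally show ?thesis .
qed

end

section \<open>Left linear combinations\<close>

lemma left_combinations_zero: "0 \<in> left_combinations R B"
  unfolding left_combinations_def by (rule CollectI, rule exI[of _ "{}"]) auto

lemma left_combinations_base:
  assumes "b \<in> B" and "r \<in> R"
  shows "r * b \<in> left_combinations R B"
  unfolding left_combinations_def using assms
  by (intro CollectI exI[of _ "{b}"] exI[of _ "\<lambda>_. r"]) auto

lemma left_combinations_add:
  assumes R: "0 \<in> R" "\<And>r s. r \<in> R \<Longrightarrow> s \<in> R \<Longrightarrow> r + s \<in> R"
    and "y \<in> left_combinations R B" and "z \<in> left_combinations R B"
  shows "y + z \<in> left_combinations R B"
proof -
  from assms obtain B1 c1 B2 c2 where y: "y = (\<Sum>b\<in>B1. c1 b * b)" and z: "z = (\<Sum>b\<in>B2. c2 b * b)"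
    and B: "finite B1" "B1 \<subseteq> B" "finite B2" "B2 \<subseteq> B"
    and c: "\<forall>b\<in>B1. c1 b \<in> R" "\<forall>b\<in>B2. c2 b \<in> R"
    unfolding left_combinations_def by blast
  define c where "c = (\<lambda>b. (if b \<in> B1 then c1 b else 0) + (if b \<in> B2 then c2 b else 0))"
  have "y = (\<Sum>b\<in>B1 \<union> B2. (if b \<in> B1 then c1 b else 0) * b)"
    unfolding y using B by (intro sum.mono_neutral_cong_left) auto
  moreover have "z = (\<Sum>b\<in>B1 \<union> B2. (if b \<in> B2 then c2 b else 0) * b)"
    unfolding z using B by (intro sum.mono_neutral_cong_left) auto
  ultimately have "y + z = (\<Sum>b\<in>B1 \<union> B2. c b * b)"
    by (simp add: c_def distrib_right sum.distrib)
  moreover have "\<forall>b\<in>B1 \<union> B2. c b \<in> R" using R c by (auto simp: c_def)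
  ultimately show ?thesis unfolding left_combinations_def using B by blast
qed

lemma left_combinations_induct [consumes 1, case_names zero base add]:
  assumes "z \<in> left_combinations R B" and "P 0"
    and "\<And>r b. r \<in> R \<Longrightarrow> b \<in> B \<Longrightarrow> P (r * b)"
    and "\<And>y z. P y \<Longrightarrow> P z \<Longrightarrow> P (y + z)"
  shows "P z"
proof -
  from assms(1) obtain B' c where z: "z = (\<Sum>b\<in>B'. c b * b)"
    and B: "finite B'" "B' \<subseteq> B" "\<forall>b\<in>B'. c b \<in> R"
    unfolding left_combinations_def by blast
  from B have "P (\<Sum>b\<in>B'. c b * b)"
    by (induction B' rule: finite_induct) (simp_all add: assms(2-4))
  then show ?thesis by (simp add: z)
qed

section \<open>The cluster algebra is spanned by the basis\<close>

context cluster_chain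
begin

abbreviation coeffs :: "'f set" where "coeffs \<equiv> \<iota> ` ZP"
abbreviation coeffs_pos :: "'f set" where "coeffs_pos \<equiv> \<iota> ` ZP_nonneg"
abbreviation basis_span :: "'f set" where "basis_span \<equiv> left_combinations coeffs (atomic_basis_set \<iota>)"

lemma coeffs_emb: "s \<in> ZP \<Longrightarrow> emb \<iota> m s \<in> coeffs"
  using emb_ZP by blast

lemma coeffs_add: "r \<in> coeffs \<Longrightarrow> s \<in> coeffs \<Longrightarrow> r + s \<in> coeffs"
  by (auto simp: add[symmetric] ZP_add)

lemma coeffs_mult: "r \<in> coeffs \<Longrightarrow> s \<in> coeffs \<Longrightarrow> r * s \<in> coeffs"
  by (auto simp: mult[symmetric] ZP_mult)

lemma coeffs_zero: "0 \<in> coeffs"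
  by (rule image_eqI[of _ _ 0]) (simp_all add: zero ZP_zero)

lemma coeffs_one: "1 \<in> coeffs"
  by (rule image_eqI[of _ _ 1]) (simp_all add: one ZP_one)

lemma coeffs_minus_one: "- 1 \<in> coeffs"
  by (rule image_eqI[of _ _ "- 1"]) (simp_all add: uminus one ZP_uminus ZP_one)

lemma coeffs_Y: "\<iota> Y \<in> coeffs"
  using ZP_mon by blast

lemma span_add: "y \<in> basis_span \<Longrightarrow> z \<in> basis_span \<Longrightarrow> y + z \<in> basis_span"
  by (rule left_combinations_add) (auto simp: coeffs_zero intro: coeffs_add)

lemma span_scale: "z \<in> basis_span \<Longrightarrow> r \<in> coeffs \<Longrightarrow> r * z \<in> basis_span"
proof (induction z rule: left_combinations_induct)
  case zero
  show ?case by (simp add: left_combinations_zero)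
next
  case (base s b)
  then have "(r * s) * b \<in> basis_span" by (intro left_combinations_base coeffs_mult)
  then show ?case by (simp add: mult.assoc)
next
  case (add y z)
  then show ?case by (simp add: distrib_left span_add)
qed

lemma span_base: "b \<in> atomic_basis_set \<iota> \<Longrightarrow> b \<in> basis_span"
  using left_combinations_base[OF _ coeffs_one] by fastforce

text \<open>
  Cluster monomials may be replaced by plain products of powers of \<open>var\<close> in all questions about
  spans.
\<close>

lemma seed_mon_unit:
  "\<exists>u \<in> coeffs. \<exists>v \<in> coeffs. v * u = 1 \<and> seed_mon m (int i) (int j) = u * cmon m i j"
proof -
  obtain s c d where "seed_mon m (int i) (int j) = emb \<iota> m (mon s 0 0 c d) * cmon m i j"
    by (rule seed_mon_emb_coeff)
  moreover have "emb \<iota> m (mon (- s) 0 0 (- c) (- d)) * emb \<iota> m (mon s 0 0 c d) = 1"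
    using mon_inverse(2)[of s 0 0 c d] by (simp add: emb.\<kappa>.mult[symmetric] emb.\<kappa>.one)
  ultimately show ?thesis
    by (intro bexI[of _ "emb \<iota> m (mon s 0 0 c d)"] bexI[of _ "emb \<iota> m (mon (- s) 0 0 (- c) (- d))"]
        conjI coeffs_emb ZP_mon)
qed

lemma seed_mon_in_basis: "seed_mon m (int i) (int j) \<in> atomic_basis_set \<iota>"
  unfolding atomic_basis_set_def cluster_monomials_eq by blast

lemma cmon_in_span: "cmon m i j \<in> basis_span"
proof -
  from seed_mon_unit[of m i j] obtain u v where uv: "u \<in> coeffs" "v \<in> coeffs" "v * u = 1"
    "seed_mon m (int i) (int j) = u * cmon m i j" by (elim bexE conjE)
  have "cmon m i j = (v * u) * cmon m i j" by (simp only: uv(3) mult_1_left)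
  then have "cmon m i j = v * seed_mon m (int i) (int j)"
    by (simp only: uv(4) mult.assoc)
  then show ?thesis using span_scale[OF span_base[OF seed_mon_in_basis] uv(2)] by simp
qed

lemma F_in_span: "\<iota> (F n) \<in> basis_span"
proof (cases "n = 0")
  case True
  then show ?thesis using cmon_in_span[of 0 0 0] by (simp add: one)
next
  case False
  then have "\<iota> (F n) \<in> atomic_basis_set \<iota>"
    by (auto simp: atomic_basis_set_def F_elements_def)
  then show ?thesis by (rule span_base)
qed

lemma delta_coeffs:
  assumes "r \<in> coeffs"
  shows "\<exists>r' \<in> coeffs. \<delta> * r = r' * \<delta>"
proof -
  from assms obtain s where s: "s \<in> ZP" "r = \<iota> s" by blast
  from delta_ZP[OF s(1)] obtain s' where "s' \<in> ZP" "X_delta * s = s' * X_delta" by blast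
  then show ?thesis by (intro bexI[of _ "\<iota> s'"]) (simp_all add: s(2) mult[symmetric])
qed

lemma var_exchange': "\<exists>c \<in> coeffs. var m * var (m + 2) = var (m + 1) * var (m + 1) + c"
proof -
  \<comment> \<open>As in \<open>var_exchange\<close>; the two orders of the product differ in the power of \<open>q\<close>.\<close>
  have "emb \<iota> m (X1 * x_next) = emb \<iota> m (X2 * X2 + mon (- 1) 0 0 1 0)" by (simp only: exchange_next)
  then have "var m * var (m + 2) = var (m + 1) * var (m + 1) + emb \<iota> m (mon (- 1) 0 0 1 0)"
    by (simp only: emb.\<kappa>.mult emb.\<kappa>.add emb_X2 emb_x_next var_def[symmetric])
  then show ?thesis by (intro bexI[of _ "emb \<iota> m (mon (- 1) 0 0 1 0)"] coeffs_emb ZP_mon)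
qed

lemma pow_commute: "var (m + 1) ^ j * var m ^ i = var m ^ i * var (m + 1) ^ j"
proof -
  have "var m ^ i * var (m + 1) = var (m + 1) * var m ^ i"
    by (rule power_commuting_commutes) (rule var_commute)
  then show ?thesis by (intro power_commuting_commutes) simp
qed

lemma cmon_Suc_0: "cmon (m + 1) i 0 = cmon m 0 i"
  by simp

lemma next_times_pow: "var (m + 2) * var (m + 1) ^ j = cmon (m + 1) j 1"
  using pow_commute[of "m + 1" 1 j] by (simp add: add.assoc)

lemma delta_cmon_0_Suc: "\<delta> * cmon m 0 (Suc j) = cmon (m + 1) j 1 + \<iota> Y * cmon m 1 j"
proof -
  have "\<delta> * cmon m 0 (Suc j) = (\<delta> * var (m + 1)) * var (m + 1) ^ j"
    by (simp add: mult.assoc)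
  also have "\<dots> = var (m + 2) * var (m + 1) ^ j + \<iota> Y * (var m * var (m + 1) ^ j)"
    by (simp add: delta_var distrib_right mult.assoc)
  finally show ?thesis by (simp add: next_times_pow)
qed

lemma delta_cmon_Suc_Suc:
  "\<exists>c \<in> coeffs. \<delta> * cmon m (Suc i) (Suc j) =
     cmon m i (j + 2) + c * cmon m i j + \<iota> Y * cmon m (i + 2) j"
proof -
  from var_exchange[of m] obtain c where c: "c \<in> coeffs" "var (m + 2) * var m = var (m + 1) * var (m + 1) + c"
    by (elim bexE)
  have "\<delta> * cmon m (Suc i) (Suc j) = \<delta> * (var (m + 1) ^ Suc j * var m ^ Suc i)"
    by (simp only: pow_commute)
  also have "\<dots> = (\<delta> * var (m + 1)) * (var (m + 1) ^ j * var m ^ Suc i)"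
    by (simp add: mult.assoc)
  also have "\<dots> = (\<delta> * var (m + 1)) * cmon m (Suc i) j"
    by (simp only: pow_commute)
  also have "\<dots> = (var (m + 2) * var m) * cmon m i j + \<iota> Y * (var m * cmon m (Suc i) j)"
    by (simp add: delta_var distrib_right mult.assoc)
  also have "(var (m + 2) * var m) * cmon m i j = var (m + 1) ^ 2 * cmon m i j + c * cmon m i j"
    by (simp add: c(2) distrib_right power2_eq_square)
  also have "var (m + 1) ^ 2 * cmon m i j = cmon m i (j + 2)"
  proof -
    have "var (m + 1) ^ 2 * cmon m i j = (var (m + 1) ^ 2 * var m ^ i) * var (m + 1) ^ j"
      by (simp only: mult.assoc)
    also have "\<dots> = var m ^ i * (var (m + 1) ^ 2 * var (m + 1) ^ j)"
      by (simp only: pow_commute mult.assoc)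
    finally show ?thesis by (simp only: power_add[symmetric] add.commute)
  qed
  also have "var m * cmon m (Suc i) j = cmon m (i + 2) j"
    by (simp add: mult.assoc)
  finally show ?thesis using c(1) by (intro bexI[of _ c])
qed

text \<open>
  Apart from \<open>X\<^sub>\<delta>\<close> itself, the product is a combination of at most three cluster monomials of the
  cluster and its neighbours, by the recursion and the exchange relation.
\<close>

lemma delta_cmon: "\<delta> * cmon m i j \<in> basis_span"
proof (cases j)
  case 0
  show ?thesis
  proof (cases i)
    case 0
    with \<open>j = 0\<close> show ?thesis using F_in_span[of 1] by simp
  next
    case (Suc i')
    have "cmon m i j = cmon (m - 1) 0 (Suc i')" using \<open>j = 0\<close> Suc by simp
    then show ?thesis
      using span_add[OF cmon_in_span span_scale[OF cmon_in_span coeffs_Y]] by (simp only: delta_cmon_0_Suc)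
  qed
next
  case (Suc j')
  show ?thesis
  proof (cases i)
    case 0
    then show ?thesis
      using span_add[OF cmon_in_span span_scale[OF cmon_in_span coeffs_Y]] Suc by (simp only: delta_cmon_0_Suc)
  next
    case (Suc i')
    from delta_cmon_Suc_Suc[of m i' j'] obtain c where c: "c \<in> coeffs" "\<delta> * cmon m (Suc i') (Suc j') =
        cmon m i' (j' + 2) + c * cmon m i' j' + \<iota> Y * cmon m (i' + 2) j'" by (elim bexE)
    show ?thesis
      unfolding \<open>j = Suc j'\<close> Suc c(2) by (intro span_add span_scale cmon_in_span coeffs_Y c(1))
  qed
qed

lemma two_Y: "\<delta> * \<delta> = \<iota> (F 2) + (\<iota> Y + \<iota> Y)"
proof -
  have "\<iota> (X_delta * X_delta) = \<iota> (F 2 + (Y + Y))" by (simp add: F_2)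
  then show ?thesis by (simp only: add mult)
qed

lemma delta_F_step: "\<delta> * \<iota> (F (n + 2)) = \<iota> (F (n + 3)) + \<iota> Y * \<iota> (F (n + 1))"
proof -
  have "X_delta * F (n + 2) = F (n + 3) + Y * F (n + 1)" by (simp only: F_step F_commute) simp
  then show ?thesis by (simp only: add[symmetric] mult[symmetric])
qed

lemma delta_F: "\<delta> * \<iota> (F n) \<in> basis_span"
proof -
  consider "n = 0" | "n = 1" | k where "n = k + 2"
    by (metis One_nat_def add_2_eq_Suc' not0_implies_Suc)
  then show ?thesis
  proof cases
    case 1
    then show ?thesis using F_in_span[of 1] by (simp add: one)
  next
    case 2
    have "\<iota> Y * \<iota> (F 0) \<in> basis_span" by (intro span_scale F_in_span coeffs_Y)
    then have "\<iota> Y \<in> basis_span" by (simp add: one)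
    then have "\<delta> * \<delta> \<in> basis_span" unfolding two_Y by (intro span_add F_in_span)
    with 2 show ?thesis by simp
  next
    case (3 k)
    then show ?thesis by (simp only: delta_F_step) (intro span_add span_scale F_in_span coeffs_Y)
  qed
qed

lemma delta_span: "z \<in> basis_span \<Longrightarrow> \<delta> * z \<in> basis_span"
proof (induction z rule: left_combinations_induct)
  case zero
  show ?case by (simp add: left_combinations_zero)
next
  case (base r b)
  from delta_coeffs[OF base(1)] obtain r' where r': "r' \<in> coeffs" "\<delta> * r = r' * \<delta>" by blast
  have "\<delta> * b \<in> basis_span"
  proof (cases "b \<in> cluster_monomials \<iota>")
    case True
    then obtain m i j where "b = seed_mon m (int i) (int j)" by (auto simp: cluster_monomials_eq)
    with seed_mon_unit[of m i j] obtain u where u: "u \<in> coeffs" "b = u * cmon m i j" by auto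
    from delta_coeffs[OF u(1)] obtain u' where "u' \<in> coeffs" "\<delta> * u = u' * \<delta>" by blast
    then have "\<delta> * b = u' * (\<delta> * cmon m i j)" "u' \<in> coeffs"
      by (simp_all add: u(2) mult.assoc[symmetric])
    then show ?thesis using span_scale[OF delta_cmon] by simp
  next
    case False
    with base(2) show ?thesis using delta_F by (auto simp: atomic_basis_set_def F_elements_def)
  qed
  from span_scale[OF this r'(1)] show ?case
    by (simp add: mult.assoc[symmetric] r'(2))
next
  case (add y z)
  then show ?case by (simp add: distrib_left span_add)
qed

text \<open>
  The span is generated by the monomials of any single cluster as a left module over coefficients and
  \<open>X\<^sub>\<delta>\<close>. Indeed, the recursion expresses a monomial of the next cluster through \<open>X\<^sub>\<delta>\<close> times a
  monomial with a smaller exponent of the new variable, and likewise to the left; the \<open>F n\<close> are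
  polynomials in \<open>X\<^sub>\<delta>\<close> and \<open>Y\<close>. The freedom to choose the cluster is what makes the span
  closed under multiplication.
\<close>

lemma span_subset_module:
  assumes add: "\<And>y z. y \<in> U \<Longrightarrow> z \<in> U \<Longrightarrow> y + z \<in> U"
    and scale: "\<And>r z. r \<in> coeffs \<Longrightarrow> z \<in> U \<Longrightarrow> r * z \<in> U"
    and delta: "\<And>z. z \<in> U \<Longrightarrow> \<delta> * z \<in> U"
    and generators: "\<And>i j. cmon m i j \<in> U"
  shows "basis_span \<subseteq> U"
proof -
  have diff: "y - z \<in> U" if "y \<in> U" "z \<in> U" for y z
    using add[OF that(1) scale[OF coeffs_minus_one that(2)]] by simp
  have one_U: "1 \<in> U" using generators[of 0 0] by simp
  have F: "\<iota> (F n) \<in> U" for n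
  proof (induction n rule: F_induct)
    case 0
    show ?case using one_U by (simp add: one)
  next
    case 1
    show ?case using delta[OF one_U] by simp
  next
    case 2
    have "\<iota> Y * 1 + \<iota> Y * 1 \<in> U" by (intro add scale one_U coeffs_Y)
    then have "\<delta> * (\<delta> * 1) - (\<iota> Y + \<iota> Y) \<in> U" using delta[OF delta[OF one_U]] by (intro diff) simp_all
    then show ?case by (simp add: two_Y)
  next
    case (step n)
    have "\<iota> (F (n + 3)) = \<delta> * \<iota> (F (n + 2)) - \<iota> Y * \<iota> (F (n + 1))"
      by (simp only: delta_F_step add_diff_cancel_right')
    then show ?case using step by (simp add: diff delta scale coeffs_Y)
  qed
  have up: "cmon (k + 1) i j \<in> U" if gen: "\<And>i j. cmon k i j \<in> U" for k i j
  proof (induction j arbitrary: i rule: less_induct)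
    case (less j)
    consider "j = 0" | "j = 1" | l where "j = l + 2"
      by (metis One_nat_def add_2_eq_Suc' not0_implies_Suc)
    then show ?case
    proof cases
      case 1
      then show ?thesis using gen[of 0 i] by simp
    next
      case 2
      have "cmon (k + 1) i 1 = \<delta> * cmon k 0 (Suc i) - \<iota> Y * cmon k 1 i"
        by (simp only: delta_cmon_0_Suc) simp
      also have "\<dots> \<in> U" by (intro diff delta scale gen coeffs_Y)
      finally show ?thesis by (simp add: 2)
    next
      case (3 l)
      from var_exchange'[of k] obtain c where c: "c \<in> coeffs" "var k * var (k + 2) = var (k + 1) * var (k + 1) + c"
        by (elim bexE)
      have "\<delta> * cmon (k + 1) (Suc i) (Suc l) = (\<delta> * var (k + 1)) * cmon (k + 1) i (Suc l)"
        by (simp add: mult.assoc)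
      also have "\<dots> = var (k + 2) * cmon (k + 1) i (Suc l) + \<iota> Y * (var k * cmon (k + 1) i (Suc l))"
        by (simp add: delta_var distrib_right mult.assoc)
      also have swap: "cmon (k + 1) i n = var (k + 2) ^ n * var (k + 1) ^ i" for n
        using pow_commute[of "k + 1" n i] by (simp add: add.assoc)
      have "var (k + 2) * cmon (k + 1) i (Suc l) = cmon (k + 1) i (l + 2)"
        unfolding swap by (simp add: mult.assoc)
      also have "var k * cmon (k + 1) i (Suc l) = (var k * var (k + 2)) * cmon (k + 1) i l"
        unfolding swap by (simp add: mult.assoc)
      also have "\<dots> = cmon (k + 1) (i + 2) l + c * cmon (k + 1) i l"
        by (simp add: c(2) distrib_right mult.assoc)
      finally have "cmon (k + 1) i (l + 2) =
          \<delta> * cmon (k + 1) (Suc i) (Suc l) - \<iota> Y * (cmon (k + 1) (i + 2) l + c * cmon (k + 1) i l)"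
        by (simp only: add_diff_cancel_right')
      also have "\<dots> \<in> U"
        using 3 by (intro diff delta scale add coeffs_Y c less.IH) auto
      finally show ?thesis using 3 by simp
    qed
  qed
  have down: "cmon k i j \<in> U" if gen: "\<And>i j. cmon (k + 1) i j \<in> U" for k i j
  proof (induction i arbitrary: j rule: less_induct)
    case (less i)
    have Yc: "\<iota> (mon 0 0 0 (- 1) (- 1)) \<in> coeffs" using ZP_mon by blast
    consider "i = 0" | "i = 1" | l where "i = l + 2"
      by (metis One_nat_def add_2_eq_Suc' not0_implies_Suc)
    then show ?case
    proof cases
      case 1
      then show ?thesis using gen[of j 0] by simp
    next
      case 2
      have "cmon k 1 j = \<iota> (mon 0 0 0 (- 1) (- 1)) * (\<delta> * cmon (k + 1) (Suc j) 0 - cmon (k + 1) j 1)"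
        by (simp only: cmon_Suc_0 delta_cmon_0_Suc) (simp add: Y_inverse)
      also have "\<dots> \<in> U" by (intro diff delta scale gen Yc)
      finally show ?thesis by (simp only: 2)
    next
      case (3 l)
      from delta_cmon_Suc_Suc[of k l j] obtain c where c: "c \<in> coeffs" "\<delta> * cmon k (Suc l) (Suc j) =
        cmon k l (j + 2) + c * cmon k l j + \<iota> Y * cmon k (l + 2) j" by blast
      have "cmon k (l + 2) j = \<iota> (mon 0 0 0 (- 1) (- 1)) *
          (\<delta> * cmon k (Suc l) (Suc j) - (cmon k l (j + 2) + c * cmon k l j))"
        by (simp only: c(2) add_diff_cancel_left' Y_inverse)
      also have "\<dots> \<in> U"
        using 3 by (intro diff delta scale add Yc c(1) less.IH) auto
      finally show ?thesis using 3 by simp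
    qed
  qed
  have cmon: "cmon k i j \<in> U" for k i j
  proof (induction k arbitrary: i j rule: int_induct[of _ m])
    case base
    show ?case by (rule generators)
  next
    case (step1 k)
    then show ?case by (rule_tac up)
  next
    case (step2 k)
    then show ?case by (rule_tac down) simp
  qed
  show ?thesis
  proof
    fix z assume "z \<in> basis_span"
    then show "z \<in> U"
    proof (induction z rule: left_combinations_induct)
      case zero
      show ?case using diff[OF one_U one_U] by simp
    next
      case (base r b)
      have "b \<in> U"
      proof (cases "b \<in> cluster_monomials \<iota>")
        case True
        then obtain m i j where "b = seed_mon m (int i) (int j)" by (auto simp: cluster_monomials_eq)
        with seed_mon_unit[of m i j] obtain u where "u \<in> coeffs" "b = u * cmon m i j" by auto
        then show ?thesis using scale cmon by simp
      next
        case False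
        with base(2) show ?thesis using F by (auto simp: atomic_basis_set_def F_elements_def)
      qed
      with base(1) show ?case by (rule_tac scale)
    qed (rule add)
  qed
qed

lemma span_times_coeff:
  assumes "r \<in> coeffs" and "z \<in> basis_span"
  shows "z * r \<in> basis_span"
proof -
  have "basis_span \<subseteq> {z. \<forall>r\<in>coeffs. z * r \<in> basis_span}"
  proof (rule span_subset_module)
    fix i j
    show "cmon 0 i j \<in> {z. \<forall>r\<in>coeffs. z * r \<in> basis_span}"
    proof (intro CollectI ballI)
      fix r assume "r \<in> coeffs"
      then obtain s where s: "s \<in> ZP" "r = \<iota> s" by blast
      from mon_ZP[OF s(1), of 0 "int i" "int j" 0 0] obtain s'
        where s': "s' \<in> ZP" "mon 0 (int i) (int j) 0 0 * s = s' * mon 0 (int i) (int j) 0 0" by blast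
      have "cmon 0 i j = \<iota> (mon 0 (int i) (int j) 0 0)"
        using emb_mon_nat[of 0 i j] by (simp add: emb_0)
      then have "cmon 0 i j * r = \<iota> s' * cmon 0 i j"
        by (simp only: s(2) s'(2) mult[symmetric])
      then show "cmon 0 i j * r \<in> basis_span" using span_scale[OF cmon_in_span imageI[OF s'(1)]] by (simp only:)
    qed
  qed (auto simp: distrib_right mult.assoc intro: span_add span_scale delta_span)
  with assms show ?thesis by blast
qed

text \<open>
  In the cluster generated with \<open>var m\<close> itself, multiplication by \<open>var m\<close> only raises an exponent.
\<close>

lemma span_times_var:
  assumes "z \<in> basis_span"
  shows "z * var m \<in> basis_span"
proof -
  have "basis_span \<subseteq> {z. z * var m \<in> basis_span}"
  proof (rule span_subset_module)
    fix i j
    have "cmon (m - 1) i j * var m = cmon (m - 1) i (Suc j)"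
      by (simp add: mult.assoc power_commutes)
    then show "cmon (m - 1) i j \<in> {z. z * var m \<in> basis_span}" using cmon_in_span[of "m - 1" i "Suc j"] by simp
  qed (auto simp: distrib_right mult.assoc intro: span_add span_scale delta_span)
  with assms show ?thesis by blast
qed

lemma seed_mon_1_0: "\<exists>u \<in> coeffs. \<exists>v \<in> coeffs. v * u = 1 \<and> seed_mon m 1 0 = u * var m"
  using seed_mon_unit[of m 1 0] by simp

text \<open>
  The set of right multipliers of the span contains all generators and is closed under sums and
  products; apply its elements to \<open>1\<close>.
\<close>

lemma cluster_algebra_subset: "cluster_algebra \<iota> \<subseteq> basis_span"
proof
  fix x assume "x \<in> cluster_algebra \<iota>"
  then have "\<forall>z \<in> basis_span. z * x \<in> basis_span"
  proof (induction x rule: cluster_algebra.induct)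
    case (coeff c)
    then show ?case using span_times_coeff by blast
  next
    case (variable x)
    then obtain m where "x = seed_mon m 1 0" by (auto simp: cluster_variables_eq)
    with seed_mon_1_0[of m] obtain u where u: "u \<in> coeffs" "x = u * var m" by auto
    then show ?case using span_times_var[OF span_times_coeff[OF u(1)]] by (simp add: mult.assoc)
  next
    case (add x y)
    then show ?case by (simp add: distrib_left span_add)
  next
    case (mult x y)
    then show ?case by (simp add: mult.assoc[symmetric])
  qed
  moreover have "1 \<in> basis_span" using F_in_span[of 0] by (simp add: one)
  ultimately show "x \<in> basis_span" by fastforce
qed

lemma algebra_coeff: "r \<in> coeffs \<Longrightarrow> r \<in> cluster_algebra \<iota>"
  using cluster_algebra.coeff by blast

lemma algebra_var: "var m \<in> cluster_algebra \<iota>"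
proof -
  from seed_mon_1_0[of m] obtain u v where uv: "v \<in> coeffs" "v * u = 1" "seed_mon m 1 0 = u * var m"
    by (elim bexE conjE)
  have "var m = (v * u) * var m" by (simp only: uv(2) mult_1_left)
  then have "var m = v * seed_mon m 1 0" by (simp only: uv(3) mult.assoc)
  moreover have "seed_mon m 1 0 \<in> cluster_algebra \<iota>"
    by (rule cluster_algebra.variable) (auto simp: cluster_variables_eq)
  ultimately show ?thesis using cluster_algebra.mult[OF algebra_coeff[OF uv(1)]] by simp
qed

lemma algebra_power: "z \<in> cluster_algebra \<iota> \<Longrightarrow> z ^ n \<in> cluster_algebra \<iota>"
  by (induction n) (simp_all add: algebra_coeff coeffs_one cluster_algebra.mult)

lemma algebra_diff: "y \<in> cluster_algebra \<iota> \<Longrightarrow> z \<in> cluster_algebra \<iota> \<Longrightarrow> y - z \<in> cluster_algebra \<iota>"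
  using cluster_algebra.add[OF _ cluster_algebra.mult[OF algebra_coeff[OF coeffs_minus_one]], of y z] by simp

lemma algebra_delta: "\<delta> \<in> cluster_algebra \<iota>"
proof -
  have "\<iota> x_prev = var (- 1)" using emb.prev_X1[of "- 1"] by (simp add: emb_0 var_def)
  moreover have "\<iota> x_next = var 2" using emb_x_next[of 0] by (simp add: emb_0)
  moreover have "\<iota> X1 = var 0" "\<iota> X2 = var 1" using emb_X2[of 0] by (simp_all add: emb_0 var_def)
  ultimately have "\<delta> = \<iota> (mon 1 0 0 0 1) * (var (- 1) * var 2) - \<iota> (mon 1 0 0 0 1) * (var 0 * var 1)"
    using arg_cong[OF delta_from_variables, of \<iota>] by (simp only: diff mult)
  moreover have "\<iota> (mon 1 0 0 0 1) \<in> coeffs" using ZP_mon by blast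
  ultimately show ?thesis
    by (simp only:) (intro algebra_diff cluster_algebra.mult algebra_var algebra_coeff)
qed

lemma algebra_F: "\<iota> (F n) \<in> cluster_algebra \<iota>"
proof (induction n rule: F_induct)
  case 0
  show ?case using algebra_coeff[OF coeffs_one] by (simp add: one)
next
  case 1
  show ?case using algebra_delta by simp
next
  case 2
  have "\<iota> (F 2) = \<delta> * \<delta> - (\<iota> Y + \<iota> Y)" by (simp add: two_Y)
  then show ?case
    by (simp only:) (intro algebra_diff cluster_algebra.mult cluster_algebra.add algebra_delta algebra_coeff coeffs_Y)
next
  case (step n)
  have "\<iota> (F (n + 3)) = \<delta> * \<iota> (F (n + 2)) - \<iota> Y * \<iota> (F (n + 1))"
    by (simp only: delta_F_step add_diff_cancel_right')
  then show ?case using step by (simp add: algebra_diff cluster_algebra.mult algebra_delta algebra_coeff coeffs_Y)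
qed

lemma basis_subset: "atomic_basis_set \<iota> \<subseteq> cluster_algebra \<iota>"
proof
  fix b assume b: "b \<in> atomic_basis_set \<iota>"
  show "b \<in> cluster_algebra \<iota>"
  proof (cases "b \<in> cluster_monomials \<iota>")
    case True
    then obtain m i j where "b = seed_mon m (int i) (int j)" by (auto simp: cluster_monomials_eq)
    with seed_mon_unit[of m i j] obtain u where "u \<in> coeffs" "b = u * cmon m i j" by auto
    then show ?thesis by (simp add: cluster_algebra.mult algebra_coeff algebra_power algebra_var)
  next
    case False
    with b show ?thesis using algebra_F by (auto simp: atomic_basis_set_def F_elements_def)
  qed
qed

lemma span_eq_cluster_algebra: "basis_span = cluster_algebra \<iota>"
proof
  show "basis_span \<subseteq> cluster_algebra \<iota>"
  proof
    fix z assume "z \<in> basis_span"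
    then show "z \<in> cluster_algebra \<iota>"
    proof (induction z rule: left_combinations_induct)
      case zero
      show ?case by (rule algebra_coeff[OF coeffs_zero])
    next
      case (base r b)
      then show ?case using basis_subset by (blast intro: cluster_algebra.mult algebra_coeff)
    qed (rule cluster_algebra.add)
  qed
qed (rule cluster_algebra_subset)

section \<open>Positive Laurent expansions\<close>

lemma coeffs_pos_add: "r \<in> coeffs_pos \<Longrightarrow> s \<in> coeffs_pos \<Longrightarrow> r + s \<in> coeffs_pos"
  by (auto simp: add[symmetric] ZP_nonneg_add)

lemma coeffs_pos_zero: "0 \<in> coeffs_pos"
  by (rule image_eqI[of _ _ 0]) (simp_all add: zero ZP_nonneg_zero)

lemma coeffs_pos_emb: "s \<in> ZP_nonneg \<Longrightarrow> emb \<iota> m s \<in> coeffs_pos"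
  using emb_ZP_nonneg by blast

lemma coeffs_pos_subset: "coeffs_pos \<subseteq> coeffs"
  by (auto simp: ZP_nonneg_iff)

definition positive_at :: "int \<Rightarrow> 'f set" where
  "positive_at m = emb \<iota> m ` {t. nonneg t}"

lemma positive_at_add: "y \<in> positive_at m \<Longrightarrow> z \<in> positive_at m \<Longrightarrow> y + z \<in> positive_at m"
  by (auto simp: positive_at_def emb.\<kappa>.add[symmetric] nonneg_add)

lemma positive_at_mult: "y \<in> positive_at m \<Longrightarrow> z \<in> positive_at m \<Longrightarrow> y * z \<in> positive_at m"
  by (auto simp: positive_at_def emb.\<kappa>.mult[symmetric] nonneg_mult)

lemma positive_at_emb: "nonneg t \<Longrightarrow> emb \<iota> m t \<in> positive_at m"
  by (auto simp: positive_at_def)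

lemma positive_at_zero: "0 \<in> positive_at m"
  using positive_at_emb[OF nonneg_zero] by (simp add: emb.\<kappa>.zero)

lemma positive_at_one: "1 \<in> positive_at m"
  using positive_at_emb[OF nonneg_one] by (simp add: emb.\<kappa>.one)

lemma positive_at_power: "y \<in> positive_at m \<Longrightarrow> y ^ n \<in> positive_at m"
  by (induction n) (simp_all add: positive_at_one positive_at_mult)

lemma coeffs_pos_subset_positive_at: "coeffs_pos \<subseteq> positive_at m"
  unfolding emb_ZP_nonneg[of m, symmetric] by (auto simp: positive_at_def ZP_nonneg_iff)

lemma var_above: "m \<le> k \<Longrightarrow> var k = emb \<iota> m (fwd_var (nat (k - m)))"
  by (simp add: emb_fwd_var)

lemma var_below: "k \<le> m + 1 \<Longrightarrow> var k = emb \<iota> m (reflect (fwd_var (nat (m + 1 - k))))"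
  by (simp add: emb_reflect_fwd_var)

lemma var_positive: "var k \<in> positive_at m"
proof (cases "m \<le> k")
  case True
  then show ?thesis unfolding var_above[OF True] by (intro positive_at_emb nonneg_fwd_var)
next
  case False
  then have "k \<le> m + 1" by simp
  then show ?thesis unfolding var_below[OF \<open>k \<le> m + 1\<close>] by (intro positive_at_emb nonneg_reflect nonneg_fwd_var)
qed

lemma emb_F: "emb \<iota> m (F n) = \<iota> (F n)"
proof (induction n rule: F_induct)
  case 0
  show ?case by (simp add: one emb.\<kappa>.one)
next
  case 1
  show ?case by (simp add: emb_delta)
next
  case 2
  show ?case by (simp only: F_2 diff mult add emb.\<kappa>.diff emb.\<kappa>.mult emb.\<kappa>.add emb_delta emb_Y)
next
  case (step n)
  then show ?case
    by (simp only: F_step diff mult emb.\<kappa>.diff emb.\<kappa>.mult emb_delta emb_Y)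
qed

text \<open>
  Monomials in the coefficients are monomials in the coordinates of every cluster, with the same
  power of \<open>q\<close>.
\<close>

lemma emb_coeff: "\<exists>c' d'. \<forall>s. emb \<iota> m (mon s 0 0 c d) = emb \<iota> k (mon s 0 0 c' d')"
proof (induction k rule: int_induct[of _ m])
  case base
  show ?case by blast
next
  case (step1 k)
  then obtain c' d' where "\<forall>s. emb \<iota> m (mon s 0 0 c d) = emb \<iota> k (mon s 0 0 c' d')" by blast
  then have "emb \<iota> m (mon s 0 0 c d) = emb \<iota> (k + 1) (mon s 0 0 d' (2 * d' - c'))" for s
    by (simp only: emb_up_0[of k])
  then show ?case by blast
next
  case (step2 k)
  then obtain c' d' where *: "\<forall>s. emb \<iota> m (mon s 0 0 c d) = emb \<iota> k (mon s 0 0 c' d')" by blast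
  have "emb \<iota> k (mon s 0 0 c' d') = emb \<iota> (k - 1) (mon s 0 0 (2 * c' - d') c')" for s
    using emb.next_coeff[of "k - 1" s c' d'] by simp
  with * have "emb \<iota> m (mon s 0 0 c d) = emb \<iota> (k - 1) (mon s 0 0 (2 * c' - d') c')" for s
    by (simp only:)
  then show ?case by blast
qed

lemma seed_mon_emb_any:
  obtains s c d where "seed_mon k (int i) (int j) = emb \<iota> m (mon s 0 0 c d) * cmon k i j"
proof -
  obtain s c d where 1: "seed_mon k (int i) (int j) = emb \<iota> k (mon s 0 0 c d) * cmon k i j"
    by (rule seed_mon_emb_coeff)
  from emb_coeff[of k c d m] obtain c' d' where
    "\<forall>s. emb \<iota> k (mon s 0 0 c d) = emb \<iota> m (mon s 0 0 c' d')" by (elim exE)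
  then have "seed_mon k (int i) (int j) = emb \<iota> m (mon s 0 0 c' d') * cmon k i j"
    by (simp only: 1)
  then show ?thesis by (rule that)
qed

lemma seed_mon_positive: "seed_mon k (int i) (int j) \<in> positive_at m"
proof -
  obtain s c d where "seed_mon k (int i) (int j) = emb \<iota> m (mon s 0 0 c d) * cmon k i j"
    by (rule seed_mon_emb_any)
  then show ?thesis
    by (simp only:) (intro positive_at_mult positive_at_power var_positive positive_at_emb nonneg_mon)
qed

lemma basis_positive: "b \<in> atomic_basis_set \<iota> \<Longrightarrow> b \<in> positive_at m"
  using seed_mon_positive positive_at_emb[OF nonneg_F]
  by (auto simp: atomic_basis_set_def cluster_monomials_eq F_elements_def emb_F)

lemma laurent_expansion_positive:
  assumes "seed_at m p S"
  shows "left_combinations coeffs_pos (cluster_laurent_monomials \<iota> S) = positive_at m"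
proof (intro equalityI subsetI)
  fix z assume "z \<in> left_combinations coeffs_pos (cluster_laurent_monomials \<iota> S)"
  then show "z \<in> positive_at m"
  proof (induction z rule: left_combinations_induct)
    case zero
    show ?case by (rule positive_at_zero)
  next
    case (base r b)
    then obtain a a' where "b = seed_mon m a a'" by (auto simp: cluster_laurent_monomials_eq[OF assms])
    then have "b \<in> positive_at m" by (simp only: seed_mon_def positive_at_emb nonneg_mon)
    with base(1) coeffs_pos_subset_positive_at show ?case by (blast intro: positive_at_mult)
  qed (rule positive_at_add)
next
  fix z assume "z \<in> positive_at m"
  then obtain t where t: "nonneg t" and z: "z = emb \<iota> m t" by (auto simp: positive_at_def)
  from t have "emb \<iota> m t \<in> left_combinations coeffs_pos (cluster_laurent_monomials \<iota> S)"
  proof (induction t rule: nonneg_induct)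
    case zero
    show ?case by (simp add: emb.\<kappa>.zero left_combinations_zero)
  next
    case (add u v)
    then show ?case
      by (auto simp: emb.\<kappa>.add intro!: left_combinations_add coeffs_pos_zero coeffs_pos_add)
  next
    case (mon r a b c d)
    define c0 where "c0 = - (of_bool (m < 0) * a) - 2 * (of_bool (m < - 1) * b)"
    define d0 where "d0 = - (of_bool (m < - 1) * b)"
    \<comment> \<open>\<open>c0\<close>, \<open>d0\<close> are the coefficient exponents built into \<open>seed_mon m a b\<close>.\<close>
    obtain s where "mon s 0 0 (c - c0) (d - d0) * mon 0 a b c0 d0 = mon r a b c d"
    proof
      show "mon (r - (c - c0) * a - (d - d0) * b - 2 * ((d - d0) * c0 - (c - c0) * d0)) 0 0 (c - c0) (d - d0) *
          mon 0 a b c0 d0 = mon r a b c d"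
        by (simp add: mon_mult)
    qed
    then have "emb \<iota> m (mon r a b c d) = emb \<iota> m (mon s 0 0 (c - c0) (d - d0)) * seed_mon m a b"
      by (simp only: seed_mon_def c0_def[symmetric] d0_def[symmetric] emb.\<kappa>.mult[symmetric])
    also have "\<dots> \<in> left_combinations coeffs_pos (cluster_laurent_monomials \<iota> S)"
      by (intro left_combinations_base coeffs_pos_emb ZP_nonneg_mon)
        (auto simp: cluster_laurent_monomials_eq[OF assms])
    finally show ?case .
  qed
  then show "z \<in> left_combinations coeffs_pos (cluster_laurent_monomials \<iota> S)" by (simp only: z)
qed

lemma positive_elements_eq:
  "positive_elements \<iota> = {z \<in> cluster_algebra \<iota>. \<forall>m. z \<in> positive_at m}"
proof -
  have "(\<forall>S\<in>seeds \<iota>. z \<in> left_combinations coeffs_pos (cluster_laurent_monomials \<iota> S)) \<longleftrightarrow>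
      (\<forall>m. z \<in> positive_at m)" for z
  proof
    assume *: "\<forall>S\<in>seeds \<iota>. z \<in> left_combinations coeffs_pos (cluster_laurent_monomials \<iota> S)"
    show "\<forall>m. z \<in> positive_at m"
    proof
      fix m
      from ex_seed_at obtain S p where "S \<in> seeds \<iota>" "seed_at m p S" by blast
      with * laurent_expansion_positive show "z \<in> positive_at m" by blast
    qed
  next
    assume *: "\<forall>m. z \<in> positive_at m"
    show "\<forall>S\<in>seeds \<iota>. z \<in> left_combinations coeffs_pos (cluster_laurent_monomials \<iota> S)"
    proof
      fix S assume "S \<in> seeds \<iota>"
      from seeds_imp_seed_at[OF this] obtain m p where "seed_at m p S" by blast
      with * show "z \<in> left_combinations coeffs_pos (cluster_laurent_monomials \<iota> S)"
        by (simp only: laurent_expansion_positive)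
    qed
  qed
  then show ?thesis by (simp add: positive_elements_def)
qed

lemma combinations_positive:
  assumes "z \<in> left_combinations coeffs_pos (atomic_basis_set \<iota>)"
  shows "z \<in> positive_elements \<iota>"
proof -
  from assms have "z \<in> cluster_algebra \<iota> \<and> (\<forall>m. z \<in> positive_at m)"
  proof (induction z rule: left_combinations_induct)
    case zero
    show ?case by (simp add: positive_at_zero algebra_coeff[OF coeffs_zero])
  next
    case (base r b)
    then show ?case
      using basis_subset coeffs_pos_subset coeffs_pos_subset_positive_at
      by (blast intro: cluster_algebra.mult algebra_coeff positive_at_mult basis_positive)
  next
    case (add y z)
    then show ?case by (simp add: cluster_algebra.add positive_at_add)
  qed
  then show ?thesis by (simp add: positive_elements_eq)
qed

section \<open>Isolating a basis element\<close>

lemma supp_coeff_mult: "supp (mon s 0 0 c d * t) \<subseteq> supp t"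
  by (rule supp_multI[of _ "{(0, 0)}"]) (auto simp: supp_mon)

text \<open>
  Seen from cluster \<open>m\<close>, a cluster monomial further to the right has the support of a product
  of two consecutive forward variables; the mirror image holds to the left.
\<close>

lemma seed_mon_above:
  assumes "k = m + 1 + int n"
  obtains t where "seed_mon k (int i) (int j) = emb \<iota> m t"
    and "supp t \<subseteq> supp (fwd_var (Suc n) ^ i * fwd_var (Suc (Suc n)) ^ j)"
proof -
  obtain s c d where s: "seed_mon k (int i) (int j) = emb \<iota> m (mon s 0 0 c d) * cmon k i j"
    by (rule seed_mon_emb_any)
  have "emb \<iota> m (fwd_var (Suc n)) = var k" "emb \<iota> m (fwd_var (Suc (Suc n))) = var (k + 1)"
    using assms emb_fwd_var[of m "Suc n"] emb_fwd_var[of m "Suc (Suc n)"] by (simp_all del: fwd_var.simps add: add_ac)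
  then have "seed_mon k (int i) (int j) =
      emb \<iota> m (mon s 0 0 c d * (fwd_var (Suc n) ^ i * fwd_var (Suc (Suc n)) ^ j))"
    by (simp only: s emb.\<kappa>.mult emb.\<kappa>.power)
  then show ?thesis using supp_coeff_mult by (rule that)
qed

lemma seed_mon_below:
  assumes "k = m - 1 - int n"
  obtains t where "seed_mon k (int i) (int j) = emb \<iota> m t"
    and "supp t \<subseteq> prod.swap ` supp (fwd_var (Suc n) ^ j * fwd_var (Suc (Suc n)) ^ i)"
proof -
  obtain s c d where s: "seed_mon k (int i) (int j) = emb \<iota> m (mon s 0 0 c d) * cmon k i j"
    by (rule seed_mon_emb_any)
  have idx: "m + 1 - int (Suc n) = k + 1" "m + 1 - int (Suc (Suc n)) = k"
    using assms by simp_all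
  have "emb \<iota> m (reflect (fwd_var (Suc n))) = var (k + 1)" "emb \<iota> m (reflect (fwd_var (Suc (Suc n)))) = var k"
    by (simp_all only: emb_reflect_fwd_var idx)
  then have "seed_mon k (int i) (int j) =
      emb \<iota> m (mon s 0 0 c d * reflect (fwd_var (Suc n) ^ j * fwd_var (Suc (Suc n)) ^ i))"
    by (simp only: s emb.\<kappa>.mult emb.\<kappa>.power reflect_mult reflect_power pow_commute[symmetric])
  moreover have "supp (mon s 0 0 c d * reflect (fwd_var (Suc n) ^ j * fwd_var (Suc (Suc n)) ^ i)) \<subseteq>
      prod.swap ` supp (fwd_var (Suc n) ^ j * fwd_var (Suc (Suc n)) ^ i)"
    using supp_coeff_mult supp_reflect by (rule subset_trans)
  ultimately show ?thesis by (rule that)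
qed

lemma seed_mon_0_0: "seed_mon m 0 0 = 1"
  by (simp add: seed_mon_def one_eq_mon[symmetric] emb.\<kappa>.one)

text \<open>
  The exceptional cases of properness are powers of a variable shared with a neighbouring cluster, and
  the element \<open>1\<close>; these are cluster monomials of the cluster \<open>m\<close> as well.
\<close>

lemma proper_or_same_cluster:
  "(\<exists>i' j'. seed_mon k (int i) (int j) = seed_mon m (int i') (int j')) \<or>
   (\<exists>t. seed_mon k (int i) (int j) = emb \<iota> m t \<and> (\<forall>p q. 0 \<le> p \<longrightarrow> 0 \<le> q \<longrightarrow> (p, q) \<notin> supp t))"
proof -
  consider "k = m" | n where "k = m + 1 + int n" | n where "k = m - 1 - int n"
  proof -
    assume a: "k = m \<Longrightarrow> thesis" "\<And>n. k = m + 1 + int n \<Longrightarrow> thesis" "\<And>n. k = m - 1 - int n \<Longrightarrow> thesis"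
    consider "k = m" | "k > m" | "k < m" by linarith
    then show thesis
      by cases (use a(1) a(2)[of "nat (k - m - 1)"] a(3)[of "nat (m - 1 - k)"] in auto)
  qed
  then show ?thesis
  proof cases
    case 1
    then show ?thesis by blast
  next
    case (2 n)
    obtain t where t: "seed_mon k (int i) (int j) = emb \<iota> m t"
      "supp t \<subseteq> supp (fwd_var (Suc n) ^ i * fwd_var (Suc (Suc n)) ^ j)"
      using seed_mon_above[OF 2] by blast
    show ?thesis
    proof (cases "j = 0 \<and> (i = 0 \<or> n = 0)")
      case False
      with t(2) proper_cluster_monomial have "\<forall>p q. 0 \<le> p \<longrightarrow> 0 \<le> q \<longrightarrow> (p, q) \<notin> supp t" by blast
      with t(1) show ?thesis by blast
    next
      case True
      then have "seed_mon k (int i) (int j) = seed_mon m (int 0) (int i)"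
        using 2 seed_mon_next[of m "int i"] by (auto simp: seed_mon_0_0)
      then show ?thesis by blast
    qed
  next
    case (3 n)
    obtain t where t: "seed_mon k (int i) (int j) = emb \<iota> m t"
      "supp t \<subseteq> prod.swap ` supp (fwd_var (Suc n) ^ j * fwd_var (Suc (Suc n)) ^ i)"
      using seed_mon_below[OF 3] by blast
    show ?thesis
    proof (cases "i = 0 \<and> (j = 0 \<or> n = 0)")
      case False
      have "(p, q) \<notin> supp t" if "0 \<le> p" "0 \<le> q" for p q
      proof
        assume "(p, q) \<in> supp t"
        with t(2) have "(q, p) \<in> supp (fwd_var (Suc n) ^ j * fwd_var (Suc (Suc n)) ^ i)" by auto
        with proper_cluster_monomial that False show False by blast
      qed
      with t(1) show ?thesis by blast
    next
      case True
      then have "seed_mon k (int i) (int j) = seed_mon m (int j) (int 0)"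
        using 3 seed_mon_next[of "m - 1" "int j"] by (auto simp: seed_mon_0_0)
      then show ?thesis by blast
    qed
  qed
qed

lemma F_not_cluster_monomial:
  assumes "n \<ge> 1"
  shows "\<iota> (F n) \<noteq> seed_mon m (int i) (int j)"
proof
  assume "\<iota> (F n) = seed_mon m (int i) (int j)"
  then obtain c d where "emb \<iota> m (F n) = emb \<iota> m (mon 0 (int i) (int j) c d)"
    by (simp only: emb_F seed_mon_def)
  then have "F n = mon 0 (int i) (int j) c d" by (rule emb.\<kappa>.eqD)
  then have "(int i, int j) \<in> supp (F n)" by (simp only: supp_mon insertI1)
  from supp_F[OF assms this] assms show False by auto
qed

lemma disjoint_basis: "cluster_monomials \<iota> \<inter> F_elements \<iota> = {}"
proof -
  have "z \<notin> F_elements \<iota>" if "z \<in> cluster_monomials \<iota>" for z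
  proof
    from that obtain m i j where "z = seed_mon m (int i) (int j)" by (auto simp: cluster_monomials_eq)
    moreover assume "z \<in> F_elements \<iota>"
    then obtain n where "n \<ge> 1" "z = \<iota> (F n)" by (auto simp: F_elements_def)
    ultimately show False using F_not_cluster_monomial[of n m i j] by simp
  qed
  then show ?thesis by blast
qed

text \<open>
  The terms selected by \<open>P\<close> in the expansions at cluster \<open>m\<close> see nothing of \<open>b\<close>, except when
  \<open>b\<close> is the distinguished element \<open>b0\<close>, of which they see a single monomial with coefficient \<open>1\<close>. If this
  holds for all members of a finite set, then the coefficient of \<open>b0\<close> in a combination can be
  read off from its expansion.
\<close>

definition isolates :: "int \<Rightarrow> (int \<Rightarrow> int \<Rightarrow> bool) \<Rightarrow> 'f \<Rightarrow> 'f \<Rightarrow> bool" where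
  "isolates m P b0 b \<longleftrightarrow> (\<exists>t. b = emb \<iota> m t \<and>
     (if b = b0 then \<exists>r a b c d. part P t = mon r a b c d else part P t = 0))"

lemma isolates_sameI: "b = emb \<iota> m t \<Longrightarrow> part P t = mon r a b' c d \<Longrightarrow> isolates m P b b"
  unfolding isolates_def by (intro exI[of _ t]) (simp, blast)

lemma isolates_otherI: "b = emb \<iota> m t \<Longrightarrow> b \<noteq> b0 \<Longrightarrow> part P t = 0 \<Longrightarrow> isolates m P b0 b"
  unfolding isolates_def by auto

text \<open>
  A cluster monomial is isolated in its own cluster by its own exponents.
\<close>

lemma isolate_cluster_monomial:
  assumes "b \<in> atomic_basis_set \<iota>"
  shows "isolates m (\<lambda>p q. p = int i \<and> q = int j) (seed_mon m (int i) (int j)) b"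
proof (cases "b \<in> cluster_monomials \<iota>")
  case True
  then obtain k i' j' where b: "b = seed_mon k (int i') (int j')" by (auto simp: cluster_monomials_eq)
  from proper_or_same_cluster[of k i' j' m] show ?thesis
  proof (elim disjE exE conjE)
    fix i'' j'' assume "seed_mon k (int i') (int j') = seed_mon m (int i'') (int j'')"
    with b have b: "b = seed_mon m (int i'') (int j'')" by (simp only:)
    then obtain c d where cd: "b = emb \<iota> m (mon 0 (int i'') (int j'') c d)"
      by (simp only: seed_mon_def)
    show ?thesis
    proof (cases "i'' = i \<and> j'' = j")
      case True
      then have "part (\<lambda>p q. p = int i \<and> q = int j) (mon 0 (int i'') (int j'') c d) =
          mon 0 (int i'') (int j'') c d" by (simp add: part_mon)
      from isolates_sameI[OF cd this] b True show ?thesis by simp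
    next
      case False
      have "b \<noteq> seed_mon m (int i) (int j)"
      proof
        assume "b = seed_mon m (int i) (int j)"
        then obtain c' d' where "emb \<iota> m (mon 0 (int i'') (int j'') c d) = emb \<iota> m (mon 0 (int i) (int j) c' d')"
          by (simp only: cd seed_mon_def)
        then have "mon 0 (int i'') (int j'') c d = mon 0 (int i) (int j) c' d'" by (rule emb.\<kappa>.eqD)
        then have "supp (mon 0 (int i'') (int j'') c d) = supp (mon 0 (int i) (int j) c' d')" by simp
        with False show False by (simp add: supp_mon)
      qed
      moreover have "part (\<lambda>p q. p = int i \<and> q = int j) (mon 0 (int i'') (int j'') c d) = 0"
        using False by (auto simp: part_mon)
      ultimately show ?thesis by (rule isolates_otherI[OF cd])
    qed
  next
    fix t assume t: "seed_mon k (int i') (int j') = emb \<iota> m t" "\<forall>p q. 0 \<le> p \<longrightarrow> 0 \<le> q \<longrightarrow> (p, q) \<notin> supp t"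
    have "b \<noteq> seed_mon m (int i) (int j)"
    proof
      assume "b = seed_mon m (int i) (int j)"
      then have "emb \<iota> m t = seed_mon m (int i) (int j)" by (simp only: b t(1))
      then obtain c d where "emb \<iota> m t = emb \<iota> m (mon 0 (int i) (int j) c d)"
        by (simp only: seed_mon_def)
      then have "t = mon 0 (int i) (int j) c d" by (rule emb.\<kappa>.eqD)
      then have "(int i, int j) \<in> supp t" by (simp add: supp_mon)
      with t(2) show False by simp
    qed
    moreover have "part (\<lambda>p q. p = int i \<and> q = int j) t = 0"
      using t(2) by (intro part_eq_0) auto
    ultimately show ?thesis using b t(1) by (intro isolates_otherI) simp_all
  qed
next
  case False
  then obtain n where n: "n \<ge> 1" "b = \<iota> (F n)"
    using assms by (auto simp: atomic_basis_set_def F_elements_def)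
  then have "b \<noteq> seed_mon m (int i) (int j)" using F_not_cluster_monomial by simp
  moreover have "part (\<lambda>p q. p = int i \<and> q = int j) (F n) = 0"
    using supp_F[OF n(1)] n(1) by (intro part_eq_0) fastforce
  ultimately show ?thesis using n(2) emb_F[of m n] by (intro isolates_otherI[of b m "F n"]) simp_all
qed

text \<open>
  The corner \<open>(n, - n)\<close> of \<open>F n\<close> is met by no cluster monomial to the right of the cluster \<open>m\<close>, and
  by no other \<open>F n'\<close>. For a finite set of basis elements, \<open>m\<close> can be chosen far enough to the left.
\<close>

lemma isolate_F:
  assumes "n \<ge> 1" and "b \<in> atomic_basis_set \<iota>"
    and "b \<in> cluster_monomials \<iota> \<Longrightarrow> \<exists>k i j. m < k \<and> b = seed_mon k (int i) (int j)"
  shows "isolates m (\<lambda>p q. p = int n \<and> q = - int n) (\<iota> (F n)) b"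
proof (cases "b \<in> cluster_monomials \<iota>")
  case True
  with assms(3) obtain k i j where k: "m < k" and b: "b = seed_mon k (int i) (int j)" by blast
  define l where "l = nat (k - m - 1)"
  have "k = m + 1 + int l" using k by (simp add: l_def)
  then obtain t where t: "b = emb \<iota> m t" "supp t \<subseteq> supp (fwd_var (Suc l) ^ i * fwd_var (Suc (Suc l)) ^ j)"
    unfolding b by (rule seed_mon_above)
  have "b \<noteq> \<iota> (F n)" using F_not_cluster_monomial[OF assms(1), of k i j] b by simp
  moreover have "part (\<lambda>p q. p = int n \<and> q = - int n) t = 0"
    using t(2) antidiagonal_cluster_monomial[of "int n" l i j] assms(1)
    by (intro part_eq_0) auto
  ultimately show ?thesis by (intro isolates_otherI[OF t(1)])
next
  case False
  then obtain n' where n': "n' \<ge> 1" "b = \<iota> (F n')"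
    using assms(2) by (auto simp: atomic_basis_set_def F_elements_def)
  show ?thesis
  proof (cases "n' = n")
    case True
    have "\<iota> (F n) = emb \<iota> m (F n)" by (simp only: emb_F)
    from isolates_sameI[OF this part_F[OF assms(1)]] show ?thesis by (simp only: n'(2) True)
  next
    case False
    have "part (\<lambda>p q. p = int n \<and> q = - int n) (F n') = 0"
      using supp_F[OF n'(1)] n'(1) False assms(1) by (intro part_eq_0) fastforce
    moreover from this have "b \<noteq> \<iota> (F n)"
      using part_F[OF assms(1)] by (auto simp: n'(2) eq_iff mon_def)
    ultimately show ?thesis
      using n'(2) emb_F[of m n'] by (intro isolates_otherI[of b m "F n'"]) simp_all
  qed
qed

lemma cluster_monomials_far:
  assumes "finite B'"
  shows "\<exists>m. \<forall>b \<in> B' \<inter> cluster_monomials \<iota>. \<exists>k i j. m < k \<and> b = seed_mon k (int i) (int j)"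
  using assms
proof (induction B' rule: finite_induct)
  case (insert b B')
  then obtain m where m: "\<forall>b \<in> B' \<inter> cluster_monomials \<iota>. \<exists>k i j. m < k \<and> b = seed_mon k (int i) (int j)"
    by blast
  show ?case
  proof (cases "b \<in> cluster_monomials \<iota>")
    case True
    then obtain k i j where b: "b = seed_mon k (int i) (int j)" by (auto simp: cluster_monomials_eq)
    have "\<exists>k i j. min m (k0 - 1) < k \<and> c = seed_mon k (int i) (int j)"
      if "\<exists>k i j. m < k \<and> c = seed_mon k (int i) (int j)" for c k0
      using that by (blast intro: min.strict_coboundedI1)
    moreover have "min m (k - 1) < k" by simp
    ultimately show ?thesis using m b by (intro exI[of _ "min m (k - 1)"]) blast
  qed (use m in auto)
qed simp

lemma isolation:
  assumes "finite B'" and "B' \<subseteq> atomic_basis_set \<iota>" and "b0 \<in> B'"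
  shows "\<exists>m P. \<forall>b \<in> B'. isolates m P b0 b"
proof (cases "b0 \<in> cluster_monomials \<iota>")
  case True
  then obtain m i j where "b0 = seed_mon m (int i) (int j)" by (auto simp: cluster_monomials_eq)
  with isolate_cluster_monomial assms(2) show ?thesis by blast
next
  case False
  then obtain n where n: "n \<ge> 1" "b0 = \<iota> (F n)"
    using assms(2,3) by (auto simp: atomic_basis_set_def F_elements_def)
  from cluster_monomials_far[OF assms(1)] obtain m
    where "\<forall>b \<in> B' \<inter> cluster_monomials \<iota>. \<exists>k i j. m < k \<and> b = seed_mon k (int i) (int j)" by blast
  with isolate_F[OF n(1)] assms(2) show ?thesis unfolding n(2) by blast
qed

text \<open>
  The coefficient is the selected part of the expansion times the inverse of one monomial. This map
  preserves both zero and positivity, so that independence and atomicity follow at once.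
\<close>

lemma coefficient_extraction:
  assumes B': "finite B'" "B' \<subseteq> atomic_basis_set \<iota>" "b0 \<in> B'" and c: "\<forall>b\<in>B'. c b \<in> coeffs"
  obtains m f where "\<And>p. (\<Sum>b\<in>B'. c b * b) = emb \<iota> m p \<Longrightarrow> c b0 = emb \<iota> m (f p)"
    and "\<And>p. nonneg p \<Longrightarrow> nonneg (f p)" and "f 0 = 0"
proof -
  from isolation[OF B'] obtain m P where iso: "\<forall>b \<in> B'. isolates m P b0 b" by blast
  then have "\<forall>b \<in> B'. \<exists>t. b = emb \<iota> m t \<and>
     (if b = b0 then \<exists>r a b c d. part P t = mon r a b c d else part P t = 0)"
    by (simp add: isolates_def)
  then obtain t where t: "\<And>b. b \<in> B' \<Longrightarrow> b = emb \<iota> m (t b)"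
    and t0: "\<exists>r a b c d. part P (t b0) = mon r a b c d"
    and t1: "\<And>b. b \<in> B' \<Longrightarrow> b \<noteq> b0 \<Longrightarrow> part P (t b) = 0"
    using B'(3) by (metis (no_types, lifting))
  from t0 obtain r a b' c' d where mon: "part P (t b0) = mon r a b' c' d" by blast
  from c have "\<forall>b\<in>B'. \<exists>s. s \<in> ZP \<and> c b = emb \<iota> m s" using emb_ZP[of m] by blast
  then obtain e where e: "\<And>b. b \<in> B' \<Longrightarrow> e b \<in> ZP" "\<And>b. b \<in> B' \<Longrightarrow> c b = emb \<iota> m (e b)"
    by metis
  define f where "f = (\<lambda>p. part P p * mon (- r) (- a) (- b') (- c') (- d))"
  have "c b0 = emb \<iota> m (f p)" if "(\<Sum>b\<in>B'. c b * b) = emb \<iota> m p" for p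
  proof -
    have "(\<Sum>b\<in>B'. c b * b) = (\<Sum>b\<in>B'. emb \<iota> m (e b * t b))"
      using t e by (intro sum.cong refl) (simp add: emb.\<kappa>.mult)
    also have "\<dots> = emb \<iota> m (\<Sum>b\<in>B'. e b * t b)"
      by (simp add: emb.\<kappa>.sum)
    finally have "p = (\<Sum>b\<in>B'. e b * t b)" using that emb.\<kappa>.eqD by simp
    then have "part P p = (\<Sum>b\<in>B'. part P (e b * t b))" by (simp add: part_sum B'(1))
    also have "\<dots> = (\<Sum>b\<in>B'. if b = b0 then e b0 * mon r a b' c' d else 0)"
      using e(1) t1 mon by (intro sum.cong refl) (auto simp: part_ZP_mult)
    also have "\<dots> = e b0 * mon r a b' c' d" using B' by simp
    finally have "f p = e b0" by (simp add: f_def mult.assoc mon_inverse)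
    then show ?thesis using e(2)[OF B'(3)] by simp
  qed
  moreover have "nonneg p \<Longrightarrow> nonneg (f p)" for p
    by (simp add: f_def nonneg_mult nonneg_part nonneg_mon)
  moreover have "f 0 = 0" by (simp add: f_def part_0)
  ultimately show ?thesis by (rule that)
qed

lemma basis_independent: "left_independent coeffs (atomic_basis_set \<iota>)"
  unfolding left_independent_def
proof (intro allI impI ballI, elim conjE)
  fix B' c b
  assume B': "finite B'" "B' \<subseteq> atomic_basis_set \<iota>" "b \<in> B'" and c: "\<forall>b\<in>B'. c b \<in> coeffs"
    and 0: "(\<Sum>b\<in>B'. c b * b) = 0"
  obtain m f where "\<And>p. (\<Sum>b\<in>B'. c b * b) = emb \<iota> m p \<Longrightarrow> c b = emb \<iota> m (f p)" "f 0 = 0"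
    by (rule coefficient_extraction[OF B' c]) blast
  from this(1)[of 0] this(2) 0 show "c b = 0" by (simp add: emb.\<kappa>.zero)
qed

lemma positive_imp_combination:
  assumes "z \<in> positive_elements \<iota>"
  shows "z \<in> left_combinations coeffs_pos (atomic_basis_set \<iota>)"
proof -
  from assms have "z \<in> basis_span" and pos: "\<And>m. z \<in> positive_at m"
    by (auto simp: positive_elements_eq span_eq_cluster_algebra)
  then obtain B' c where z: "z = (\<Sum>b\<in>B'. c b * b)" and B': "finite B'" "B' \<subseteq> atomic_basis_set \<iota>"
    and c: "\<forall>b\<in>B'. c b \<in> coeffs"
    unfolding left_combinations_def by blast
  have "c b \<in> coeffs_pos" if b: "b \<in> B'" for b
  proof -
    obtain m f where f: "\<And>p. (\<Sum>b\<in>B'. c b * b) = emb \<iota> m p \<Longrightarrow> c b = emb \<iota> m (f p)"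
      "\<And>p. nonneg p \<Longrightarrow> nonneg (f p)"
      by (rule coefficient_extraction[OF B' b c]) blast
    from pos[of m] obtain p where p: "nonneg p" "z = emb \<iota> m p" by (auto simp: positive_at_def)
    have cb: "c b = emb \<iota> m (f p)" using f(1)[of p] z p(2) by simp
    from c b emb_ZP[of m] obtain s where s: "s \<in> ZP" "c b = emb \<iota> m s" by blast
    have "f p \<in> ZP_nonneg"
      using s cb f(2)[OF p(1)] emb.\<kappa>.eqD[of m s "f p"] by (simp add: ZP_nonneg_iff)
    then show ?thesis unfolding cb by (rule coeffs_pos_emb)
  qed
  then show ?thesis unfolding left_combinations_def z using B' by blast
qed

section \<open>Bar-invariance\<close>

text \<open>
  The product of powers of two commuting bar-invariant elements is bar-invariant. A monomial in the
  coefficients \<open>q\<close>-commutes with it, and the power of \<open>q\<close> in a seed monomial is the one that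
  compensates for the reversal of this product.
\<close>

lemma bar_invariant_seed_mon: "bar_invariant \<iota> (seed_mon m (int i) (int j))"
proof -
  obtain N where N: "bar N = N" "\<iota> N = cmon m i j"
  proof (cases "m \<ge> 0")
    case True
    define n where "n = nat m"
    have m: "m = int n" using True by (simp add: n_def)
    have comm: "fwd_var (Suc n) ^ j * fwd_var n ^ i = fwd_var n ^ i * fwd_var (Suc n) ^ j"
    proof (rule eqD)
      show "\<iota> (fwd_var (Suc n) ^ j * fwd_var n ^ i) = \<iota> (fwd_var n ^ i * fwd_var (Suc n) ^ j)"
        using pow_commute[of "int n" j i] emb_fwd_var[of 0 n] emb_fwd_var[of 0 "Suc n"]
        by (simp add: emb_0 mult power add_ac)
    qed
    show ?thesis
    proof (rule that)
      show "bar (fwd_var n ^ i * fwd_var (Suc n) ^ j) = fwd_var n ^ i * fwd_var (Suc n) ^ j"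
        by (simp only: bar_mult bar_power bar_fwd_var comm)
      show "\<iota> (fwd_var n ^ i * fwd_var (Suc n) ^ j) = cmon m i j"
        using emb_fwd_var[of 0 n] emb_fwd_var[of 0 "Suc n"] by (simp add: emb_0 mult power add_ac m)
    qed
  next
    case False
    define n where "n = nat (- m)"
    have m: "m = - int n" using False by (simp add: n_def)
    have var: "\<iota> (reflect (fwd_var (Suc n))) = var m" "\<iota> (reflect (fwd_var n)) = var (m + 1)"
      using emb_reflect_fwd_var[of 0 "Suc n"] emb_reflect_fwd_var[of 0 n] by (simp_all add: emb_0 m)
    have comm: "reflect (fwd_var n) ^ j * reflect (fwd_var (Suc n)) ^ i = reflect (fwd_var (Suc n)) ^ i * reflect (fwd_var n) ^ j"
    proof (rule eqD)
      show "\<iota> (reflect (fwd_var n) ^ j * reflect (fwd_var (Suc n)) ^ i) = \<iota> (reflect (fwd_var (Suc n)) ^ i * reflect (fwd_var n) ^ j)"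
        by (simp only: mult power var pow_commute)
    qed
    show ?thesis
    proof (rule that)
      show "bar (reflect (fwd_var (Suc n)) ^ i * reflect (fwd_var n) ^ j) = reflect (fwd_var (Suc n)) ^ i * reflect (fwd_var n) ^ j"
        by (simp only: bar_mult bar_power bar_reflect bar_fwd_var comm)
      show "\<iota> (reflect (fwd_var (Suc n)) ^ i * reflect (fwd_var n) ^ j) = cmon m i j"
        by (simp only: mult power var)
    qed
  qed
  obtain s c d where s: "s = - (c * int i + d * int j)"
    "seed_mon m (int i) (int j) = emb \<iota> m (mon s 0 0 c d) * cmon m i j"
    by (rule seed_mon_emb_coeff)
  from emb_coeff[of m c d 0] obtain c' d'
    where c': "\<And>s. emb \<iota> m (mon s 0 0 c d) = \<iota> (mon s 0 0 c' d')" by (auto simp: emb_0)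
  have "N * mon (- s) 0 0 c' d' = mon s 0 0 c' d' * N"
  proof (rule eqD)
    have "mon 0 (int i) (int j) 0 0 * mon (- s) 0 0 c d = mon s 0 0 c d * mon 0 (int i) (int j) 0 0"
      by (simp add: mon_mult s(1) algebra_simps)
    then have "cmon m i j * emb \<iota> m (mon (- s) 0 0 c d) = emb \<iota> m (mon s 0 0 c d) * cmon m i j"
      by (simp only: emb_mon_nat[symmetric] emb.\<kappa>.mult[symmetric])
    then show "\<iota> (N * mon (- s) 0 0 c' d') = \<iota> (mon s 0 0 c' d' * N)"
      by (simp only: mult N(2) c')
  qed
  then have "bar (mon s 0 0 c' d' * N) = mon s 0 0 c' d' * N"
    by (simp only: bar_mult bar_mon N(1))
  moreover have "seed_mon m (int i) (int j) = \<iota> (mon s 0 0 c' d' * N)"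
    by (simp only: s(2) c' mult N(2))
  ultimately show ?thesis unfolding bar_invariant_def by blast
qed

lemma bar_invariant_basis: "b \<in> atomic_basis_set \<iota> \<Longrightarrow> bar_invariant \<iota> b"
  using bar_invariant_seed_mon bar_F
  by (auto simp: atomic_basis_set_def cluster_monomials_eq F_elements_def bar_invariant_def)

end

section \<open>The atomic basis\<close>

theorem theorem4p6:
  fixes \<iota> :: "qtorus \<Rightarrow> 'f::division_ring"
  assumes "is_fraction_skew_field \<iota>"
  shows "cluster_monomials \<iota> \<inter> F_elements \<iota> = {} \<and>
         is_left_basis (\<iota> ` ZP) (atomic_basis_set \<iota>) (cluster_algebra \<iota>) \<and>
         (\<forall>b \<in> atomic_basis_set \<iota>. bar_invariant \<iota> b) \<and>
         positive_elements \<iota> = left_combinations (\<iota> ` ZP_nonneg) (atomic_basis_set \<iota>)"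
proof -
  interpret cluster_chain \<iota>
    using assms by unfold_locales (auto simp: is_fraction_skew_field_def dest: injD)
  show ?thesis
    unfolding is_left_basis_def
    using disjoint_basis basis_subset basis_independent span_eq_cluster_algebra bar_invariant_basis
      positive_imp_combination combinations_positive
    by blast
qed

end
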